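(* The functor $\Gamma_I:\mathcal{PUALG}\to\mathcal{PMV}$, given on objects by $\Gamma_I(G,u,I)=(\Gamma(G,u),I\cap[0,u])$ and on morphisms $f:(G_1,u_1,I_1)\to(G_2,u_2,I_2)$ by $\Gamma_I(f)(x)=f(x)$ for $x\in\Gamma(G_1,u_1)$, defines a categorical equivalence of the category $\mathcal{PUALG}$ and the category $\mathcal{PMV}$.
   Context: An $MV$-algebra is an algebra $(A;\oplus,',0,1)$ of type $(2,1,0,0)$ such that $(A;\oplus,0)$ is a commutative monoid and, for all $x,y\in A$, $x''=x$, $x\oplus 1=1$ and $x\oplus(x\oplus y')'=y\oplus(y\oplus x')'$; it is ordered by $x\le y\Leftrightarrow x'\oplus y=1$. An ideal of an $MV$-algebra is a non-empty down-closed subset closed under $\oplus$; a maximal ideal is a proper ideal not properly contained in another proper ideal. An ideal $J$ of an $MV$-algebra has enough idempotent elements if for each $x\in J$ there is $a\in J$ with $a\oplus a=a$ and $x\le a$. A unital Abelian $\ell$-group $(G,u)$ is an Abelian lattice-ordered group $G$ with a fixed strong unit $u$ (for each $g\in G$ there is $n\in\mathbb N$ with $g\le nu$); $G^+=\{g\in G: g\ge 0\}$. $\Gamma(G,u)=([0,u];\oplus,',0,u)$ is the $MV$-algebra with $x\oplus y=(x+y)\wedge u$ and $x'=u-x$. An $\ell$-ideal of $(G,u)$ is a convex $\ell$-subgroup of $G$; it is maximal if it is a maximal proper $\ell$-ideal of $(G,u)$ (not containing $u$). For an $\ell$-ideal $I$, put $I^+=\{x\in I:x\ge0\}$ and $I^u=\{nu-y\mid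 n\ge1,\ y\in I,\ 0\le y<nu\}$. $\mathcal{PUALG}$ is the category whose objects are triples $(G,u,I)$ such that $(G,u)$ is a unital Abelian $\ell$-group and $I$ is a fixed maximal $\ell$-ideal of $(G,u)$ such that $G^+=I^+\cup I^u$ and the ideal $I_0=I\cap[0,u]$ of $\Gamma(G,u)$ has enough idempotent elements. Morphisms $(G_1,u_1,I_1)\to(G_2,u_2,I_2)$ are homomorphisms of unital $\ell$-groups ($\ell$-group homomorphisms $f$ with $f(u_1)=u_2$) such that $f(I_1)\subseteq I_2$. $\mathcal{PMV}$ is the category whose objects are couples $(N,I)$, where $N$ is an $MV$-algebra and $I$ is a fixed maximal ideal of $N$ having enough idempotent elements such that $N=I\cup I'$, where $I'=\{x':x\in I\}$. Morphisms $(N_1,I_1)\to(N_2,I_2)$ are $MV$-homomorphisms $\phi:N_1\to N_2$ with $\phi(I_1)\subseteq I_2$.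
   Formalization: In I^u the condition 0≤y is dropped (with it every object of PUALG is (Z,1,{0}) up to isomorphism and the claim fails); the axiom 0'=1 is added to MV-algebras, as the listed axioms do not imply it; all carriers are subsets of an arbitrary infinite universe. *)

theory Defs
  imports "HOL-Algebra.Group"
begin

section \<open>Categories, functors and equivalences\<close>

text \<open>
  Categories are given by hom-sets, which need not be disjoint. Therefore composition takes the
  three objects involved as arguments (\<open>Comp C X Y Z g f\<close> composes \<open>f : X \<rightarrow> Y\<close> with
  \<open>g : Y \<rightarrow> Z\<close>), and the arrow part of a functor takes source and target as arguments.
\<close>

record ('o, 'm) category =
  Obj :: "'o set"
  Hom :: "'o \<Rightarrow> 'o \<Rightarrow> 'm set"
  Id :: "'o \<Rightarrow> 'm"
  Comp :: "'o \<Rightarrow> 'o \<Rightarrow> 'o \<Rightarrow> 'm \<Rightarrow> 'm \<Rightarrow> 'm"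

definition is_category :: "('o, 'm) category \<Rightarrow> bool" where
  "is_category C \<longleftrightarrow>
     (\<forall>X \<in> Obj C. Id C X \<in> Hom C X X) \<and>
     (\<forall>X \<in> Obj C. \<forall>Y \<in> Obj C. \<forall>Z \<in> Obj C. \<forall>f \<in> Hom C X Y. \<forall>g \<in> Hom C Y Z.
        Comp C X Y Z g f \<in> Hom C X Z) \<and>
     (\<forall>X \<in> Obj C. \<forall>Y \<in> Obj C. \<forall>f \<in> Hom C X Y.
        Comp C X X Y f (Id C X) = f \<and> Comp C X Y Y (Id C Y) f = f) \<and>
     (\<forall>W \<in> Obj C. \<forall>X \<in> Obj C. \<forall>Y \<in> Obj C. \<forall>Z \<in> Obj C.
        \<forall>f \<in> Hom C W X. \<forall>g \<in> Hom C X Y. \<forall>h \<in> Hom C Y Z.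
          Comp C W Y Z h (Comp C W X Y g f) = Comp C W X Z (Comp C X Y Z h g) f)"

record ('o, 'm, 'p, 'n) cat_functor =
  fobj :: "'o \<Rightarrow> 'p"
  fmor :: "'o \<Rightarrow> 'o \<Rightarrow> 'm \<Rightarrow> 'n"

definition is_functor ::
    "('o, 'm) category \<Rightarrow> ('p, 'n) category \<Rightarrow> ('o, 'm, 'p, 'n) cat_functor \<Rightarrow> bool" where
  "is_functor C D F \<longleftrightarrow>
     is_category C \<and> is_category D \<and>
     (\<forall>X \<in> Obj C. fobj F X \<in> Obj D) \<and>
     (\<forall>X \<in> Obj C. \<forall>Y \<in> Obj C. \<forall>f \<in> Hom C X Y. fmor F X Y f \<in> Hom D (fobj F X) (fobj F Y)) \<and>
     (\<forall>X \<in> Obj C. fmor F X X (Id C X) = Id D (fobj F X)) \<and>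
     (\<forall>X \<in> Obj C. \<forall>Y \<in> Obj C. \<forall>Z \<in> Obj C. \<forall>f \<in> Hom C X Y. \<forall>g \<in> Hom C Y Z.
        fmor F X Z (Comp C X Y Z g f) =
          Comp D (fobj F X) (fobj F Y) (fobj F Z) (fmor F Y Z g) (fmor F X Y f))"

definition id_functor :: "('o, 'm, 'o, 'm) cat_functor" where
  "id_functor = \<lparr>fobj = \<lambda>X. X, fmor = \<lambda>X Y f. f\<rparr>"

definition comp_functor ::
    "('p, 'n, 'q, 'l) cat_functor \<Rightarrow> ('o, 'm, 'p, 'n) cat_functor \<Rightarrow> ('o, 'm, 'q, 'l) cat_functor" where
  "comp_functor G F =
     \<lparr>fobj = \<lambda>X. fobj G (fobj F X),
      fmor = \<lambda>X Y f. fmor G (fobj F X) (fobj F Y) (fmor F X Y f)\<rparr>"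

definition isomorphism :: "('o, 'm) category \<Rightarrow> 'o \<Rightarrow> 'o \<Rightarrow> 'm \<Rightarrow> bool" where
  "isomorphism C X Y f \<longleftrightarrow> f \<in> Hom C X Y \<and>
     (\<exists>g \<in> Hom C Y X. Comp C X Y X g f = Id C X \<and> Comp C Y X Y f g = Id C Y)"

definition natural_isomorphism ::
    "('o, 'm) category \<Rightarrow> ('p, 'n) category \<Rightarrow> ('o, 'm, 'p, 'n) cat_functor \<Rightarrow>
     ('o, 'm, 'p, 'n) cat_functor \<Rightarrow> ('o \<Rightarrow> 'n) \<Rightarrow> bool" where
  "natural_isomorphism C D F G \<eta> \<longleftrightarrow>
     is_functor C D F \<and> is_functor C D G \<and>
     (\<forall>X \<in> Obj C. isomorphism D (fobj F X) (fobj G X) (\<eta> X)) \<and>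
     (\<forall>X \<in> Obj C. \<forall>Y \<in> Obj C. \<forall>f \<in> Hom C X Y.
        Comp D (fobj F X) (fobj F Y) (fobj G Y) (\<eta> Y) (fmor F X Y f) =
        Comp D (fobj F X) (fobj G X) (fobj G Y) (fmor G X Y f) (\<eta> X))"

definition categorical_equivalence ::
    "('o, 'm) category \<Rightarrow> ('p, 'n) category \<Rightarrow> ('o, 'm, 'p, 'n) cat_functor \<Rightarrow> bool" where
  "categorical_equivalence C D F \<longleftrightarrow>
     is_functor C D F \<and>
     (\<exists>G \<eta> \<epsilon>. is_functor D C G \<and>
        natural_isomorphism C C id_functor (comp_functor G F) \<eta> \<and>
        natural_isomorphism D D (comp_functor F G) id_functor \<epsilon>)"


section \<open>MV-algebras\<close>

record 'a mv = "'a partial_object" +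
  mvplus :: "'a \<Rightarrow> 'a \<Rightarrow> 'a" (infixl \<open>\<oplus>\<index>\<close> 65)
  mvneg :: "'a \<Rightarrow> 'a" (\<open>\<sim>\<index> _\<close> [81] 80)
  mvzero :: 'a (\<open>\<zero>\<index>\<close>)
  mvunit :: 'a (\<open>\<bbbone>\<index>\<close>)

text \<open>
  The axiom \<open>neg_zero\<close> is needed when the unit is a separate constant: on \<open>{0, 1}\<close> with
  \<open>x \<oplus> y = max x y\<close> and \<open>\<sim> x = x\<close> all the other axioms hold.
\<close>

locale mv_algebra =
  fixes N (structure)
  assumes comm_monoid: "comm_monoid \<lparr>carrier = carrier N, mult = mvplus N, one = mvzero N\<rparr>"
    and neg_closed: "x \<in> carrier N \<Longrightarrow> \<sim> x \<in> carrier N"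
    and unit_closed: "\<bbbone> \<in> carrier N"
    and neg_neg: "x \<in> carrier N \<Longrightarrow> \<sim> (\<sim> x) = x"
    and plus_unit: "x \<in> carrier N \<Longrightarrow> x \<oplus> \<bbbone> = \<bbbone>"
    and neg_zero: "\<sim> \<zero> = \<bbbone>"
    and plus_neg_plus: "\<lbrakk>x \<in> carrier N; y \<in> carrier N\<rbrakk> \<Longrightarrow>
           x \<oplus> (\<sim> (x \<oplus> (\<sim> y))) = y \<oplus> (\<sim> (y \<oplus> (\<sim> x)))"

definition mv_le :: "'a mv \<Rightarrow> 'a \<Rightarrow> 'a \<Rightarrow> bool" where
  "mv_le N x y \<longleftrightarrow> (\<sim>\<^bsub>N\<^esub> x) \<oplus>\<^bsub>N\<^esub> y = \<bbbone>\<^bsub>N\<^esub>"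

definition mv_ideal :: "'a mv \<Rightarrow> 'a set \<Rightarrow> bool" where
  "mv_ideal N J \<longleftrightarrow> J \<subseteq> carrier N \<and> J \<noteq> {} \<and>
     (\<forall>x \<in> J. \<forall>y \<in> carrier N. mv_le N y x \<longrightarrow> y \<in> J) \<and>
     (\<forall>x \<in> J. \<forall>y \<in> J. x \<oplus>\<^bsub>N\<^esub> y \<in> J)"

definition maximal_mv_ideal :: "'a mv \<Rightarrow> 'a set \<Rightarrow> bool" where
  "maximal_mv_ideal N J \<longleftrightarrow> mv_ideal N J \<and> J \<noteq> carrier N \<and>
     (\<forall>K. mv_ideal N K \<and> K \<noteq> carrier N \<longrightarrow> \<not> J \<subset> K)"

definition enough_idempotents :: "'a mv \<Rightarrow> 'a set \<Rightarrow> bool" where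
  "enough_idempotents N J \<longleftrightarrow> (\<forall>x \<in> J. \<exists>a \<in> J. a \<oplus>\<^bsub>N\<^esub> a = a \<and> mv_le N x a)"

definition mv_hom :: "'a mv \<Rightarrow> 'b mv \<Rightarrow> ('a \<Rightarrow> 'b) set" where
  "mv_hom M N = {h \<in> carrier M \<rightarrow> carrier N.
     (\<forall>x \<in> carrier M. \<forall>y \<in> carrier M. h (x \<oplus>\<^bsub>M\<^esub> y) = h x \<oplus>\<^bsub>N\<^esub> h y) \<and>
     (\<forall>x \<in> carrier M. h (\<sim>\<^bsub>M\<^esub> x) = \<sim>\<^bsub>N\<^esub> (h x)) \<and>
     h \<zero>\<^bsub>M\<^esub> = \<zero>\<^bsub>N\<^esub> \<and> h \<bbbone>\<^bsub>M\<^esub> = \<bbbone>\<^bsub>N\<^esub>}"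


section \<open>Unital Abelian lattice-ordered groups\<close>

text \<open>
  The group operation is written multiplicatively, as in HOL-Algebra: \<open>x + y\<close> is \<open>x \<otimes> y\<close>,
  \<open>0\<close> is \<open>\<one>\<close>, \<open>x - y\<close> is \<open>x \<otimes> inv y\<close>, and \<open>n x\<close> is \<open>x [^] n\<close>.
\<close>

record 'a lgroup = "'a monoid" +
  lg_le :: "'a \<Rightarrow> 'a \<Rightarrow> bool" (infixl \<open>\<preceq>\<index>\<close> 50)

definition lg_order :: "'a lgroup \<Rightarrow> 'a gorder" where
  "lg_order G = \<lparr>carrier = carrier G, eq = (=), le = lg_le G\<rparr>"

abbreviation lg_join :: "'a lgroup \<Rightarrow> 'a \<Rightarrow> 'a \<Rightarrow> 'a" where
  "lg_join G x y \<equiv> join (lg_order G) x y"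

abbreviation lg_meet :: "'a lgroup \<Rightarrow> 'a \<Rightarrow> 'a \<Rightarrow> 'a" where
  "lg_meet G x y \<equiv> meet (lg_order G) x y"

locale abelian_lgroup = comm_group G for G :: "'a lgroup" (structure) +
  assumes lattice: "lattice (lg_order G)"
    and translation: "\<lbrakk>x \<in> carrier G; y \<in> carrier G; z \<in> carrier G; x \<preceq> y\<rbrakk> \<Longrightarrow> x \<otimes> z \<preceq> y \<otimes> z"

locale unital_lgroup = abelian_lgroup G for G :: "'a lgroup" (structure) and u :: 'a +
  assumes strong_unit_closed: "u \<in> carrier G"
    and strong_unit: "g \<in> carrier G \<Longrightarrow> \<exists>n::nat. g \<preceq> u [^] n"

definition positive_cone :: "'a lgroup \<Rightarrow> 'a set" where
  "positive_cone G = {x \<in> carrier G. \<one>\<^bsub>G\<^esub> \<preceq>\<^bsub>G\<^esub> x}"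

definition l_ideal :: "'a lgroup \<Rightarrow> 'a set \<Rightarrow> bool" where
  "l_ideal G I \<longleftrightarrow> subgroup I G \<and>
     (\<forall>x \<in> I. \<forall>y \<in> I. lg_join G x y \<in> I \<and> lg_meet G x y \<in> I) \<and>
     (\<forall>x \<in> I. \<forall>z \<in> I. \<forall>y \<in> carrier G. x \<preceq>\<^bsub>G\<^esub> y \<and> y \<preceq>\<^bsub>G\<^esub> z \<longrightarrow> y \<in> I)"

text \<open>For a strong unit \<open>u\<close>, an \<open>\<ell>\<close>-ideal is proper iff it does not contain \<open>u\<close>.\<close>

definition maximal_l_ideal :: "'a lgroup \<Rightarrow> 'a \<Rightarrow> 'a set \<Rightarrow> bool" where
  "maximal_l_ideal G u I \<longleftrightarrow> l_ideal G I \<and> I \<noteq> carrier G \<and> u \<notin> I \<and>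
     (\<forall>J. l_ideal G J \<and> J \<noteq> carrier G \<longrightarrow> \<not> I \<subset> J)"

definition lower_part :: "'a lgroup \<Rightarrow> 'a set \<Rightarrow> 'a set" where
  "lower_part G I = {x \<in> I. \<one>\<^bsub>G\<^esub> \<preceq>\<^bsub>G\<^esub> x}"

text \<open>
  The definition of \<open>I\<^sup>u\<close> in the source carries the additional restriction \<open>0 \<le> y\<close>. This has
  to be dropped: \<open>u + y\<close> with \<open>0 < y \<in> I\<close> is \<open>u - (- y)\<close>, and under the restriction the condition
  \<open>G\<^sup>+ = I\<^sup>+ \<union> I\<^sup>u\<close> forces \<open>I = {0}\<close>, i.e. only \<open>(\<int>, 1, {0})\<close> is left up to
  isomorphism, and the equivalence fails; see \<open>positive_upper_part_trivial\<close> below.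
\<close>

definition upper_part :: "'a lgroup \<Rightarrow> 'a \<Rightarrow> 'a set \<Rightarrow> 'a set" where
  "upper_part G u I = {u [^]\<^bsub>G\<^esub> n \<otimes>\<^bsub>G\<^esub> inv\<^bsub>G\<^esub> y | (n::nat) y.
     1 \<le> n \<and> y \<in> I \<and> y \<preceq>\<^bsub>G\<^esub> u [^]\<^bsub>G\<^esub> n \<and> y \<noteq> u [^]\<^bsub>G\<^esub> n}"

definition lgroup_hom :: "'a lgroup \<Rightarrow> 'b lgroup \<Rightarrow> ('a \<Rightarrow> 'b) set" where
  "lgroup_hom G H = {f \<in> hom G H. \<forall>x \<in> carrier G. \<forall>y \<in> carrier G.
     f (lg_join G x y) = lg_join H (f x) (f y) \<and> f (lg_meet G x y) = lg_meet H (f x) (f y)}"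

definition Gamma :: "'a lgroup \<Rightarrow> 'a \<Rightarrow> 'a mv" where
  "Gamma G u =
     \<lparr>carrier = {x \<in> carrier G. \<one>\<^bsub>G\<^esub> \<preceq>\<^bsub>G\<^esub> x \<and> x \<preceq>\<^bsub>G\<^esub> u},
      mvplus = \<lambda>x y. lg_meet G (x \<otimes>\<^bsub>G\<^esub> y) u,
      mvneg = \<lambda>x. u \<otimes>\<^bsub>G\<^esub> inv\<^bsub>G\<^esub> x,
      mvzero = \<one>\<^bsub>G\<^esub>,
      mvunit = u\<rparr>"

lemma (in unital_lgroup) positive_upper_part_trivial:
  assumes u: "\<one> \<preceq> u" and I: "maximal_l_ideal G u I"
    and cone: "positive_cone G = lower_part G I \<union>
      {u [^] n \<otimes> inv y | (n::nat) y. 1 \<le> n \<and> y \<in> I \<and> \<one> \<preceq> y \<and> y \<preceq> u [^] n \<and> y \<noteq> u [^] n}"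
  shows "I = {\<one>}"
proof -
  interpret L: lattice "lg_order G" by (rule lattice)
  have [simp]: "carrier (lg_order G) = carrier G" "le (lg_order G) = lg_le G" "eq (lg_order G) = (=)"
    unfolding lg_order_def by simp_all
  note uc [simp] = strong_unit_closed
  have I': "l_ideal G I" "u \<notin> I" using I by (simp_all add: maximal_l_ideal_def)
  note uI = I'(2)
  have sub: "subgroup I G" using I'(1) by (simp add: l_ideal_def)
  note I'' = I'(1)[unfolded l_ideal_def, THEN conjunct2]
  have join: "lg_join G x y \<in> I" if "x \<in> I" "y \<in> I" for x y
    by (rule conjunct1[OF bspec[OF bspec[OF conjunct1[OF I''] that(1)] that(2)]])
  have conv: "y \<in> I" if "x \<in> I" "z \<in> I" "y \<in> carrier G" "x \<preceq> y" "y \<preceq> z" for x y z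
    by (rule mp[OF bspec[OF bspec[OF bspec[OF conjunct2[OF I''] that(1)] that(2)] that(3)]])
      (rule conjI that(4,5))+
  have IG: "x \<in> carrier G" if "x \<in> I" for x using sub that by (rule subgroup.mem_carrier)
  have trans: "x \<preceq> z" if "x \<preceq> y" "y \<preceq> z" "x \<in> carrier G" "y \<in> carrier G" "z \<in> carrier G" for x y z
    using L.le_trans[of x y z] that by simp
  have antisym: "x = y" if "x \<preceq> y" "y \<preceq> x" "x \<in> carrier G" "y \<in> carrier G" for x y
    using L.weak_le_antisym[of x y] that by simp
  have pow: "\<one> \<preceq> u [^] (n::nat)" for n
  proof (induction n)
    case 0 show ?case using L.le_refl[of \<one>] by simp
  next
    case (Suc n)
    have "\<one> \<otimes> u \<preceq> u [^] n \<otimes> u" by (rule translation) (use Suc in auto)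
    then show ?case using trans[OF u, of "u [^] Suc n"] by simp
  qed
  have pos: "y = \<one>" if y: "y \<in> I" "\<one> \<preceq> y" for y
  proof -
    have yG: "y \<in> carrier G" using IG y by simp
    have uy: "u \<preceq> y \<otimes> u" using translation[OF _ yG uc y(2)] by simp
    have "\<one> \<preceq> y \<otimes> u" using trans[OF u uy] yG by simp
    then have "y \<otimes> u \<in> positive_cone G" using yG by (simp add: positive_cone_def)
    moreover have "y \<otimes> u \<notin> I"
      using conv[OF subgroup.one_closed[OF sub] _ uc u uy] uI by blast
    ultimately obtain n :: nat and z where n: "1 \<le> n" and z: "z \<in> I" "\<one> \<preceq> z"
      and eq: "y \<otimes> u = u [^] n \<otimes> inv z"
      using cone by (auto simp: lower_part_def)
    have zG: "z \<in> carrier G" using IG z by simp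
    obtain m where m: "n = Suc m" using n by (cases n) auto
    have "(y \<otimes> z) \<otimes> u = (y \<otimes> u) \<otimes> z" using yG zG by (simp add: m_ac)
    also have "\<dots> = u [^] n" unfolding eq using zG by (simp add: m_assoc)
    finally have "(y \<otimes> z) \<otimes> u = u [^] m \<otimes> u" by (simp add: m)
    then have yz: "y \<otimes> z = u [^] m" using yG zG by simp
    have "m = 0"
    proof (rule ccontr)
      assume "m \<noteq> 0"
      then obtain k where k: "m = Suc k" by (cases m) auto
      have "\<one> \<otimes> u \<preceq> u [^] k \<otimes> u" by (rule translation) (use pow in auto)
      then have "u \<preceq> y \<otimes> z" using yz k by simp
      then show False
        using conv[OF subgroup.one_closed[OF sub] subgroup.m_closed[OF sub y(1) z(1)] uc u] uI by blast
    qed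
    then have yz1: "y \<otimes> z = \<one>" using yz by simp
    have "\<one> \<otimes> y \<preceq> z \<otimes> y" by (rule translation) (use z zG yG in auto)
    then have "y \<preceq> \<one>" using yz1 yG zG by (simp add: m_comm)
    then show "y = \<one>" using antisym y yG by simp
  qed
  have le1: "y \<preceq> \<one>" if y: "y \<in> I" for y
  proof -
    have yG: "y \<in> carrier G" using IG y by simp
    have j: "lg_join G y \<one> \<in> I" using join y subgroup.one_closed[OF sub] by blast
    have "\<one> \<preceq> lg_join G y \<one>" using L.join_right[of y \<one>] yG by simp
    then have "lg_join G y \<one> = \<one>" using pos j by blast
    then show ?thesis using L.join_left[of y \<one>] yG by simp
  qed
  have "y = \<one>" if y: "y \<in> I" for y
  proof -
    have yG: "y \<in> carrier G" using IG y by simp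
    have "inv y \<preceq> \<one>" using le1 subgroup.m_inv_closed[OF sub y] by blast
    then have "inv y \<otimes> y \<preceq> \<one> \<otimes> y" using yG by (intro translation) auto
    then have "\<one> \<preceq> y" using yG by simp
    then show ?thesis using pos y by blast
  qed
  then show ?thesis using subgroup.one_closed[OF sub] by blast
qed


section \<open>The categories and the functor\<close>

text \<open>
  The objects of both categories are the structures whose carrier is a subset of the type \<open>'u\<close>,
  which plays the role of the universe. If \<open>'u\<close> is infinite, the universe is closed under the
  construction of the unital \<open>\<ell>\<close>-group of an MV-algebra; for finite \<open>'u\<close> it is not, since
  the group of the two-element MV-algebra is \<open>\<int>\<close>. Morphisms are made extensional, so that equality of
  arrows is equality on the carrier of the source.
\<close>

type_synonym 'u pualg_obj = "'u lgroup \<times> 'u \<times> 'u set"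
type_synonym 'u pmv_obj = "'u mv \<times> 'u set"

definition PUALG :: "('u pualg_obj, 'u \<Rightarrow> 'u) category" where
  "PUALG =
     \<lparr>Obj = {(G, u, I). unital_lgroup G u \<and> maximal_l_ideal G u I \<and>
               positive_cone G = lower_part G I \<union> upper_part G u I \<and>
               enough_idempotents (Gamma G u) (I \<inter> carrier (Gamma G u))},
      Hom = \<lambda>(G1, u1, I1) (G2, u2, I2).
               {f \<in> lgroup_hom G1 G2. f \<in> extensional (carrier G1) \<and> f u1 = u2 \<and> f ` I1 \<subseteq> I2},
      Id = \<lambda>(G, u, I). \<lambda>x \<in> carrier G. x,
      Comp = \<lambda>(G1, u1, I1) Y Z g f. compose (carrier G1) g f\<rparr>"

definition PMV :: "('u pmv_obj, 'u \<Rightarrow> 'u) category" where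
  "PMV =
     \<lparr>Obj = {(N, I). mv_algebra N \<and> maximal_mv_ideal N I \<and> enough_idempotents N I \<and>
               carrier N = I \<union> mvneg N ` I},
      Hom = \<lambda>(N1, I1) (N2, I2).
               {h \<in> mv_hom N1 N2. h \<in> extensional (carrier N1) \<and> h ` I1 \<subseteq> I2},
      Id = \<lambda>(N, I). \<lambda>x \<in> carrier N. x,
      Comp = \<lambda>(N1, I1) Y Z g f. compose (carrier N1) g f\<rparr>"

definition Gamma_I :: "('u pualg_obj, 'u \<Rightarrow> 'u, 'u pmv_obj, 'u \<Rightarrow> 'u) cat_functor" where
  "Gamma_I =
     \<lparr>fobj = \<lambda>(G, u, I). (Gamma G u, I \<inter> carrier (Gamma G u)),
      fmor = \<lambda>(G1, u1, I1) Y f. \<lambda>x \<in> carrier (Gamma G1 u1). f x\<rparr>"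

end

theory Submission
  imports Defs "HOL-Library.Multiset"
begin

text \<open>
  In an MV-algebra the truncated difference \<open>x \<ominus> y = \<sim> (\<sim> x \<oplus> y)\<close> satisfies the cube law
  \<open>(x \<ominus> y) \<ominus> (t \<ominus> y) = (x \<ominus> t) \<ominus> (y \<ominus> t)\<close>, which is exactly what Garside's theory of complements
  needs: \<open>\<ominus>\<close> extends to words over the MV-algebra, the cube law extends too, and words modulo mutual
  divisibility form a commutative cancellative monoid with joins. Its group of differences is the
  unital \<open>\<ell>\<close>-group of the MV-algebra; no representation by chains is needed.

  Conversely, in a unital \<open>\<ell>\<close>-group every positive element is a sum of elements of \<open>[0, u]\<close> (Riesz
  decomposition), and the residual of words computes \<open>(\<Sum>v - \<Sum>w) \<or> 0\<close>. Hence whether two words have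
  the same sum is decided inside \<open>\<Gamma>(G, u)\<close>, so MV-homomorphisms extend uniquely to
  \<open>\<ell>\<close>-group homomorphisms. An ideal of \<open>\<Gamma>(G, u)\<close> generates the \<open>\<ell>\<close>-ideal of differences of sums of its
  elements; by \<open>N = I \<union> I'\<close> every sum of elements of \<open>N\<close> has the form \<open>n u - y\<close> with \<open>y\<close> in this
  \<open>\<ell>\<close>-ideal, which gives both its maximality and the condition on the positive cone.
\<close>

section \<open>Residuals of words\<close>

text \<open>The obstacle in building the group is that addition of words must respect their
  identification. Everything is therefore phrased by one test, that a residual consists of zeros.
  This test is computed inside the MV-algebra, it survives every map that preserves differences and
  zero, and in an \<ell>-group it says that one sum is below another. So one calculus both
  constructs the group of an abstract MV-algebra and shows that extensions of homomorphisms are well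
  defined.

  The group must have its carrier in the universe \<open>'u\<close> again. Its elements are pairs of
  words up to equivalence; one pair of each class is chosen and coded by an injection into
  \<open>'u\<close>, which is where the infinite universe enters.\<close>

declare in_lists_conv_set [simp del] in_listsD [rule del] in_listsI [rule del]

text \<open>
  Read a word as the sum of its letters and \<open>d x y\<close> as the truncated difference \<open>(x - y) \<or> 0\<close>.
  Then \<open>lres d x v\<close> and \<open>wres d w v\<close> are words of the length of \<open>v\<close> with sum \<open>(v - x) \<or> 0\<close> and
  \<open>(v - w) \<or> 0\<close>; so \<open>wle\<close> says that the sum of \<open>v\<close> is at most the sum of \<open>w\<close>.
\<close>

primrec lres :: "('a \<Rightarrow> 'a \<Rightarrow> 'a) \<Rightarrow> 'a \<Rightarrow> 'a list \<Rightarrow> 'a list" where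
  "lres d x [] = []"
| "lres d x (y # w) = d y x # lres d (d x y) w"

primrec wres :: "('a \<Rightarrow> 'a \<Rightarrow> 'a) \<Rightarrow> 'a list \<Rightarrow> 'a list \<Rightarrow> 'a list" where
  "wres d [] v = v"
| "wres d (x # w) v = wres d w (lres d x v)"

definition wle :: "('a \<Rightarrow> 'a \<Rightarrow> 'a) \<Rightarrow> 'a \<Rightarrow> 'a list \<Rightarrow> 'a list \<Rightarrow> bool" where
  "wle d z v w \<longleftrightarrow> set (wres d w v) \<subseteq> {z}"

definition weq :: "('a \<Rightarrow> 'a \<Rightarrow> 'a) \<Rightarrow> 'a \<Rightarrow> 'a list \<Rightarrow> 'a list \<Rightarrow> bool" where
  "weq d z v w \<longleftrightarrow> wle d z v w \<and> wle d z w v"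

lemma wres_Nil [simp]: "wres d w [] = []"
  by (induction w rule: list.induct) auto

lemma wres_append_left: "wres d (w1 @ w2) v = wres d w2 (wres d w1 v)"
  by (induction w1 arbitrary: v rule: list.induct) auto

text \<open>A residual fills a rectangular grid with the letters of the two words along its sides.
  The recursion of \<open>wres\<close> removes a row, this rule a column.\<close>

lemma wres_Cons_right: "wres d v (x # w) = wres d v [x] @ wres d (lres d x v) w"
proof (induction v arbitrary: x w rule: list.induct)
  case (Cons y v)
  show ?case
    using Cons.IH[of "d x y" "lres d (d y x) w"] by simp
qed simp

text \<open>\<open>wres d v1 [x]\<close> is a single letter, what v1 leaves of x; only this part
  still acts on v2.\<close>

lemma lres_append: "lres d x (v1 @ v2) = lres d x v1 @ wres d (wres d v1 [x]) v2"
  by (induction v1 arbitrary: x rule: list.induct) auto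

text \<open>Together with \<open>wres_append_left\<close> this pastes grids in both directions: v2
  meets only what v1 leaves of w.\<close>

lemma wres_append_right: "wres d w (v1 @ v2) = wres d w v1 @ wres d (wres d v1 w) v2"
proof (induction w arbitrary: v1 v2 rule: list.induct)
  case (Cons x w)
  have "wres d (x # w) (v1 @ v2) = wres d w (lres d x v1) @ wres d (wres d (lres d x v1) w) (wres d (wres d v1 [x]) v2)"
    by (simp only: wres.simps lres_append Cons.IH)
  also have "\<dots> = wres d (x # w) v1 @ wres d (wres d v1 (x # w)) v2"
    by (simp only: wres.simps wres_Cons_right[of d v1 x w] wres_append_left)
  finally show ?case .
qed simp

text \<open>Of the two substantial laws, \<open>cube\<close> drives the calculus of residuals, order
  and joins. \<open>diff_diff\<close> is the symmetry of the meet
  \<open>x \<ominus> (x \<ominus> y)\<close>; it enters in \<open>wle_swap\<close>, where it makes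
  letters commute.\<close>

locale difference_algebra =
  fixes C :: "'a set" and d :: "'a \<Rightarrow> 'a \<Rightarrow> 'a" (infixl \<open>\<ominus>\<close> 65) and z :: 'a
  assumes diff_closed [simp]: "x \<in> C \<Longrightarrow> y \<in> C \<Longrightarrow> x \<ominus> y \<in> C"
    and zero_closed [simp]: "z \<in> C"
    and diff_self [simp]: "x \<in> C \<Longrightarrow> x \<ominus> x = z"
    and diff_zero [simp]: "x \<in> C \<Longrightarrow> x \<ominus> z = x"
    and zero_diff [simp]: "x \<in> C \<Longrightarrow> z \<ominus> x = z"
    and diff_le [simp]: "x \<in> C \<Longrightarrow> y \<in> C \<Longrightarrow> (x \<ominus> y) \<ominus> x = z"
    and diff_diff: "x \<in> C \<Longrightarrow> y \<in> C \<Longrightarrow> x \<ominus> (x \<ominus> y) = y \<ominus> (y \<ominus> x)"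
    and cube: "x \<in> C \<Longrightarrow> y \<in> C \<Longrightarrow> t \<in> C \<Longrightarrow> (x \<ominus> y) \<ominus> (t \<ominus> y) = (x \<ominus> t) \<ominus> (y \<ominus> t)"
begin

abbreviation wres_op (infixr \<open>\<setminus>\<close> 75) where "w \<setminus> v \<equiv> wres d w v"
abbreviation wle_op (infix \<open>\<sqsubseteq>w\<close> 50) where "v \<sqsubseteq>w w \<equiv> wle d z v w"
abbreviation weq_op (infix \<open>\<simeq>\<close> 50) where "v \<simeq> w \<equiv> weq d z v w"

lemma lres_closed [simp]: "x \<in> C \<Longrightarrow> v \<in> lists C \<Longrightarrow> lres d x v \<in> lists C"
  by (induction v arbitrary: x rule: list.induct) auto

lemma wres_closed [simp]: "w \<in> lists C \<Longrightarrow> v \<in> lists C \<Longrightarrow> w \<setminus> v \<in> lists C"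
  by (induction w arbitrary: v rule: list.induct) auto

text \<open>Passing a letter t turns x and y into \<open>x \<ominus> t\<close> and
  \<open>y \<ominus> t\<close>. The cube law rewrites the updated residuals of x and y as residuals
  of these two, to which the induction hypothesis applies.\<close>

lemma cube_letters:
  assumes "x \<in> C" "y \<in> C" "v \<in> lists C"
  shows "lres d (y \<ominus> x) (lres d x v) = lres d (x \<ominus> y) (lres d y v)"
  using assms
proof (induction v arbitrary: x y rule: list.induct)
  case (Cons t v)
  have t: "t \<in> C" "v \<in> lists C" using Cons.prems by auto
  have "lres d ((y \<ominus> x) \<ominus> (t \<ominus> x)) (lres d (x \<ominus> t) v) = lres d ((y \<ominus> t) \<ominus> (x \<ominus> t)) (lres d (x \<ominus> t) v)"
    using t Cons.prems by (simp add: cube)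
  also have "\<dots> = lres d ((x \<ominus> t) \<ominus> (y \<ominus> t)) (lres d (y \<ominus> t) v)"
    by (rule Cons.IH) (use t Cons.prems in auto)
  also have "\<dots> = lres d ((x \<ominus> y) \<ominus> (t \<ominus> y)) (lres d (y \<ominus> t) v)"
    using t Cons.prems by (simp add: cube)
  finally show ?case using t Cons.prems by (simp add: cube)
qed simp

lemma cube_letter_word:
  assumes "w \<in> lists C" "y \<in> C" "v \<in> lists C"
  shows "(w \<setminus> [y]) \<setminus> (w \<setminus> v) = lres d y w \<setminus> lres d y v"
  using assms
proof (induction w arbitrary: y v rule: list.induct)
  case (Cons x w)
  then have "(w \<setminus> [y \<ominus> x]) \<setminus> (w \<setminus> lres d x v) = lres d (y \<ominus> x) w \<setminus> lres d (y \<ominus> x) (lres d x v)"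
    by (intro Cons.IH) auto
  also have "\<dots> = lres d (y \<ominus> x) w \<setminus> lres d (x \<ominus> y) (lres d y v)"
    using Cons.prems by (simp add: cube_letters[of x y v])
  finally show ?case by simp
qed simp

text \<open>The letter cubes are stacked along one word in \<open>cube_letter_word\<close> and along
  the other one here; the third side is already a word in \<open>cube_letters\<close>.\<close>

lemma cube_words:
  assumes "w \<in> lists C" "v \<in> lists C" "t \<in> lists C"
  shows "(w \<setminus> v) \<setminus> (w \<setminus> t) = (v \<setminus> w) \<setminus> (v \<setminus> t)"
  using assms
proof (induction w arbitrary: v t rule: list.induct)
  case (Cons x w)
  then have xw: "x \<in> C" "w \<in> lists C" by auto
  have "(w \<setminus> lres d x v) \<setminus> (w \<setminus> lres d x t) = (lres d x v \<setminus> w) \<setminus> (lres d x v \<setminus> lres d x t)"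
    using Cons.prems by (intro Cons.IH) auto
  also have "\<dots> = (lres d x v \<setminus> w) \<setminus> ((v \<setminus> [x]) \<setminus> (v \<setminus> t))"
    using Cons.prems xw by (simp add: cube_letter_word)
  finally show ?case
    by (simp add: wres_Cons_right[of d v x w] wres_append_left)
qed simp

lemma lres_zero [simp]: "v \<in> lists C \<Longrightarrow> lres d z v = v"
  by (induction v rule: list.induct) auto

lemma wres_zeros_left: "set w \<subseteq> {z} \<Longrightarrow> v \<in> lists C \<Longrightarrow> w \<setminus> v = v"
  by (induction w rule: list.induct) auto

lemma lres_zeros: "set v \<subseteq> {z} \<Longrightarrow> x \<in> C \<Longrightarrow> lres d x v = v"
  by (induction v arbitrary: x rule: list.induct) auto

lemma wres_zeros_right: "set v \<subseteq> {z} \<Longrightarrow> w \<in> lists C \<Longrightarrow> w \<setminus> v = v"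
  by (induction w rule: list.induct) (auto simp: lres_zeros)

lemma wle_refl [simp]: "w \<in> lists C \<Longrightarrow> w \<sqsubseteq>w w"
proof (induction w rule: list.induct)
  case (Cons x w)
  then show ?case
    by (simp add: wle_def wres_Cons_right[of d w z w] wres_zeros_right)
qed (simp add: wle_def)

text \<open>Taking the residual by a word of zeros changes nothing, so
  \<open>t \<setminus> w\<close> may be inserted in front; then the cube law exchanges t and
  w.\<close>

lemma wle_trans:
  assumes "v \<sqsubseteq>w w" "w \<sqsubseteq>w t" "v \<in> lists C" "w \<in> lists C" "t \<in> lists C"
  shows "v \<sqsubseteq>w t"
proof -
  have "t \<setminus> v = (t \<setminus> w) \<setminus> (t \<setminus> v)" using assms by (simp add: wres_zeros_left wle_def)
  also have "\<dots> = (w \<setminus> t) \<setminus> (w \<setminus> v)" using assms by (simp add: cube_words)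
  also have "\<dots> = w \<setminus> v" using assms by (simp add: wres_zeros_right wle_def)
  finally show ?thesis using assms by (simp add: wle_def)
qed

lemma wle_append_left [simp]:
  assumes "a \<in> lists C" "v \<in> lists C" "w \<in> lists C"
  shows "a @ v \<sqsubseteq>w a @ w \<longleftrightarrow> v \<sqsubseteq>w w"
proof -
  have z: "set (a \<setminus> a) \<subseteq> {z}" using wle_refl[OF assms(1)] by (simp add: wle_def)
  have "w \<setminus> (a \<setminus> (a @ v)) = (a \<setminus> a) @ (w \<setminus> v)"
    using z assms by (simp add: wres_append_right wres_zeros_left wres_zeros_right)
  then show ?thesis using z by (simp add: wle_def wres_append_left)
qed

lemma wle_append_self [simp]:
  assumes "v \<in> lists C" "w \<in> lists C" shows "v \<sqsubseteq>w v @ w"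
  using wle_append_left[of v "[]" w] assms by (simp add: wle_def)

text \<open>Both words represent the join of v and w: one word followed by what remains of the
  other.\<close>

lemma wjoin_comm:
  assumes "v \<in> lists C" "w \<in> lists C" shows "w @ (w \<setminus> v) \<simeq> v @ (v \<setminus> w)"
proof -
  have "w @ (w \<setminus> v) \<sqsubseteq>w v @ (v \<setminus> w)" if "v \<in> lists C" "w \<in> lists C" for v w
  proof -
    have "set ((v \<setminus> w) \<setminus> (v \<setminus> w)) \<subseteq> {z}" "set ((w \<setminus> v) \<setminus> (w \<setminus> v)) \<subseteq> {z}"
      using wle_refl[of "v \<setminus> w"] wle_refl[of "w \<setminus> v"] that by (simp_all add: wle_def)
    then show ?thesis using that
      by (simp add: wle_def wres_append_left wres_append_right wres_zeros_left wres_zeros_right)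
  qed
  then show ?thesis using assms by (simp add: weq_def)
qed

text \<open>The cube law rewrites the second block of the residual by t as a residual of
  \<open>t \<setminus> v\<close>, which is already a word of zeros.\<close>

lemma wjoin_least:
  assumes "v \<sqsubseteq>w t" "w \<sqsubseteq>w t" "v \<in> lists C" "w \<in> lists C" "t \<in> lists C"
  shows "w @ (w \<setminus> v) \<sqsubseteq>w t"
proof -
  have "(w \<setminus> t) \<setminus> (w \<setminus> v) = (t \<setminus> w) \<setminus> (t \<setminus> v)" using assms by (simp add: cube_words)
  then show ?thesis using assms
    by (simp add: wle_def wres_append_right wres_zeros_left)
qed

text \<open>The order of words is divisibility, with the residual as cofactor: the join of v and w
  is equivalent to w.\<close>

lemma wle_imp_weq:
  assumes "v \<sqsubseteq>w w" "v \<in> lists C" "w \<in> lists C"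
  shows "w \<simeq> v @ (v \<setminus> w)"
proof -
  have *: "w @ (w \<setminus> v) \<simeq> v @ (v \<setminus> w)" using wjoin_comm assms by simp
  have "w @ (w \<setminus> v) \<sqsubseteq>w w" using assms by (intro wjoin_least) auto
  moreover have "w \<sqsubseteq>w w @ (w \<setminus> v)" using assms by simp
  ultimately show ?thesis using * assms
    wle_trans[of w "w @ (w \<setminus> v)" "v @ (v \<setminus> w)"] wle_trans[of "v @ (v \<setminus> w)" "w @ (w \<setminus> v)" w]
    by (simp add: weq_def)
qed

text \<open>After the first cancellations the letters that face each other are
  \<open>y \<ominus> (y \<ominus> x)\<close> and \<open>x \<ominus> (x \<ominus> y)\<close>, two
  forms of the meet of x and y, and they cancel.\<close>

lemma wle_swap:
  assumes "x \<in> C" "y \<in> C" "v \<in> lists C"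
  shows "x # y # v \<sqsubseteq>w y # x # v"
proof -
  have "(y \<ominus> (y \<ominus> x)) = (x \<ominus> (x \<ominus> y))" using assms diff_diff by simp
  moreover have "set (v \<setminus> v) \<subseteq> {z}" using wle_refl[OF assms(3)] by (simp add: wle_def)
  moreover have "x \<ominus> (x \<ominus> y) \<in> C" using assms by simp
  ultimately show ?thesis using assms
    by (simp add: wle_def wres_Cons_right[of d v z "z # v"] wres_Cons_right[of d v z v] wres_zeros_right)
qed

lemma wle_Cons [simp]: 
  "x \<in> C \<Longrightarrow> v \<in> lists C \<Longrightarrow> w \<in> lists C \<Longrightarrow> x # v \<sqsubseteq>w x # w \<longleftrightarrow> v \<sqsubseteq>w w"
  using wle_append_left[of "[x]" v w] by simp

lemma wle_rotate_left:
  "x \<in> C \<Longrightarrow> v \<in> lists C \<Longrightarrow> w \<in> lists C \<Longrightarrow> x # v @ w \<sqsubseteq>w v @ x # w"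
proof (induction v rule: list.induct)
  case (Cons y v)
  have "x # y # v @ w \<sqsubseteq>w y # x # v @ w" using Cons.prems by (simp add: wle_swap)
  also have "y # x # v @ w \<sqsubseteq>w y # v @ x # w" using Cons by simp
  finally (wle_trans) show ?case using Cons.prems by simp
qed simp

text \<open>Here the free monoid becomes commutative: from now on rearrangements of words are
  settled by comparing multisets.\<close>

lemma wle_mset:
  assumes "mset v = mset w" "v \<in> lists C"
  shows "v \<sqsubseteq>w w"
  using assms
proof (induction v arbitrary: w rule: list.induct)
  case (Cons x v)
  then have "x \<in> set w" by (metis list.set_intros(1) set_mset_mset)
  then obtain a b where w: "w = a @ x # b" by (meson split_list)
  then have m: "mset v = mset (a @ b)" using Cons.prems by simp
  have ab: "set (a @ b) = set v" using m by (metis set_mset_mset)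
  then have ab': "a \<in> lists C" "b \<in> lists C" "x \<in> C" using Cons.prems
    by (auto simp: in_lists_conv_set)
  have "x # v \<sqsubseteq>w x # a @ b" using Cons.IH[OF m] Cons.prems ab' by simp
  also have "x # a @ b \<sqsubseteq>w w" using wle_rotate_left[of x a b] ab' w by simp
  finally (wle_trans) show ?case using Cons.prems ab' w by simp
qed simp

lemma wle_append_right [simp]:
  assumes "a \<in> lists C" "v \<in> lists C" "w \<in> lists C"
  shows "v @ a \<sqsubseteq>w w @ a \<longleftrightarrow> v \<sqsubseteq>w w"
proof -
  have c: "s @ a \<sqsubseteq>w a @ s" "a @ s \<sqsubseteq>w s @ a" if "s \<in> lists C" for s
    by (rule wle_mset; use that assms in simp)+
  have "a @ v \<sqsubseteq>w a @ w" if *: "v @ a \<sqsubseteq>w w @ a"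
  proof -
    have "a @ v \<sqsubseteq>w v @ a" by (rule c) fact
    also note *
    also (wle_trans) have "w @ a \<sqsubseteq>w a @ w" by (rule c) fact
    finally (wle_trans) show ?thesis using assms by simp
  qed
  moreover have "v @ a \<sqsubseteq>w w @ a" if *: "a @ v \<sqsubseteq>w a @ w"
  proof -
    have "v @ a \<sqsubseteq>w a @ v" by (rule c) fact
    also note *
    also (wle_trans) have "a @ w \<sqsubseteq>w w @ a" by (rule c) fact
    finally (wle_trans) show ?thesis using assms by simp
  qed
  ultimately show ?thesis using assms by auto
qed

lemma wle_append_mono:
  assumes "v \<sqsubseteq>w w" "v' \<sqsubseteq>w w'" "v \<in> lists C" "w \<in> lists C" "v' \<in> lists C" "w' \<in> lists C"
  shows "v @ v' \<sqsubseteq>w w @ w'"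
  by (rule wle_trans[of _ "w @ v'"]) (use assms in simp_all)

end

lemma map_lres:
  assumes "\<And>x y. x \<in> C \<Longrightarrow> y \<in> C \<Longrightarrow> f (d x y) = d' (f x) (f y)" "\<And>x y. x \<in> C \<Longrightarrow> y \<in> C \<Longrightarrow> d x y \<in> C"
    and "x \<in> C" "v \<in> lists C"
  shows "map f (lres d x v) = lres d' (f x) (map f v)"
  using assms(3,4) by (induction v arbitrary: x rule: list.induct) (auto simp: assms(1,2))

text \<open>Serves twice: with an MV-homomorphism, to transport the order of words, and with the
  identity, to replace the MV-difference of a unit interval by the truncated difference of its
  group.\<close>

lemma map_wres:
  assumes "difference_algebra C d z" "\<And>x y. x \<in> C \<Longrightarrow> y \<in> C \<Longrightarrow> f (d x y) = d' (f x) (f y)"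
    and "w \<in> lists C" "v \<in> lists C"
  shows "map f (wres d w v) = wres d' (map f w) (map f v)"
proof -
  interpret difference_algebra C d z by fact
  show ?thesis using assms(3,4)
  proof (induction w arbitrary: v rule: list.induct)
    case (Cons x w)
    have "map f (lres d x v) = lres d' (f x) (map f v)"
      by (rule map_lres[of C]) (use Cons.prems assms(2) in simp_all)
    then show ?case using Cons by simp
  qed simp
qed

section \<open>MV-algebras\<close>

definition mv_diff :: "('a, 'b) mv_scheme \<Rightarrow> 'a \<Rightarrow> 'a \<Rightarrow> 'a" where
  "mv_diff N x y = \<sim>\<^bsub>N\<^esub> ((\<sim>\<^bsub>N\<^esub> x) \<oplus>\<^bsub>N\<^esub> y)"

context mv_algebra
begin

lemma plus_closed [simp]: "x \<in> carrier N \<Longrightarrow> y \<in> carrier N \<Longrightarrow> x \<oplus> y \<in> carrier N"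
  using comm_monoid.axioms(1)[OF comm_monoid] monoid.m_closed by fastforce

lemma zero_closed [simp]: "\<zero> \<in> carrier N"
  using comm_monoid.axioms(1)[OF comm_monoid] monoid.one_closed by fastforce

declare neg_closed [simp] unit_closed [simp] neg_neg [simp] plus_unit [simp] neg_zero [simp]

lemma plus_comm: "x \<in> carrier N \<Longrightarrow> y \<in> carrier N \<Longrightarrow> x \<oplus> y = y \<oplus> x"
  using comm_monoid.m_comm[OF comm_monoid] by simp

lemma plus_assoc:
  "x \<in> carrier N \<Longrightarrow> y \<in> carrier N \<Longrightarrow> z \<in> carrier N \<Longrightarrow> (x \<oplus> y) \<oplus> z = x \<oplus> (y \<oplus> z)"
  using monoid.m_assoc[OF comm_monoid.axioms(1)[OF comm_monoid]] by simp

lemma plus_zero [simp]: "x \<in> carrier N \<Longrightarrow> x \<oplus> \<zero> = x"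
  using monoid.r_one[OF comm_monoid.axioms(1)[OF comm_monoid]] by simp

lemma zero_plus [simp]: "x \<in> carrier N \<Longrightarrow> \<zero> \<oplus> x = x"
  using monoid.l_one[OF comm_monoid.axioms(1)[OF comm_monoid]] by simp

lemma neg_unit [simp]: "\<sim> \<bbbone> = \<zero>"
  using neg_neg[of \<zero>] by simp

lemma unit_plus [simp]: "x \<in> carrier N \<Longrightarrow> \<bbbone> \<oplus> x = \<bbbone>"
  using plus_comm[of x \<bbbone>] by simp

lemma plus_neg [simp]: "x \<in> carrier N \<Longrightarrow> x \<oplus> \<sim> x = \<bbbone>"
  using plus_neg_plus[of x \<bbbone>] by simp

lemma neg_plus [simp]: "x \<in> carrier N \<Longrightarrow> \<sim> x \<oplus> x = \<bbbone>"
  using plus_comm[of x "\<sim> x"] by simp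

lemma mv_diff_closed [simp]: "x \<in> carrier N \<Longrightarrow> y \<in> carrier N \<Longrightarrow> mv_diff N x y \<in> carrier N"
  by (simp add: mv_diff_def)

lemma mv_diff_diff:
  assumes "x \<in> carrier N" "y \<in> carrier N" "z \<in> carrier N"
  shows "mv_diff N (mv_diff N x y) z = mv_diff N x (y \<oplus> z)"
  using assms by (simp add: mv_diff_def plus_assoc)

lemma difference_algebra: "difference_algebra (carrier N) (mv_diff N) \<zero>"
proof
  fix x y assume xy: "x \<in> carrier N" "y \<in> carrier N"
  have "\<sim> x \<oplus> (y \<oplus> x) = \<bbbone>"
    using xy plus_assoc[of "\<sim> x" x y] plus_comm[of x y] by simp
  then show "mv_diff N (mv_diff N x y) x = \<zero>"
    using xy by (simp add: mv_diff_def plus_assoc)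
  \<comment> \<open>The negation of the last MV-axiom, taken at the negated elements.\<close>
  show "mv_diff N x (mv_diff N x y) = mv_diff N y (mv_diff N y x)"
    using xy plus_neg_plus[of "\<sim> x" "\<sim> y"] by (simp add: mv_diff_def)
  fix t assume t: "t \<in> carrier N"
  \<comment> \<open>Both sides are the join of y and t. By \<open>mv_diff_diff\<close> each side of
    the cube law is x minus this join.\<close>
  have "y \<oplus> mv_diff N t y = t \<oplus> mv_diff N y t"
    using xy t plus_neg_plus[of y t] plus_comm[of y "\<sim> t"] plus_comm[of t "\<sim> y"]
    by (simp add: mv_diff_def)
  then show "mv_diff N (mv_diff N x y) (mv_diff N t y) = mv_diff N (mv_diff N x t) (mv_diff N y t)"
    using xy t by (simp add: mv_diff_diff)
qed (auto simp: mv_diff_def)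

lemma plus_eq_diff:
  "x \<in> carrier N \<Longrightarrow> y \<in> carrier N \<Longrightarrow> x \<oplus> y = \<sim> (mv_diff N (\<sim> x) y)"
  by (simp add: mv_diff_def)

end

lemma mv_le_iff:
  assumes "mv_algebra N" "x \<in> carrier N" "y \<in> carrier N"
  shows "mv_le N x y \<longleftrightarrow> mv_diff N x y = \<zero>\<^bsub>N\<^esub>"
proof -
  interpret mv_algebra N by fact
  have "\<sim>\<^bsub>N\<^esub> x \<oplus>\<^bsub>N\<^esub> y \<in> carrier N" using assms by simp
  then show ?thesis unfolding mv_le_def mv_diff_def using neg_neg neg_unit neg_zero by metis
qed

text \<open>Given negation, sum and difference define each other. The word calculus only knows the
  difference, so homomorphisms are exchanged with it in this form.\<close>

lemma mv_hom_iff: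
  assumes "mv_algebra M" "mv_algebra N" "f \<in> carrier M \<rightarrow> carrier N"
    and neg: "\<And>x. x \<in> carrier M \<Longrightarrow> f (\<sim>\<^bsub>M\<^esub> x) = \<sim>\<^bsub>N\<^esub> (f x)"
    and zero: "f \<zero>\<^bsub>M\<^esub> = \<zero>\<^bsub>N\<^esub>"
  shows "f \<in> mv_hom M N \<longleftrightarrow>
    (\<forall>x \<in> carrier M. \<forall>y \<in> carrier M. f (mv_diff M x y) = mv_diff N (f x) (f y))"
proof -
  interpret M: mv_algebra M by fact
  interpret N: mv_algebra N by fact
  have fc: "f x \<in> carrier N" if "x \<in> carrier M" for x using assms(3) that by auto
  have "f \<bbbone>\<^bsub>M\<^esub> = \<bbbone>\<^bsub>N\<^esub>" using neg[of "\<zero>\<^bsub>M\<^esub>"] zero by simp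
  moreover have "(\<forall>x \<in> carrier M. \<forall>y \<in> carrier M. f (x \<oplus>\<^bsub>M\<^esub> y) = f x \<oplus>\<^bsub>N\<^esub> f y) \<longleftrightarrow>
    (\<forall>x \<in> carrier M. \<forall>y \<in> carrier M. f (mv_diff M x y) = mv_diff N (f x) (f y))" (is "?L \<longleftrightarrow> ?R")
  proof
    assume ?L then show ?R by (simp add: mv_diff_def neg)
  next
    assume ?R then show ?L by (simp add: M.plus_eq_diff N.plus_eq_diff neg fc)
  qed
  ultimately show ?thesis using assms by (simp add: mv_hom_def)
qed

section \<open>Lattice-ordered groups\<close>

context abelian_lgroup
begin

abbreviation join_op (infixl \<open>\<or>\<^sub>L\<close> 65) where "x \<or>\<^sub>L y \<equiv> lg_join G x y"
abbreviation meet_op (infixl \<open>\<and>\<^sub>L\<close> 65) where "x \<and>\<^sub>L y \<equiv> lg_meet G x y"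

lemma
  shows lle_refl [simp]: "x \<in> carrier G \<Longrightarrow> x \<preceq> x"
    and lle_trans: "x \<preceq> y \<Longrightarrow> y \<preceq> z \<Longrightarrow> x \<in> carrier G \<Longrightarrow> y \<in> carrier G \<Longrightarrow> z \<in> carrier G \<Longrightarrow> x \<preceq> z"
    and lle_antisym: "x \<preceq> y \<Longrightarrow> y \<preceq> x \<Longrightarrow> x \<in> carrier G \<Longrightarrow> y \<in> carrier G \<Longrightarrow> x = y"
    and join_closed [simp]: "x \<in> carrier G \<Longrightarrow> y \<in> carrier G \<Longrightarrow> x \<or>\<^sub>L y \<in> carrier G"
    and meet_closed [simp]: "x \<in> carrier G \<Longrightarrow> y \<in> carrier G \<Longrightarrow> x \<and>\<^sub>L y \<in> carrier G"
    and join_left [simp]: "x \<in> carrier G \<Longrightarrow> y \<in> carrier G \<Longrightarrow> x \<preceq> x \<or>\<^sub>L y"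
    and join_right [simp]: "x \<in> carrier G \<Longrightarrow> y \<in> carrier G \<Longrightarrow> y \<preceq> x \<or>\<^sub>L y"
    and meet_left [simp]: "x \<in> carrier G \<Longrightarrow> y \<in> carrier G \<Longrightarrow> x \<and>\<^sub>L y \<preceq> x"
    and meet_right [simp]: "x \<in> carrier G \<Longrightarrow> y \<in> carrier G \<Longrightarrow> x \<and>\<^sub>L y \<preceq> y"
    and join_le: "x \<preceq> z \<Longrightarrow> y \<preceq> z \<Longrightarrow> x \<in> carrier G \<Longrightarrow> y \<in> carrier G \<Longrightarrow> z \<in> carrier G \<Longrightarrow> x \<or>\<^sub>L y \<preceq> z"
    and meet_le: "z \<preceq> x \<Longrightarrow> z \<preceq> y \<Longrightarrow> x \<in> carrier G \<Longrightarrow> y \<in> carrier G \<Longrightarrow> z \<in> carrier G \<Longrightarrow> z \<preceq> x \<and>\<^sub>L y"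
proof -
  interpret L: lattice "lg_order G"
    rewrites "carrier (lg_order G) = carrier G" and "le (lg_order G) = lg_le G"
      and "eq (lg_order G) = (=)"
    by (rule lattice) (simp_all add: lg_order_def)
  show "x \<in> carrier G \<Longrightarrow> x \<preceq> x" by (rule L.le_refl)
  show "x \<preceq> y \<Longrightarrow> y \<preceq> z \<Longrightarrow> x \<in> carrier G \<Longrightarrow> y \<in> carrier G \<Longrightarrow> z \<in> carrier G \<Longrightarrow> x \<preceq> z"
    by (rule L.le_trans)
  show "x \<preceq> y \<Longrightarrow> y \<preceq> x \<Longrightarrow> x \<in> carrier G \<Longrightarrow> y \<in> carrier G \<Longrightarrow> x = y"
    by (rule L.weak_le_antisym)
  show "x \<in> carrier G \<Longrightarrow> y \<in> carrier G \<Longrightarrow> x \<or>\<^sub>L y \<in> carrier G" by (rule L.join_closed)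
  show "x \<in> carrier G \<Longrightarrow> y \<in> carrier G \<Longrightarrow> x \<and>\<^sub>L y \<in> carrier G" by (rule L.meet_closed)
  show "x \<in> carrier G \<Longrightarrow> y \<in> carrier G \<Longrightarrow> x \<preceq> x \<or>\<^sub>L y" by (rule L.join_left)
  show "x \<in> carrier G \<Longrightarrow> y \<in> carrier G \<Longrightarrow> y \<preceq> x \<or>\<^sub>L y" by (rule L.join_right)
  show "x \<in> carrier G \<Longrightarrow> y \<in> carrier G \<Longrightarrow> x \<and>\<^sub>L y \<preceq> x" by (rule L.meet_left)
  show "x \<in> carrier G \<Longrightarrow> y \<in> carrier G \<Longrightarrow> x \<and>\<^sub>L y \<preceq> y" by (rule L.meet_right)
  show "x \<preceq> z \<Longrightarrow> y \<preceq> z \<Longrightarrow> x \<in> carrier G \<Longrightarrow> y \<in> carrier G \<Longrightarrow> z \<in> carrier G \<Longrightarrow> x \<or>\<^sub>L y \<preceq> z"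
    by (rule L.join_le)
  show "z \<preceq> x \<Longrightarrow> z \<preceq> y \<Longrightarrow> x \<in> carrier G \<Longrightarrow> y \<in> carrier G \<Longrightarrow> z \<in> carrier G \<Longrightarrow> z \<preceq> x \<and>\<^sub>L y"
    by (rule L.meet_le)
qed

lemma join_eqI:
  assumes "x \<in> carrier G" "y \<in> carrier G" "s \<in> carrier G" "x \<preceq> s" "y \<preceq> s"
    and "\<And>t. t \<in> carrier G \<Longrightarrow> x \<preceq> t \<Longrightarrow> y \<preceq> t \<Longrightarrow> s \<preceq> t"
  shows "x \<or>\<^sub>L y = s"
  using assms by (intro lle_antisym join_le) auto

lemma meet_eqI:
  assumes "x \<in> carrier G" "y \<in> carrier G" "s \<in> carrier G" "s \<preceq> x" "s \<preceq> y"
    and "\<And>t. t \<in> carrier G \<Longrightarrow> t \<preceq> x \<Longrightarrow> t \<preceq> y \<Longrightarrow> t \<preceq> s"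
  shows "x \<and>\<^sub>L y = s"
  using assms by (intro lle_antisym meet_le) auto

lemma join_comm: "x \<in> carrier G \<Longrightarrow> y \<in> carrier G \<Longrightarrow> x \<or>\<^sub>L y = y \<or>\<^sub>L x"
  by (intro join_eqI join_le) auto

lemma meet_comm: "x \<in> carrier G \<Longrightarrow> y \<in> carrier G \<Longrightarrow> x \<and>\<^sub>L y = y \<and>\<^sub>L x"
  by (intro meet_eqI meet_le) auto

lemma join_absorb: "x \<in> carrier G \<Longrightarrow> y \<in> carrier G \<Longrightarrow> x \<preceq> y \<Longrightarrow> x \<or>\<^sub>L y = y"
  by (intro join_eqI) auto

lemma meet_absorb: "x \<in> carrier G \<Longrightarrow> y \<in> carrier G \<Longrightarrow> x \<preceq> y \<Longrightarrow> x \<and>\<^sub>L y = x"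
  by (intro meet_eqI) auto

lemma mult_le_cancel_right [simp]:
  assumes "x \<in> carrier G" "y \<in> carrier G" "z \<in> carrier G"
  shows "x \<otimes> z \<preceq> y \<otimes> z \<longleftrightarrow> x \<preceq> y"
proof
  assume "x \<otimes> z \<preceq> y \<otimes> z"
  then have "x \<otimes> z \<otimes> inv z \<preceq> y \<otimes> z \<otimes> inv z" by (rule translation[rotated -1]) (use assms in auto)
  then show "x \<preceq> y" using assms by (simp add: m_assoc)
qed (use assms in \<open>auto intro: translation\<close>)

lemma mult_le_cancel_left [simp]:
  "x \<in> carrier G \<Longrightarrow> y \<in> carrier G \<Longrightarrow> z \<in> carrier G \<Longrightarrow> z \<otimes> x \<preceq> z \<otimes> y \<longleftrightarrow> x \<preceq> y"
  by (simp add: m_comm[of z])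

lemma mult_mono:
  assumes "x \<preceq> y" "x' \<preceq> y'" "x \<in> carrier G" "y \<in> carrier G" "x' \<in> carrier G" "y' \<in> carrier G"
  shows "x \<otimes> x' \<preceq> y \<otimes> y'"
  by (rule lle_trans[of _ "y \<otimes> x'"]) (use assms in auto)

lemma div_le_iff:
  assumes "x \<in> carrier G" "y \<in> carrier G" "z \<in> carrier G"
  shows "x \<otimes> inv y \<preceq> z \<longleftrightarrow> x \<preceq> z \<otimes> y"
proof -
  have "x \<otimes> inv y \<preceq> z \<longleftrightarrow> x \<otimes> inv y \<otimes> y \<preceq> z \<otimes> y"
    using assms by (subst mult_le_cancel_right) auto
  then show ?thesis using assms by (simp add: m_assoc)
qed

lemma le_div_iff:
  assumes "x \<in> carrier G" "y \<in> carrier G" "z \<in> carrier G"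
  shows "z \<preceq> x \<otimes> inv y \<longleftrightarrow> z \<otimes> y \<preceq> x"
proof -
  have "z \<preceq> x \<otimes> inv y \<longleftrightarrow> z \<otimes> y \<preceq> x \<otimes> inv y \<otimes> y"
    using assms by (subst mult_le_cancel_right) auto
  then show ?thesis using assms by (simp add: m_assoc)
qed

lemma div_eq_div_iff:
  assumes "a \<in> carrier G" "b \<in> carrier G" "c \<in> carrier G" "e \<in> carrier G"
  shows "a \<otimes> inv b = c \<otimes> inv e \<longleftrightarrow> a \<otimes> e = c \<otimes> b"
proof -
  have "a \<otimes> inv b = c \<otimes> inv e \<longleftrightarrow> c = (a \<otimes> inv b) \<otimes> e"
    using assms by (intro inv_solve_right) auto
  also have "(a \<otimes> inv b) \<otimes> e = (a \<otimes> e) \<otimes> inv b" using assms by (simp add: m_ac)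
  also have "c = (a \<otimes> e) \<otimes> inv b \<longleftrightarrow> a \<otimes> e = c \<otimes> b"
    using assms by (intro inv_solve_right) auto
  finally show ?thesis .
qed

lemma inv_le_inv_iff [simp]:
  "x \<in> carrier G \<Longrightarrow> y \<in> carrier G \<Longrightarrow> inv x \<preceq> inv y \<longleftrightarrow> y \<preceq> x"
  using div_le_iff[of \<one> x "inv y"] le_div_iff[of x y \<one>] by (simp add: m_comm)

lemma join_mult:
  assumes "x \<in> carrier G" "y \<in> carrier G" "z \<in> carrier G"
  shows "(x \<or>\<^sub>L y) \<otimes> z = (x \<otimes> z) \<or>\<^sub>L (y \<otimes> z)"
proof (rule join_eqI[symmetric])
  fix t assume t: "t \<in> carrier G" "x \<otimes> z \<preceq> t" "y \<otimes> z \<preceq> t"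
  then have "x \<or>\<^sub>L y \<preceq> t \<otimes> inv z" using assms by (intro join_le) (auto simp: le_div_iff)
  then show "(x \<or>\<^sub>L y) \<otimes> z \<preceq> t" using assms t by (simp add: le_div_iff)
qed (use assms in auto)

lemma mult_join:
  "x \<in> carrier G \<Longrightarrow> y \<in> carrier G \<Longrightarrow> z \<in> carrier G \<Longrightarrow> z \<otimes> (x \<or>\<^sub>L y) = (z \<otimes> x) \<or>\<^sub>L (z \<otimes> y)"
  by (simp add: m_comm[of z] join_mult)

lemma inv_meet:
  assumes "x \<in> carrier G" "y \<in> carrier G"
  shows "inv (x \<and>\<^sub>L y) = inv x \<or>\<^sub>L inv y"
proof (rule join_eqI[symmetric])
  fix t assume t: "t \<in> carrier G" "inv x \<preceq> t" "inv y \<preceq> t"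
  have "inv t \<preceq> x \<and>\<^sub>L y" using assms t inv_le_inv_iff[of "inv t"] by (intro meet_le) (metis inv_closed inv_inv inv_le_inv_iff)+
  then show "inv (x \<and>\<^sub>L y) \<preceq> t" using assms t by (metis inv_closed inv_inv inv_le_inv_iff meet_closed)
qed (use assms in auto)

lemma inv_join:
  "x \<in> carrier G \<Longrightarrow> y \<in> carrier G \<Longrightarrow> inv (x \<or>\<^sub>L y) = inv x \<and>\<^sub>L inv y"
  using inv_meet[of "inv x" "inv y"] by (metis inv_closed inv_inv meet_closed)

lemma meet_mult:
  assumes "x \<in> carrier G" "y \<in> carrier G" "z \<in> carrier G"
  shows "(x \<and>\<^sub>L y) \<otimes> z = (x \<otimes> z) \<and>\<^sub>L (y \<otimes> z)"
proof (rule meet_eqI[symmetric])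
  fix t assume t: "t \<in> carrier G" "t \<preceq> x \<otimes> z" "t \<preceq> y \<otimes> z"
  then have "t \<otimes> inv z \<preceq> x \<and>\<^sub>L y" using assms by (intro meet_le) (auto simp: div_le_iff)
  then show "t \<preceq> (x \<and>\<^sub>L y) \<otimes> z" using assms t by (simp add: div_le_iff)
qed (use assms in auto)

text \<open>Inversion exchanges joins and meets, so x + y minus the join is the meet of x + y - x
  and x + y - y.\<close>

lemma join_times_meet:
  assumes "x \<in> carrier G" "y \<in> carrier G"
  shows "(x \<or>\<^sub>L y) \<otimes> (x \<and>\<^sub>L y) = x \<otimes> y"
proof -
  have "inv (x \<or>\<^sub>L y) \<otimes> (x \<otimes> y) = (inv x \<and>\<^sub>L inv y) \<otimes> (x \<otimes> y)" using assms by (simp add: inv_join)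
  also have "\<dots> = (inv x \<otimes> (x \<otimes> y)) \<and>\<^sub>L (inv y \<otimes> (y \<otimes> x))" 
    using assms m_comm[of x y] by (simp add: meet_mult)
  also have "\<dots> = x \<and>\<^sub>L y" using assms by (simp add: m_assoc[symmetric] meet_comm)
  finally show ?thesis using assms by (metis inv_closed inv_solve_left join_closed m_closed meet_closed)
qed

text \<open>The positive part of x - y; on the unit interval it is the MV-difference, see
  \<open>mv_diff_Gamma\<close>.\<close>

definition pdiff :: "'a \<Rightarrow> 'a \<Rightarrow> 'a" where
  "pdiff x y = (x \<otimes> inv y) \<or>\<^sub>L \<one>"

lemma pdiff_closed [simp]: "x \<in> carrier G \<Longrightarrow> y \<in> carrier G \<Longrightarrow> pdiff x y \<in> carrier G"
  by (simp add: pdiff_def)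

lemma pdiff_ge_one [simp]: "x \<in> carrier G \<Longrightarrow> y \<in> carrier G \<Longrightarrow> \<one> \<preceq> pdiff x y"
  by (simp add: pdiff_def)

lemma pdiff_mult: "x \<in> carrier G \<Longrightarrow> y \<in> carrier G \<Longrightarrow> pdiff x y \<otimes> y = x \<or>\<^sub>L y"
  by (simp add: pdiff_def join_mult m_assoc)

lemma pdiff_eqI:
  assumes "x \<in> carrier G" "y \<in> carrier G" "t \<in> carrier G" "t \<otimes> y = x \<or>\<^sub>L y"
  shows "pdiff x y = t"
  using assms pdiff_mult[of x y] by (metis pdiff_closed right_cancel)

lemma pdiff_meet: "x \<in> carrier G \<Longrightarrow> y \<in> carrier G \<Longrightarrow> pdiff x y \<otimes> (x \<and>\<^sub>L y) = x"
proof -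
  assume xy: "x \<in> carrier G" "y \<in> carrier G"
  have "(pdiff x y \<otimes> (x \<and>\<^sub>L y)) \<otimes> y = x \<otimes> y"
    using xy join_times_meet[of x y] pdiff_mult[of x y] by (metis m_assoc m_comm meet_closed pdiff_closed)
  then show ?thesis using xy by simp
qed

lemma pdiff_eq_one_iff:
  "x \<in> carrier G \<Longrightarrow> y \<in> carrier G \<Longrightarrow> pdiff x y = \<one> \<longleftrightarrow> x \<preceq> y"
  by (metis join_absorb join_left l_one one_closed pdiff_closed pdiff_eqI pdiff_mult)

lemma pdiff_le_iff:
  assumes "x \<in> carrier G" "y \<in> carrier G" "t \<in> carrier G" "\<one> \<preceq> t"
  shows "pdiff x y \<preceq> t \<longleftrightarrow> x \<preceq> t \<otimes> y"
proof
  assume le: "pdiff x y \<preceq> t"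
  have "x \<otimes> inv y \<preceq> pdiff x y" using assms by (simp add: pdiff_def)
  then have "x \<otimes> inv y \<preceq> t" by (rule lle_trans[OF _ le]) (use assms in auto)
  then show "x \<preceq> t \<otimes> y" using assms by (simp add: div_le_iff)
next
  assume "x \<preceq> t \<otimes> y"
  then show "pdiff x y \<preceq> t" unfolding pdiff_def
    using assms by (intro join_le) (auto simp: div_le_iff)
qed

lemma eq_pos_div: "x \<in> carrier G \<Longrightarrow> x = pdiff x \<one> \<otimes> inv (pdiff \<one> x)"
  using pdiff_mult[of \<one> x] by (simp add: inv_solve_right join_comm pdiff_def m_comm)

text \<open>This is the recursion of \<open>lres\<close> on the level of sums: y absorbs what it can
  of x, and the rest \<open>pdiff x y\<close> acts on s. Adding x turns both sides into joins, where
  y itself is absorbed because s is positive.\<close>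

lemma pdiff_mult_left:
  assumes "x \<in> carrier G" "y \<in> carrier G" "s \<in> carrier G" "\<one> \<preceq> s"
  shows "pdiff (y \<otimes> s) x = pdiff y x \<otimes> pdiff s (pdiff x y)"
proof (rule pdiff_eqI)
  have ys: "y \<preceq> y \<otimes> s" using assms mult_le_cancel_left[of \<one> s y] by simp
  have "pdiff y x \<otimes> pdiff s (pdiff x y) \<otimes> x = pdiff s (pdiff x y) \<otimes> (pdiff y x \<otimes> x)"
    using assms by (simp add: m_ac)
  also have "\<dots> = pdiff s (pdiff x y) \<otimes> pdiff x y \<otimes> y"
    using assms by (simp add: pdiff_mult[of y x] pdiff_mult[of x y] join_comm[of y x] m_assoc)
  also have "\<dots> = (s \<otimes> y) \<or>\<^sub>L (x \<or>\<^sub>L y)"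
    using assms by (simp add: pdiff_mult[of s] pdiff_mult[of x y] join_mult)
  also have "\<dots> = (y \<otimes> s) \<or>\<^sub>L x"
  proof -
    have ys': "y \<preceq> (y \<otimes> s) \<or>\<^sub>L x" by (rule lle_trans[OF ys]) (use assms in auto)
    have x: "x \<preceq> t" if "x \<or>\<^sub>L y \<preceq> t" "t \<in> carrier G" for t
      by (rule lle_trans[OF join_left that(1)]) (use assms that in auto)
    show ?thesis unfolding m_comm[OF \<open>s \<in> _\<close> \<open>y \<in> _\<close>]
    proof (rule join_eqI)
      show "x \<or>\<^sub>L y \<preceq> (y \<otimes> s) \<or>\<^sub>L x" using assms ys' by (intro join_le) auto
    next
      fix t assume "t \<in> carrier G" "y \<otimes> s \<preceq> t" "x \<or>\<^sub>L y \<preceq> t"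
      then show "y \<otimes> s \<or>\<^sub>L x \<preceq> t" using assms x[of t] by (intro join_le) auto
    qed (use assms in auto)
  qed
  finally show "pdiff y x \<otimes> pdiff s (pdiff x y) \<otimes> x = y \<otimes> s \<or>\<^sub>L x" .
qed (use assms in auto)

section \<open>Sums of words and Riesz decomposition\<close>

definition lsum :: "'a list \<Rightarrow> 'a" where "lsum v = foldr (\<otimes>) v \<one>"

lemma lsum_simps [simp]: "lsum [] = \<one>" "lsum (x # v) = x \<otimes> lsum v"
  by (simp_all add: lsum_def)

lemma lsum_closed [simp]: "v \<in> lists (carrier G) \<Longrightarrow> lsum v \<in> carrier G"
  by (induction v rule: list.induct) auto

lemma lsum_append [simp]:
  "v \<in> lists (carrier G) \<Longrightarrow> w \<in> lists (carrier G) \<Longrightarrow> lsum (v @ w) = lsum v \<otimes> lsum w"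
  by (induction v rule: list.induct) (auto simp: m_assoc)

lemma positive_coneI: "x \<in> carrier G \<Longrightarrow> \<one> \<preceq> x \<Longrightarrow> x \<in> positive_cone G"
  by (simp add: positive_cone_def)

lemma one_positive [simp]: "\<one> \<in> positive_cone G"
  by (simp add: positive_cone_def)

lemma positive_coneD [simp]: "x \<in> positive_cone G \<Longrightarrow> x \<in> carrier G" "x \<in> positive_cone G \<Longrightarrow> \<one> \<preceq> x"
  by (auto simp: positive_cone_def)


lemma positive_lists [simp]: "v \<in> lists (positive_cone G) \<Longrightarrow> v \<in> lists (carrier G)"
  by (auto simp: in_lists_conv_set)

lemma positive_mult [simp]:
  "x \<in> positive_cone G \<Longrightarrow> y \<in> positive_cone G \<Longrightarrow> x \<otimes> y \<in> positive_cone G"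
  using mult_mono[of \<one> x \<one> y] by (intro positive_coneI) simp_all

lemma positive_lsum [simp]: "v \<in> lists (positive_cone G) \<Longrightarrow> lsum v \<in> positive_cone G"
  by (induction v rule: list.induct) auto

lemma positive_pdiff [simp]: "x \<in> carrier G \<Longrightarrow> y \<in> carrier G \<Longrightarrow> pdiff x y \<in> positive_cone G"
  by (rule positive_coneI) simp_all

lemma lres_positive [simp]:
  "x \<in> positive_cone G \<Longrightarrow> v \<in> lists (positive_cone G) \<Longrightarrow> lres pdiff x v \<in> lists (positive_cone G)"
  by (induction v arbitrary: x rule: list.induct) auto

lemma lsum_lres:
  "x \<in> positive_cone G \<Longrightarrow> v \<in> lists (positive_cone G) \<Longrightarrow> lsum (lres pdiff x v) = pdiff (lsum v) x"
proof (induction v arbitrary: x rule: list.induct)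
  case Nil
  then show ?case using pdiff_eq_one_iff[of \<one> x] by simp
next
  case (Cons y v)
  then show ?case using pdiff_mult_left[of x y "lsum v"] by simp
qed

text \<open>By the adjunction \<open>pdiff_le_iff\<close>, both sides lie below the same positive
  elements.\<close>

lemma pdiff_pdiff:
  assumes "x \<in> carrier G" "y \<in> carrier G" "z \<in> carrier G" "\<one> \<preceq> z"
  shows "pdiff (pdiff x y) z = pdiff x (y \<otimes> z)"
proof (rule lle_antisym)
  let ?a = "pdiff (pdiff x y) z" and ?b = "pdiff x (y \<otimes> z)"
  have bz: "\<one> \<preceq> ?b \<otimes> z" using mult_mono[of \<one> ?b \<one> z] assms by simp
  have "x \<preceq> ?b \<otimes> (y \<otimes> z)" using assms pdiff_le_iff[of x "y \<otimes> z" ?b] by simp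
  then have "x \<preceq> (?b \<otimes> z) \<otimes> y" using assms by (simp add: m_ac)
  then show "?a \<preceq> ?b" using assms bz by (simp add: pdiff_le_iff)
  have az: "\<one> \<preceq> ?a \<otimes> z" using mult_mono[of \<one> ?a \<one> z] assms by simp
  have "pdiff x y \<preceq> ?a \<otimes> z" using assms pdiff_le_iff[of "pdiff x y" z ?a] by simp
  then have "x \<preceq> (?a \<otimes> z) \<otimes> y" using assms az by (simp add: pdiff_le_iff)
  then show "?b \<preceq> ?a" using assms by (simp add: pdiff_le_iff m_ac)
qed (use assms in auto)

lemma lsum_wres:
  "w \<in> lists (positive_cone G) \<Longrightarrow> v \<in> lists (positive_cone G) \<Longrightarrow>
    lsum (wres pdiff w v) = pdiff (lsum v) (lsum w)"
proof (induction w arbitrary: v rule: list.induct)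
  case Nil
  have "pdiff (lsum v) \<one> = lsum v" using Nil pdiff_mult[of "lsum v" \<one>] join_absorb[of \<one> "lsum v"] join_comm[of \<one> "lsum v"]
    by simp
  then show ?case by simp
next
  case (Cons x w)
  then show ?case by (simp add: lsum_lres pdiff_pdiff)
qed

lemma lsum_eq_one_iff:
  "v \<in> lists (positive_cone G) \<Longrightarrow> lsum v = \<one> \<longleftrightarrow> set v \<subseteq> {\<one>}"
proof (induction v rule: list.induct)
  case (Cons x v)
  have "x = \<one> \<and> lsum v = \<one>" if "x \<otimes> lsum v = \<one>"
  proof -
    have "x \<preceq> x \<otimes> lsum v" "lsum v \<preceq> x \<otimes> lsum v"
      using Cons.prems mult_le_cancel_left[of \<one> "lsum v" x] mult_le_cancel_right[of \<one> x "lsum v"] by simp_all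
    then show ?thesis using Cons.prems that by (auto intro!: lle_antisym)
  qed
  then show ?case using Cons by auto
qed simp

lemma wres_pdiff_positive [simp]:
  "w \<in> lists (positive_cone G) \<Longrightarrow> v \<in> lists (positive_cone G) \<Longrightarrow> wres pdiff w v \<in> lists (positive_cone G)"
  by (induction w arbitrary: v rule: list.induct) auto

lemma wle_pdiff_iff:
  assumes "w \<in> lists (positive_cone G)" "v \<in> lists (positive_cone G)"
  shows "wle pdiff \<one> v w \<longleftrightarrow> lsum v \<preceq> lsum w"
  using assms by (simp add: wle_def flip: lsum_eq_one_iff) (simp add: lsum_wres pdiff_eq_one_iff)

lemma Riesz_decomposition:
  assumes "y \<in> positive_cone G" "v \<in> lists (positive_cone G)" "y \<preceq> lsum v"
  obtains t where "list_all2 (\<preceq>) t v" "t \<in> lists (positive_cone G)" "lsum t = y"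
  using assms
proof (induction v arbitrary: y thesis rule: list.induct)
  case Nil
  then have "y = \<one>" by (auto intro: lle_antisym)
  then show ?case using Nil(1)[of "[]"] by simp
next
  case (Cons x v)
  \<comment> \<open>The first summand of y is its meet with x; the remainder
    \<open>pdiff y x\<close> lies below the rest of the word, so the induction hypothesis decomposes
    it.\<close>
  have "pdiff y x \<preceq> lsum v"
    using Cons.prems by (subst pdiff_le_iff) (auto simp: m_comm)
  then obtain t where t: "list_all2 (\<preceq>) t v" "t \<in> lists (positive_cone G)" "lsum t = pdiff y x"
    using Cons.IH[of "pdiff y x"] Cons.prems by auto
  have "\<one> \<preceq> y \<and>\<^sub>L x" using Cons.prems by (intro meet_le) auto
  then show ?case using Cons.prems t pdiff_meet[of y x]
    by (intro Cons.prems(1)[of "(y \<and>\<^sub>L x) # t"]) (auto simp: m_comm intro!: positive_coneI)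
qed

end

section \<open>The MV-algebra of a unital lattice-ordered group\<close>

context unital_lgroup
begin

declare strong_unit_closed [simp]

text \<open>A strong unit is only required to dominate through its multiples, so positivity must be
  derived. For t = u \<and> 0 one has (n+1) t = (n+1) u \<and> n t. Some multiple n u is above -u,
  whence (n+1) u \<ge> 0 \<ge> n t. Then (n+1) t = n t, and t = 0 by cancellation.\<close>

lemma unit_ge_one [simp]: "\<one> \<preceq> u"
proof -
  define t where "t = u \<and>\<^sub>L \<one>"
  have t [simp]: "t \<in> carrier G" by (simp add: t_def)
  have t1: "t \<preceq> \<one>" and tu: "t \<preceq> u" by (simp_all add: t_def)
  have pow_le: "t [^] n \<preceq> \<one>" for n :: nat
    by (induction n) (use mult_mono[OF _ t1] in fastforce)+
  have step: "t [^] Suc n = u [^] Suc n \<and>\<^sub>L t [^] n" for n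
  proof (induction n)
    case 0
    then show ?case by (simp add: t_def)
  next
    case (Suc n)
    have "t [^] Suc (Suc n) = (u \<otimes> t [^] Suc n) \<and>\<^sub>L t [^] Suc n"
      using meet_mult[of u \<one> "t [^] Suc n"] m_comm[of "t [^] Suc n" t] by (simp add: t_def)
    also have "u \<otimes> t [^] Suc n = u [^] Suc (Suc n) \<and>\<^sub>L (u \<otimes> t [^] n)"
      unfolding Suc by (simp add: m_comm[of u] meet_mult)
    \<comment> \<open>Since t \<le> u, the last term is below the middle one and absorbs it.\<close>
    also have "u [^] Suc (Suc n) \<and>\<^sub>L (u \<otimes> t [^] n) \<and>\<^sub>L t [^] Suc n = u [^] Suc (Suc n) \<and>\<^sub>L t [^] Suc n"
    proof (rule meet_eqI)
      have le: "t [^] Suc n \<preceq> u \<otimes> t [^] n" using tu by (simp add: m_comm[of u])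
      let ?m = "u [^] Suc (Suc n) \<and>\<^sub>L t [^] Suc n"
      have "?m \<preceq> u \<otimes> t [^] n" by (rule lle_trans[OF meet_right le]) simp_all
      then show "?m \<preceq> u [^] Suc (Suc n) \<and>\<^sub>L (u \<otimes> t [^] n)"
        by (intro meet_le meet_left) simp_all
      show "?m \<preceq> t [^] Suc n" by (rule meet_right) simp_all
    next
      fix s assume s: "s \<in> carrier G" "s \<preceq> u [^] Suc (Suc n) \<and>\<^sub>L (u \<otimes> t [^] n)" "s \<preceq> t [^] Suc n"
      have "s \<preceq> u [^] Suc (Suc n)" by (rule lle_trans[OF s(2) meet_left]) (use s in simp_all)
      then show "s \<preceq> u [^] Suc (Suc n) \<and>\<^sub>L t [^] Suc n" using s by (intro meet_le) simp_all
    qed simp_all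
    finally show ?case .
  qed
  obtain n :: nat where n: "inv u \<preceq> u [^] n" using strong_unit[of "inv u"] by auto
  then have "\<one> \<preceq> u [^] Suc n" using div_le_iff[of \<one> u "u [^] n"] by simp
  then have "t [^] n \<preceq> u [^] Suc n" using pow_le[of n] by (auto intro: lle_trans)
  then have "t [^] Suc n = t [^] n"
    unfolding step by (subst meet_comm) (simp_all add: meet_absorb)
  then have "t = \<one>" by simp
  then show ?thesis using tu by simp
qed

lemma Gamma_carrier: "x \<in> carrier (Gamma G u) \<longleftrightarrow> x \<in> carrier G \<and> \<one> \<preceq> x \<and> x \<preceq> u"
  by (simp add: Gamma_def)

lemma Gamma_carrierI: "x \<in> carrier G \<Longrightarrow> \<one> \<preceq> x \<Longrightarrow> x \<preceq> u \<Longrightarrow> x \<in> carrier (Gamma G u)"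
  by (simp add: Gamma_carrier)

lemma Gamma_simps [simp]:
  "x \<oplus>\<^bsub>Gamma G u\<^esub> y = x \<otimes> y \<and>\<^sub>L u" "\<sim>\<^bsub>Gamma G u\<^esub> x = u \<otimes> inv x"
  "\<zero>\<^bsub>Gamma G u\<^esub> = \<one>" "\<bbbone>\<^bsub>Gamma G u\<^esub> = u"
  by (simp_all add: Gamma_def)

lemma Gamma_carrierD [simp]: 
  "x \<in> carrier (Gamma G u) \<Longrightarrow> x \<in> carrier G" 
  "x \<in> carrier (Gamma G u) \<Longrightarrow> \<one> \<preceq> x" 
  "x \<in> carrier (Gamma G u) \<Longrightarrow> x \<preceq> u"
  "x \<in> carrier (Gamma G u) \<Longrightarrow> x \<in> positive_cone G"
  by (auto simp: Gamma_carrier intro: positive_coneI)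

lemma Gamma_lists [simp]: "v \<in> lists (carrier (Gamma G u)) \<Longrightarrow> v \<in> lists (positive_cone G)"
  by (auto simp: in_lists_conv_set)

text \<open>Adding a positive element to u exceeds u anyway, so intermediate truncations may be
  dropped. This gives associativity of the truncated sum.\<close>

lemma truncated_mult:
  assumes "x \<in> carrier G" "z \<in> carrier G" "\<one> \<preceq> z"
  shows "(x \<and>\<^sub>L u) \<otimes> z \<and>\<^sub>L u = x \<otimes> z \<and>\<^sub>L u"
proof (rule meet_eqI)
  show "x \<otimes> z \<and>\<^sub>L u \<preceq> (x \<and>\<^sub>L u) \<otimes> z"
    unfolding meet_mult[OF assms(1) strong_unit_closed assms(2)]
  proof (intro meet_le meet_left)
    have "u \<preceq> u \<otimes> z" using assms mult_le_cancel_left[of \<one> z u] by simp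
    then show "x \<otimes> z \<and>\<^sub>L u \<preceq> u \<otimes> z"
      using assms by (intro lle_trans[of "x \<otimes> z \<and>\<^sub>L u" u "u \<otimes> z"]) simp_all
  qed (use assms in auto)
  fix t assume t: "t \<in> carrier G" "t \<preceq> (x \<and>\<^sub>L u) \<otimes> z" "t \<preceq> u"
  have "t \<preceq> x \<otimes> z" by (rule lle_trans[OF t(2)]) (use assms t in auto)
  then show "t \<preceq> x \<otimes> z \<and>\<^sub>L u" using assms t by (intro meet_le) auto
qed (use assms in auto)

text \<open>Subtracting from u turns the truncation at u from above into a truncation at 0 from
  below.\<close>

lemma neg_truncated:
  assumes "x \<in> carrier G" "y \<in> carrier G"
  shows "u \<otimes> inv (u \<otimes> inv x \<otimes> y \<and>\<^sub>L u) = pdiff x y"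
proof -
  have "u \<otimes> inv (u \<otimes> inv x \<otimes> y) = x \<otimes> inv y"
    using assms by (simp add: inv_mult m_assoc[symmetric])
  then show ?thesis using assms by (simp add: inv_meet mult_join pdiff_def)
qed

lemma mv_diff_Gamma:
  "x \<in> carrier G \<Longrightarrow> y \<in> carrier G \<Longrightarrow> mv_diff (Gamma G u) x y = pdiff x y"
  by (simp add: mv_diff_def neg_truncated)

lemma Gamma_mv_algebra: "mv_algebra (Gamma G u)"
proof (rule mv_algebra.intro)
  show "comm_monoid \<lparr>carrier = carrier (Gamma G u), monoid.mult = mvplus (Gamma G u), one = mvzero (Gamma G u)\<rparr>"
  proof (rule comm_monoidI; simp only: monoid.simps partial_object.simps Gamma_simps)
    fix x y assume xy: "x \<in> carrier (Gamma G u)" "y \<in> carrier (Gamma G u)"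
    have "x \<otimes> y \<in> positive_cone G" using xy by simp
    then have "\<one> \<preceq> x \<otimes> y \<and>\<^sub>L u" by (intro meet_le) auto
    then show "x \<otimes> y \<and>\<^sub>L u \<in> carrier (Gamma G u)" using xy by (intro Gamma_carrierI) simp_all
    show "x \<otimes> y \<and>\<^sub>L u = y \<otimes> x \<and>\<^sub>L u" using xy by (simp add: m_comm)
    fix z assume z: "z \<in> carrier (Gamma G u)"
    have "(x \<otimes> y \<and>\<^sub>L u) \<otimes> z \<and>\<^sub>L u = y \<otimes> z \<otimes> x \<and>\<^sub>L u" using xy z by (simp add: truncated_mult) (simp add: m_ac)
    also have "\<dots> = (y \<otimes> z \<and>\<^sub>L u) \<otimes> x \<and>\<^sub>L u" using xy z by (simp add: truncated_mult)
    finally show "(x \<otimes> y \<and>\<^sub>L u) \<otimes> z \<and>\<^sub>L u = x \<otimes> (y \<otimes> z \<and>\<^sub>L u) \<and>\<^sub>L u" using xy z by (simp add: m_comm)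
  next
    show "\<one> \<in> carrier (Gamma G u)" by (rule Gamma_carrierI) simp_all
  next
    fix x assume x: "x \<in> carrier (Gamma G u)"
    have "\<one> \<otimes> x = x" using x by simp
    then show "\<one> \<otimes> x \<and>\<^sub>L u = x" using x by (simp only: meet_absorb Gamma_carrierD strong_unit_closed)
  qed
  fix x assume x: "x \<in> carrier (Gamma G u)"
  show "\<sim>\<^bsub>Gamma G u\<^esub> x \<in> carrier (Gamma G u)"
    using x mult_le_cancel_left[of "inv x" \<one> u] inv_le_inv_iff[of x \<one>]
    by (intro Gamma_carrierI) (simp_all add: le_div_iff del: mult_le_cancel_left)
  show "\<sim>\<^bsub>Gamma G u\<^esub> (\<sim>\<^bsub>Gamma G u\<^esub> x) = x" using x by (simp add: inv_mult m_assoc[symmetric])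
  have "u \<preceq> x \<otimes> u" using x mult_le_cancel_right[of \<one> x u] by simp
  then show "x \<oplus>\<^bsub>Gamma G u\<^esub> \<bbbone>\<^bsub>Gamma G u\<^esub> = \<bbbone>\<^bsub>Gamma G u\<^esub>" using x by (simp add: meet_comm[of _ u] meet_absorb)
  fix y assume y: "y \<in> carrier (Gamma G u)"
  \<comment> \<open>By \<open>neg_truncated\<close>, the untruncated form of either side of the last
    MV-axiom is a join, which is symmetric.\<close>
  have *: "s \<otimes> (u \<otimes> inv (s \<otimes> (u \<otimes> inv t) \<and>\<^sub>L u)) = t \<or>\<^sub>L s"
    if "s \<in> carrier G" "t \<in> carrier G" for s t
    using that neg_truncated[of t s] pdiff_mult[of t s] by (simp add: m_comm)
  show "x \<oplus>\<^bsub>Gamma G u\<^esub> \<sim>\<^bsub>Gamma G u\<^esub> (x \<oplus>\<^bsub>Gamma G u\<^esub> \<sim>\<^bsub>Gamma G u\<^esub> y) = y \<oplus>\<^bsub>Gamma G u\<^esub> \<sim>\<^bsub>Gamma G u\<^esub> (y \<oplus>\<^bsub>Gamma G u\<^esub> \<sim>\<^bsub>Gamma G u\<^esub> x)"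
    using x y by (simp add: * join_comm)
next
  show "\<bbbone>\<^bsub>Gamma G u\<^esub> \<in> carrier (Gamma G u)" unfolding Gamma_simps by (rule Gamma_carrierI) simp_all
qed simp

lemma mv_le_Gamma:
  assumes "x \<in> carrier (Gamma G u)" "y \<in> carrier (Gamma G u)"
  shows "mv_le (Gamma G u) x y \<longleftrightarrow> x \<preceq> y"
  using assms by (simp add: mv_le_iff[OF Gamma_mv_algebra] mv_diff_Gamma pdiff_eq_one_iff)

lemma wres_Gamma:
  assumes "w \<in> lists (carrier (Gamma G u))" "v \<in> lists (carrier (Gamma G u))"
  shows "wres (mv_diff (Gamma G u)) w v = wres pdiff w v"
  using map_wres[OF mv_algebra.difference_algebra[OF Gamma_mv_algebra], of id pdiff w v] assms
  by (simp add: mv_diff_Gamma)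

lemma wle_Gamma_iff:
  assumes "w \<in> lists (carrier (Gamma G u))" "v \<in> lists (carrier (Gamma G u))"
  shows "wle (mv_diff (Gamma G u)) \<one> v w \<longleftrightarrow> lsum v \<preceq> lsum w"
  using assms wle_pdiff_iff[of w v] by (simp add: wle_def wres_Gamma)

lemma lsum_replicate: "x \<in> carrier G \<Longrightarrow> lsum (replicate n x) = x [^] n"
  by (induction n) (auto simp: m_comm)

text \<open>Riesz decomposition against the word u, ..., u whose length is supplied by the strong
  unit; the resulting letters are below u.\<close>

lemma positive_eq_lsum:
  assumes "x \<in> positive_cone G"
  obtains v where "v \<in> lists (carrier (Gamma G u))" "x = lsum v"
proof -
  obtain n :: nat where "x \<preceq> u [^] n" using strong_unit assms by force
  moreover have "replicate n u \<in> lists (positive_cone G)"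
    by (auto simp: in_lists_conv_set intro: positive_coneI)
  ultimately obtain t where t: "list_all2 (\<preceq>) t (replicate n u)" "t \<in> lists (positive_cone G)" "lsum t = x"
    using Riesz_decomposition[of x "replicate n u"] assms lsum_replicate[of u n] by auto
  have "t \<in> lists (carrier (Gamma G u))"
    using t(1,2) by (auto simp: in_lists_conv_set list_all2_conv_all_nth in_set_conv_nth intro!: Gamma_carrierI)
  then show thesis using that t(3) by auto
qed

lemma eq_lsum_div:
  assumes "x \<in> carrier G"
  obtains v w where "v \<in> lists (carrier (Gamma G u))" "w \<in> lists (carrier (Gamma G u))"
    "x = lsum v \<otimes> inv (lsum w)"
  using positive_eq_lsum[of "pdiff x \<one>"] positive_eq_lsum[of "pdiff \<one> x"] eq_pos_div[of x] assms
  by (metis one_closed positive_pdiff)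

lemma common_denominator:
  assumes "x \<in> carrier G" "y \<in> carrier G"
  obtains a b c where "a \<in> lists (carrier (Gamma G u))" "b \<in> lists (carrier (Gamma G u))"
    "c \<in> lists (carrier (Gamma G u))" "x = lsum a \<otimes> inv (lsum c)" "y = lsum b \<otimes> inv (lsum c)"
proof -
  obtain a c where ac: "a \<in> lists (carrier (Gamma G u))" "c \<in> lists (carrier (Gamma G u))"
    "x = lsum a \<otimes> inv (lsum c)" using eq_lsum_div assms(1) .
  obtain b d where bd: "b \<in> lists (carrier (Gamma G u))" "d \<in> lists (carrier (Gamma G u))"
    "y = lsum b \<otimes> inv (lsum d)" using eq_lsum_div assms(2) .
  have *: "s \<otimes> inv t = (s \<otimes> r) \<otimes> inv (t \<otimes> r)" if "s \<in> carrier G" "t \<in> carrier G" "r \<in> carrier G" for s t r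
    using that by (simp add: inv_mult m_assoc m_lcomm[of r "inv t"])
  have "x = lsum (a @ d) \<otimes> inv (lsum (c @ d))"
    using ac bd *[of "lsum a" "lsum c" "lsum d"] by simp
  moreover have "y = lsum (b @ c) \<otimes> inv (lsum (c @ d))"
    using ac bd *[of "lsum b" "lsum d" "lsum c"] by (simp add: m_comm)
  ultimately show thesis using that[of "a @ d" "b @ c" "c @ d"] ac bd by auto
qed

end

section \<open>Homomorphisms and their restrictions to unit intervals\<close>

lemma (in abelian_lgroup) lgroup_homI:
  assumes "abelian_lgroup H" "f \<in> hom G H"
    and join: "\<And>x y. x \<in> carrier G \<Longrightarrow> y \<in> carrier G \<Longrightarrow> f (x \<or>\<^sub>L y) = lg_join H (f x) (f y)"
  shows "f \<in> lgroup_hom G H"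
proof -
  interpret H: abelian_lgroup H by fact
  have fc: "f x \<in> carrier H" if "x \<in> carrier G" for x using assms(2) that by (auto simp: hom_def)
  have fm: "f (x \<otimes> y) = f x \<otimes>\<^bsub>H\<^esub> f y" if "x \<in> carrier G" "y \<in> carrier G" for x y
    using assms(2) that by (auto simp: hom_def)
  have "f (x \<and>\<^sub>L y) = lg_meet H (f x) (f y)" if xy: "x \<in> carrier G" "y \<in> carrier G" for x y
  proof -
    \<comment> \<open>In both groups the sum of join and meet is the sum of the two elements;
      cancelling the preserved join leaves the meet.\<close>
    have "f (x \<or>\<^sub>L y) \<otimes>\<^bsub>H\<^esub> f (x \<and>\<^sub>L y) = f x \<otimes>\<^bsub>H\<^esub> f y"
      using xy fm[of "x \<or>\<^sub>L y" "x \<and>\<^sub>L y"] fm[of x y] by (simp add: join_times_meet)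
    also have "\<dots> = f (x \<or>\<^sub>L y) \<otimes>\<^bsub>H\<^esub> lg_meet H (f x) (f y)"
      using xy fc by (simp add: join H.join_times_meet)
    finally show ?thesis using xy fc by (simp add: H.m_comm[of "f (x \<or>\<^sub>L y)"])
  qed
  then show ?thesis using assms by (simp add: lgroup_hom_def)
qed

locale unital_lgroup_pair = A: unital_lgroup G u + B: unital_lgroup H v
  for G :: "'a lgroup" and u and H :: "'b lgroup" and v
begin

lemma lgroup_hom_closed: "f \<in> lgroup_hom G H \<Longrightarrow> x \<in> carrier G \<Longrightarrow> f x \<in> carrier H"
  by (auto simp: lgroup_hom_def hom_def)

lemma lgroup_hom_group_hom: "f \<in> lgroup_hom G H \<Longrightarrow> group_hom G H f"
  by unfold_locales (auto simp: lgroup_hom_def)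

lemma lgroup_hom_inv: "f \<in> lgroup_hom G H \<Longrightarrow> x \<in> carrier G \<Longrightarrow> f (inv\<^bsub>G\<^esub> x) = inv\<^bsub>H\<^esub> (f x)"
  using group_hom.hom_inv[OF lgroup_hom_group_hom] .

lemma lgroup_hom_one: "f \<in> lgroup_hom G H \<Longrightarrow> f \<one>\<^bsub>G\<^esub> = \<one>\<^bsub>H\<^esub>"
  using group_hom.hom_one[OF lgroup_hom_group_hom] .

lemma lgroup_hom_mult:
  "f \<in> lgroup_hom G H \<Longrightarrow> x \<in> carrier G \<Longrightarrow> y \<in> carrier G \<Longrightarrow> f (x \<otimes>\<^bsub>G\<^esub> y) = f x \<otimes>\<^bsub>H\<^esub> f y"
  by (simp add: lgroup_hom_def hom_def)

lemma lgroup_hom_mono: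
  assumes "f \<in> lgroup_hom G H" "x \<in> carrier G" "y \<in> carrier G" "x \<preceq>\<^bsub>G\<^esub> y"
  shows "f x \<preceq>\<^bsub>H\<^esub> f y"
proof -
  have "f (lg_join G x y) = lg_join H (f x) (f y)" using assms by (simp add: lgroup_hom_def)
  then have "f y = lg_join H (f x) (f y)" using assms by (simp add: A.join_absorb)
  then show ?thesis using B.join_left[of "f x" "f y"] lgroup_hom_closed assms by metis
qed

lemma lgroup_hom_lsum:
  assumes "f \<in> lgroup_hom G H" "w \<in> lists (carrier G)"
  shows "f (A.lsum w) = B.lsum (map f w)"
  using assms(2) by (induction w rule: list.induct)
    (auto simp: lgroup_hom_one[OF assms(1)] lgroup_hom_mult[OF assms(1)])

lemma restrict_mv_hom:
  assumes "f \<in> lgroup_hom G H" "f u = v"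
  shows "restrict f (carrier (Gamma G u)) \<in> mv_hom (Gamma G u) (Gamma H v)"
proof -
  interpret N: mv_algebra "Gamma G u" by (rule A.Gamma_mv_algebra)
  have "f x \<in> carrier (Gamma H v)" if "x \<in> carrier (Gamma G u)" for x
    using that assms lgroup_hom_mono[of f "\<one>\<^bsub>G\<^esub>" x] lgroup_hom_mono[of f x u]
    by (intro B.Gamma_carrierI) (simp_all add: lgroup_hom_closed lgroup_hom_one)
  moreover have "x \<otimes>\<^bsub>G\<^esub> y \<in> carrier G" if "x \<in> carrier (Gamma G u)" "y \<in> carrier (Gamma G u)" for x y
    using that by simp
  ultimately show ?thesis
    using N.plus_closed N.neg_closed N.zero_closed N.unit_closed assms
    by (auto simp: mv_hom_def lgroup_hom_one lgroup_hom_mult lgroup_hom_inv lgroup_hom_def[of G H])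
qed

text \<open>The unit interval generates the group, by \<open>eq_lsum_div\<close>. This makes the
  functor faithful.\<close>

lemma lgroup_hom_eqI:
  assumes "f \<in> lgroup_hom G H" "g \<in> lgroup_hom G H"
    and "\<And>x. x \<in> carrier (Gamma G u) \<Longrightarrow> f x = g x" "x \<in> carrier G"
  shows "f x = g x"
proof -
  obtain a b where ab: "a \<in> lists (carrier (Gamma G u))" "b \<in> lists (carrier (Gamma G u))"
    "x = A.lsum a \<otimes>\<^bsub>G\<^esub> inv\<^bsub>G\<^esub> (A.lsum b)" using A.eq_lsum_div assms(4) .
  have "B.lsum (map f a) = B.lsum (map g a)" "B.lsum (map f b) = B.lsum (map g b)"
    using ab assms(3) by (auto simp: in_lists_conv_set intro!: arg_cong[of _ _ B.lsum])
  then show ?thesis using ab assms(1,2)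
    by (simp add: lgroup_hom_mult lgroup_hom_inv lgroup_hom_lsum)
qed

lemma mv_hom_extends:
  assumes \<phi>: "\<phi> \<in> mv_hom (Gamma G u) (Gamma H v)"
  obtains f where "f \<in> lgroup_hom G H" "f u = v" "f \<in> extensional (carrier G)"
    "\<forall>x \<in> carrier (Gamma G u). f x = \<phi> x"
proof -
  let ?\<Gamma> = "carrier (Gamma G u)"
  interpret M: mv_algebra "Gamma G u" by (rule A.Gamma_mv_algebra)
  have \<phi>c [simp]: "\<phi> x \<in> carrier (Gamma H v)" if "x \<in> ?\<Gamma>" for x
    using \<phi> that by (auto simp: mv_hom_def)
  have map_closed [simp]: "map \<phi> a \<in> lists (carrier (Gamma H v))" if "a \<in> lists ?\<Gamma>" for a
    using that by (auto simp: in_lists_conv_set)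
  have \<phi>d: "\<phi> (mv_diff (Gamma G u) x y) = mv_diff (Gamma H v) (\<phi> x) (\<phi> y)"
    if "x \<in> ?\<Gamma>" "y \<in> ?\<Gamma>" for x y
    using \<phi> mv_hom_iff[OF A.Gamma_mv_algebra B.Gamma_mv_algebra, of \<phi>] that
    unfolding mv_hom_def by auto
  have \<phi>w: "map \<phi> (wres (mv_diff (Gamma G u)) a b) = wres (mv_diff (Gamma H v)) (map \<phi> a) (map \<phi> b)"
    if "a \<in> lists ?\<Gamma>" "b \<in> lists ?\<Gamma>" for a b
    by (rule map_wres[OF M.difference_algebra]) (use that \<phi>d in auto)
  have wres_closed [simp]: "wres (mv_diff (Gamma G u)) a b \<in> lists ?\<Gamma>"
    if "a \<in> lists ?\<Gamma>" "b \<in> lists ?\<Gamma>" for a b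
    by (rule difference_algebra.wres_closed[OF M.difference_algebra that])
  have \<phi>0: "\<phi> \<one>\<^bsub>G\<^esub> = \<one>\<^bsub>H\<^esub>" using \<phi> by (simp add: mv_hom_def)
  \<comment> \<open>The comparison of two sums says that a residual computed in the unit interval
    consists of zeros, and \<phi> commutes with residuals.\<close>
  have mono: "B.lsum (map \<phi> a) \<preceq>\<^bsub>H\<^esub> B.lsum (map \<phi> b)"
    if ab: "a \<in> lists ?\<Gamma>" "b \<in> lists ?\<Gamma>" and le: "A.lsum a \<preceq>\<^bsub>G\<^esub> A.lsum b" for a b
  proof -
    have "set (wres (mv_diff (Gamma G u)) b a) \<subseteq> {\<one>\<^bsub>G\<^esub>}"
      using le ab by (simp add: wle_def flip: A.wle_Gamma_iff)
    then have "set (wres (mv_diff (Gamma H v)) (map \<phi> b) (map \<phi> a)) \<subseteq> {\<one>\<^bsub>H\<^esub>}"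
      using ab \<phi>0 by (auto simp flip: \<phi>w)
    then show ?thesis using ab by (simp add: wle_def flip: B.wle_Gamma_iff)
  qed
  \<comment> \<open>An element has many presentations as a difference of sums. One is chosen, and
    the fact about f shows by cross addition and \<open>mono\<close> that the value is the same for
    all of them.\<close>
  define F where "F = (\<lambda>(a, b). B.lsum (map \<phi> a) \<otimes>\<^bsub>H\<^esub> inv\<^bsub>H\<^esub> (B.lsum (map \<phi> b)))"
  define f where "f = (\<lambda>x \<in> carrier G. F (SOME (a, b).
    a \<in> lists ?\<Gamma> \<and> b \<in> lists ?\<Gamma> \<and> x = A.lsum a \<otimes>\<^bsub>G\<^esub> inv\<^bsub>G\<^esub> (A.lsum b)))"
  have f: "f (A.lsum a \<otimes>\<^bsub>G\<^esub> inv\<^bsub>G\<^esub> (A.lsum b)) = B.lsum (map \<phi> a) \<otimes>\<^bsub>H\<^esub> inv\<^bsub>H\<^esub> (B.lsum (map \<phi> b))"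
    if ab: "a \<in> lists ?\<Gamma>" "b \<in> lists ?\<Gamma>" for a b
  proof -
    let ?P = "\<lambda>(c, d). c \<in> lists ?\<Gamma> \<and> d \<in> lists ?\<Gamma> \<and>
      A.lsum a \<otimes>\<^bsub>G\<^esub> inv\<^bsub>G\<^esub> (A.lsum b) = A.lsum c \<otimes>\<^bsub>G\<^esub> inv\<^bsub>G\<^esub> (A.lsum d)"
    have "?P (SOME p. ?P p)" by (rule someI[of ?P "(a, b)"]) (use ab in simp)
    then obtain c d where cd: "(SOME p. ?P p) = (c, d)" "c \<in> lists ?\<Gamma>" "d \<in> lists ?\<Gamma>"
      and eq: "A.lsum a \<otimes>\<^bsub>G\<^esub> inv\<^bsub>G\<^esub> (A.lsum b) = A.lsum c \<otimes>\<^bsub>G\<^esub> inv\<^bsub>G\<^esub> (A.lsum d)"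
      by (cases "SOME p. ?P p") auto
    have "A.lsum (a @ d) = A.lsum (c @ b)"
      using eq ab cd by (simp add: A.div_eq_div_iff)
    then have "B.lsum (map \<phi> (a @ d)) = B.lsum (map \<phi> (c @ b))"
      using mono[of "a @ d" "c @ b"] mono[of "c @ b" "a @ d"] ab cd
      by (intro B.lle_antisym) auto
    then have "B.lsum (map \<phi> a) \<otimes>\<^bsub>H\<^esub> inv\<^bsub>H\<^esub> (B.lsum (map \<phi> b)) = F (c, d)"
      using ab cd by (simp add: F_def B.div_eq_div_iff)
    then show ?thesis using cd ab by (simp add: f_def)
  qed
  have \<phi>f: "f x = \<phi> x" if "x \<in> ?\<Gamma>" for x using f[of "[x]" "[]"] that by simp
  have "f \<in> hom G H"
  proof (rule homI)
    fix x assume x: "x \<in> carrier G"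
    obtain a b where "a \<in> lists ?\<Gamma>" "b \<in> lists ?\<Gamma>" "x = A.lsum a \<otimes>\<^bsub>G\<^esub> inv\<^bsub>G\<^esub> (A.lsum b)"
      using A.eq_lsum_div[OF x] .
    then show "f x \<in> carrier H" using f[of a b] by simp
  next
    fix x y assume xy: "x \<in> carrier G" "y \<in> carrier G"
    obtain a b c where abc: "a \<in> lists ?\<Gamma>" "b \<in> lists ?\<Gamma>" "c \<in> lists ?\<Gamma>"
      "x = A.lsum a \<otimes>\<^bsub>G\<^esub> inv\<^bsub>G\<^esub> (A.lsum c)" "y = A.lsum b \<otimes>\<^bsub>G\<^esub> inv\<^bsub>G\<^esub> (A.lsum c)"
      using A.common_denominator[OF xy] .
    have "x \<otimes>\<^bsub>G\<^esub> y = A.lsum (a @ b) \<otimes>\<^bsub>G\<^esub> inv\<^bsub>G\<^esub> (A.lsum (c @ c))"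
      using abc by (simp add: A.inv_mult A.m_ac)
    then have "f (x \<otimes>\<^bsub>G\<^esub> y) = B.lsum (map \<phi> (a @ b)) \<otimes>\<^bsub>H\<^esub> inv\<^bsub>H\<^esub> (B.lsum (map \<phi> (c @ c)))"
      using f[of "a @ b" "c @ c"] abc by simp
    also have "\<dots> = f x \<otimes>\<^bsub>H\<^esub> f y" using f abc by (simp add: B.inv_mult B.m_ac)
    finally show "f (x \<otimes>\<^bsub>G\<^esub> y) = f x \<otimes>\<^bsub>H\<^esub> f y" .
  qed
  moreover have "f (lg_join G x y) = lg_join H (f x) (f y)" if xy: "x \<in> carrier G" "y \<in> carrier G" for x y
  proof -
    obtain a b c where abc: "a \<in> lists ?\<Gamma>" "b \<in> lists ?\<Gamma>" "c \<in> lists ?\<Gamma>"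
      "x = A.lsum a \<otimes>\<^bsub>G\<^esub> inv\<^bsub>G\<^esub> (A.lsum c)" "y = A.lsum b \<otimes>\<^bsub>G\<^esub> inv\<^bsub>G\<^esub> (A.lsum c)"
      using A.common_denominator[OF xy] .
    \<comment> \<open>A word for the join of the two numerators: b followed by the excess of a over
      b. The map \<phi> sends it to the word built in the same way from the images.\<close>
    define w where "w = wres (mv_diff (Gamma G u)) b a @ b"
    have w: "w \<in> lists ?\<Gamma>" using abc by (simp add: w_def)
    have "A.lsum w = lg_join G (A.lsum a) (A.lsum b)"
      using abc by (simp add: w_def A.wres_Gamma A.lsum_wres A.pdiff_mult)
    then have "lg_join G x y = A.lsum w \<otimes>\<^bsub>G\<^esub> inv\<^bsub>G\<^esub> (A.lsum c)"
      using abc by (simp add: A.join_mult)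
    moreover have "B.lsum (map \<phi> w) = lg_join H (B.lsum (map \<phi> a)) (B.lsum (map \<phi> b))"
      using abc by (simp add: w_def \<phi>w B.wres_Gamma B.lsum_wres B.pdiff_mult)
    ultimately show ?thesis using f[OF w] f[of a c] f[of b c] abc by (simp add: B.join_mult)
  qed
  ultimately have "f \<in> lgroup_hom G H" using A.lgroup_homI B.abelian_lgroup_axioms by blast
  moreover have "f u = v" using \<phi>f[of u] \<phi> M.unit_closed by (simp add: mv_hom_def)
  ultimately show thesis using that \<phi>f by (auto simp: f_def)
qed

end

section \<open>The group of differences\<close>

context difference_algebra
begin

lemma wle_perm:
  assumes "v \<sqsubseteq>w w" "mset v = mset v'" "mset w = mset w'" "v \<in> lists C" "w \<in> lists C"
  shows "v' \<sqsubseteq>w w'"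
proof -
  have c: "v' \<in> lists C" "w' \<in> lists C"
    using assms mset_eq_setD[OF assms(2)] mset_eq_setD[OF assms(3)] by (simp_all add: in_lists_conv_set)
  have "v' \<sqsubseteq>w v" using assms c by (intro wle_mset) simp_all
  also note assms(1)
  also (wle_trans) have "w \<sqsubseteq>w w'" using assms c by (intro wle_mset) simp_all
  finally (wle_trans) show ?thesis using assms c by simp
qed

text \<open>Upper bounds in the group of differences come with a denominator of their own; after
  cross addition it is the common prefix s.\<close>

lemma wjoin_least_append:
  assumes "s @ v \<sqsubseteq>w t" "s @ w \<sqsubseteq>w t" "s \<in> lists C" "v \<in> lists C" "w \<in> lists C" "t \<in> lists C"
  shows "s @ w @ (w \<setminus> v) \<sqsubseteq>w t"
proof -
  have z: "set (s \<setminus> s) \<subseteq> {z}" using wle_refl[OF assms(3)] by (simp add: wle_def)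
  have "(s @ w) \<setminus> (s @ v) = (s \<setminus> s) @ (w \<setminus> v)"
    using z assms by (simp add: wres_append_left wres_append_right wres_zeros_left wres_zeros_right)
  then have "(s @ w) @ ((s \<setminus> s) @ (w \<setminus> v)) \<sqsubseteq>w t"
    using wjoin_least[of "s @ v" t "s @ w"] assms by simp
  \<comment> \<open>The residual has the extra block \<open>s \<setminus> s\<close>; it consists of
    zeros and is dropped.\<close>
  moreover have "w \<setminus> v \<sqsubseteq>w (s \<setminus> s) @ (w \<setminus> v)"
    using wle_refl[of "w \<setminus> v"] z assms by (simp add: wle_def wres_append_left wres_zeros_left)
  then have "(s @ w) @ (w \<setminus> v) \<sqsubseteq>w (s @ w) @ ((s \<setminus> s) @ (w \<setminus> v))"
    using assms by (subst wle_append_left) simp_all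
  ultimately have "(s @ w) @ (w \<setminus> v) \<sqsubseteq>w t" using assms by (elim wle_trans[rotated]) simp_all
  then show ?thesis by simp
qed

definition ple :: "'a list \<times> 'a list \<Rightarrow> 'a list \<times> 'a list \<Rightarrow> bool" where
  "ple p q \<longleftrightarrow> fst p @ snd q \<sqsubseteq>w fst q @ snd p"

abbreviation "pairs \<equiv> lists C \<times> lists C"

lemma ple_refl: "p \<in> pairs \<Longrightarrow> ple p p"
  by (auto simp: ple_def)

lemma ple_trans:
  assumes "ple p q" "ple q r" "p \<in> pairs" "q \<in> pairs" "r \<in> pairs"
  shows "ple p r"
proof -
  obtain a b c e f g where pqr: "p = (a, b)" "q = (c, e)" "r = (f, g)" by (meson surj_pair)
  then have cl: "a \<in> lists C" "b \<in> lists C" "c \<in> lists C" "e \<in> lists C" "f \<in> lists C" "g \<in> lists C"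
    using assms by auto
  have "(a @ e) @ (c @ g) \<sqsubseteq>w (c @ b) @ (f @ e)"
    by (rule wle_append_mono) (use assms cl pqr in \<open>simp_all add: ple_def\<close>)
  then have "(a @ g) @ (c @ e) \<sqsubseteq>w (f @ b) @ (c @ e)"
    by (rule wle_perm) (use cl in simp_all)
  then have "a @ g \<sqsubseteq>w f @ b" using cl by (subst (asm) wle_append_right) simp_all
  then show ?thesis using pqr by (simp add: ple_def)
qed

end

text \<open>\<open>\<phi> (a, b)\<close> is the formal difference \<open>a - b\<close> of two words.\<close>

locale difference_group = difference_algebra C d z
  for C :: "'a set" and d (infixl \<open>\<ominus>\<close> 65) and z +
  fixes \<phi> :: "'a list \<times> 'a list \<Rightarrow> 'b"
  assumes \<phi>_eq_iff: "p \<in> lists C \<times> lists C \<Longrightarrow> q \<in> lists C \<times> lists C \<Longrightarrow>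
    \<phi> p = \<phi> q \<longleftrightarrow> difference_algebra.ple d z p q \<and> difference_algebra.ple d z q p"
begin

text \<open>The group has to live on an arbitrary type \<open>'b\<close>, so a class of pairs is
  represented by its code under \<phi>, and the operations read some pair with that code.\<close>

definition \<psi> :: "'b \<Rightarrow> 'a list \<times> 'a list" where "\<psi> = inv_into pairs \<phi>"

definition dgroup :: "'b lgroup" where
  "dgroup = \<lparr>carrier = \<phi> ` pairs,
    monoid.mult = (\<lambda>x y. \<phi> (fst (\<psi> x) @ fst (\<psi> y), snd (\<psi> x) @ snd (\<psi> y))),
    one = \<phi> ([], []), lg_le = (\<lambda>x y. ple (\<psi> x) (\<psi> y))\<rparr>"

lemma \<psi>_\<phi>:
  assumes "p \<in> pairs" shows "\<psi> (\<phi> p) \<in> pairs" "ple (\<psi> (\<phi> p)) p" "ple p (\<psi> (\<phi> p))"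
proof -
  show 1: "\<psi> (\<phi> p) \<in> pairs" unfolding \<psi>_def by (rule inv_into_into) (use assms in auto)
  have "\<phi> (\<psi> (\<phi> p)) = \<phi> p" unfolding \<psi>_def by (rule f_inv_into_f) (use assms in auto)
  then show "ple (\<psi> (\<phi> p)) p" "ple p (\<psi> (\<phi> p))" using \<phi>_eq_iff[OF 1 assms] by auto
qed

lemma dgroup_cases:
  assumes "x \<in> carrier dgroup"
  obtains a b where "x = \<phi> (a, b)" "a \<in> lists C" "b \<in> lists C"
  using assms by (auto simp: dgroup_def)

lemma \<phi>_closed [simp]: "a \<in> lists C \<Longrightarrow> b \<in> lists C \<Longrightarrow> \<phi> (a, b) \<in> carrier dgroup"
  by (auto simp: dgroup_def)

lemma one_dgroup: "\<one>\<^bsub>dgroup\<^esub> = \<phi> ([], [])"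
  by (simp add: dgroup_def)

lemma \<phi>_le_iff:
  assumes "a \<in> lists C" "b \<in> lists C" "c \<in> lists C" "e \<in> lists C"
  shows "\<phi> (a, b) \<preceq>\<^bsub>dgroup\<^esub> \<phi> (c, e) \<longleftrightarrow> a @ e \<sqsubseteq>w c @ b"
proof -
  have ab: "(a, b) \<in> pairs" and ce: "(c, e) \<in> pairs" using assms by simp_all
  have "ple (\<psi> (\<phi> (a, b))) (\<psi> (\<phi> (c, e))) \<longleftrightarrow> ple (a, b) (c, e)"
    using ple_trans \<psi>_\<phi>[OF ab] \<psi>_\<phi>[OF ce] ab ce by metis
  then show ?thesis by (simp add: dgroup_def ple_def)
qed

lemma \<phi>_eq:
  assumes "a \<in> lists C" "b \<in> lists C" "c \<in> lists C" "e \<in> lists C"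
  shows "\<phi> (a, b) = \<phi> (c, e) \<longleftrightarrow> a @ e \<simeq> c @ b"
  using \<phi>_eq_iff[of "(a, b)" "(c, e)"] assms by (simp add: ple_def weq_def)

text \<open>Reduces the group identities to equalities of multisets of letters.\<close>

lemma \<phi>_eqI:
  assumes "mset (a @ e) = mset (c @ b)" "a \<in> lists C" "b \<in> lists C" "c \<in> lists C" "e \<in> lists C"
  shows "\<phi> (a, b) = \<phi> (c, e)"
  using assms wle_mset[of "a @ e" "c @ b"] wle_mset[of "c @ b" "a @ e"] by (simp add: \<phi>_eq weq_def)

lemma \<phi>_mult:
  assumes "a \<in> lists C" "b \<in> lists C" "c \<in> lists C" "e \<in> lists C"
  shows "\<phi> (a, b) \<otimes>\<^bsub>dgroup\<^esub> \<phi> (c, e) = \<phi> (a @ c, b @ e)"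
proof -
  have ab: "(a, b) \<in> pairs" and ce: "(c, e) \<in> pairs" using assms by simp_all
  obtain a' b' where ab': "\<psi> (\<phi> (a, b)) = (a', b')" by fastforce
  obtain c' e' where ce': "\<psi> (\<phi> (c, e)) = (c', e')" by fastforce
  have cl: "a' \<in> lists C" "b' \<in> lists C" "c' \<in> lists C" "e' \<in> lists C"
    using \<psi>_\<phi>(1)[OF ab] \<psi>_\<phi>(1)[OF ce] ab' ce' by auto
  have *: "a' @ b \<sqsubseteq>w a @ b'" "a @ b' \<sqsubseteq>w a' @ b" "c' @ e \<sqsubseteq>w c @ e'" "c @ e' \<sqsubseteq>w c' @ e"
    using \<psi>_\<phi>(2,3)[OF ab] \<psi>_\<phi>(2,3)[OF ce] by (simp_all add: ab' ce' ple_def)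
  have "(a' @ b) @ (c' @ e) \<sqsubseteq>w (a @ b') @ (c @ e')" "(a @ b') @ (c @ e') \<sqsubseteq>w (a' @ b) @ (c' @ e)"
    by (rule wle_append_mono; use * assms cl in simp)+
  then have "(a' @ c') @ (b @ e) \<sqsubseteq>w (a @ c) @ (b' @ e')" "(a @ c) @ (b' @ e') \<sqsubseteq>w (a' @ c') @ (b @ e)"
    by (elim wle_perm; use assms cl in simp)+
  then have "\<phi> (a' @ c', b' @ e') = \<phi> (a @ c, b @ e)" using assms cl by (simp add: \<phi>_eq weq_def)
  then show ?thesis using ab' ce' by (simp add: dgroup_def)
qed

lemma dgroup_comm_group: "comm_group dgroup"
proof (rule comm_groupI)
  fix x y assume "x \<in> carrier dgroup" "y \<in> carrier dgroup"
  then obtain a b c e where x: "x = \<phi> (a, b)" "a \<in> lists C" "b \<in> lists C"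
    and y: "y = \<phi> (c, e)" "c \<in> lists C" "e \<in> lists C" by (elim dgroup_cases)
  show "x \<otimes>\<^bsub>dgroup\<^esub> y \<in> carrier dgroup" using x y by (simp add: \<phi>_mult)
  show "x \<otimes>\<^bsub>dgroup\<^esub> y = y \<otimes>\<^bsub>dgroup\<^esub> x" using x y by (auto simp: \<phi>_mult intro!: \<phi>_eqI)
  fix t assume "t \<in> carrier dgroup"
  then obtain f g where t: "t = \<phi> (f, g)" "f \<in> lists C" "g \<in> lists C" by (elim dgroup_cases)
  show "x \<otimes>\<^bsub>dgroup\<^esub> y \<otimes>\<^bsub>dgroup\<^esub> t = x \<otimes>\<^bsub>dgroup\<^esub> (y \<otimes>\<^bsub>dgroup\<^esub> t)" using x y t by (simp add: \<phi>_mult)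
next
  fix x assume "x \<in> carrier dgroup"
  then obtain a b where x: "x = \<phi> (a, b)" "a \<in> lists C" "b \<in> lists C" by (elim dgroup_cases)
  show "\<one>\<^bsub>dgroup\<^esub> \<otimes>\<^bsub>dgroup\<^esub> x = x" using x by (simp add: \<phi>_mult one_dgroup)
  have "\<phi> (b, a) \<otimes>\<^bsub>dgroup\<^esub> x = \<one>\<^bsub>dgroup\<^esub>" using x by (auto simp: \<phi>_mult one_dgroup intro!: \<phi>_eqI)
  then show "\<exists>y\<in>carrier dgroup. y \<otimes>\<^bsub>dgroup\<^esub> x = \<one>\<^bsub>dgroup\<^esub>" using x by (intro bexI[of _ "\<phi> (b, a)"]) simp_all
qed (simp add: one_dgroup)

lemma common_denominator:
  assumes "x \<in> carrier dgroup" "y \<in> carrier dgroup"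
  obtains a b c where "x = \<phi> (a, c)" "y = \<phi> (b, c)" "a \<in> lists C" "b \<in> lists C" "c \<in> lists C"
proof -
  obtain a b c e where x: "x = \<phi> (a, b)" "a \<in> lists C" "b \<in> lists C"
    and y: "y = \<phi> (c, e)" "c \<in> lists C" "e \<in> lists C" using assms by (elim dgroup_cases)
  have "x = \<phi> (a @ e, b @ e)" "y = \<phi> (c @ b, b @ e)" using x y by (auto intro!: \<phi>_eqI)
  then show thesis using x y that[of "a @ e" "b @ e" "c @ b"] by simp
qed

abbreviation dle (infix \<open>\<preceq>d\<close> 50) where "x \<preceq>d y \<equiv> x \<preceq>\<^bsub>dgroup\<^esub> y"

lemma dgroup_join:
  assumes "a \<in> lists C" "b \<in> lists C" "c \<in> lists C"
  defines "s \<equiv> \<phi> (b @ (b \<setminus> a), c)"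
  shows "\<phi> (a, c) \<preceq>d s" "\<phi> (b, c) \<preceq>d s"
    and "\<And>t. t \<in> carrier dgroup \<Longrightarrow> \<phi> (a, c) \<preceq>d t \<Longrightarrow> \<phi> (b, c) \<preceq>d t \<Longrightarrow> s \<preceq>d t"
proof -
  have "a \<sqsubseteq>w a @ (a \<setminus> b)" using assms by simp
  also have "a @ (a \<setminus> b) \<sqsubseteq>w b @ (b \<setminus> a)" using assms wjoin_comm[of a b] by (simp add: weq_def)
  finally (wle_trans) have "a \<sqsubseteq>w b @ (b \<setminus> a)" using assms by simp
  then show "\<phi> (a, c) \<preceq>d s" "\<phi> (b, c) \<preceq>d s"
    using assms wle_append_right[of c a "b @ (b \<setminus> a)"] wle_append_right[of c b "b @ (b \<setminus> a)"]
    by (simp_all add: \<phi>_le_iff)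
  fix t assume "t \<in> carrier dgroup" and le: "\<phi> (a, c) \<preceq>d t" "\<phi> (b, c) \<preceq>d t"
  then obtain f g where t: "t = \<phi> (f, g)" "f \<in> lists C" "g \<in> lists C" by (elim dgroup_cases)
  have "a @ g \<sqsubseteq>w f @ c" "b @ g \<sqsubseteq>w f @ c" using le t assms by (simp_all add: \<phi>_le_iff)
  then have "g @ a \<sqsubseteq>w f @ c" "g @ b \<sqsubseteq>w f @ c" by (elim wle_perm; use t assms in simp)+
  then have "g @ b @ (b \<setminus> a) \<sqsubseteq>w f @ c" using t assms by (intro wjoin_least_append) simp_all
  then have "(b @ (b \<setminus> a)) @ g \<sqsubseteq>w f @ c" by (rule wle_perm) (use t assms in simp_all)
  then show "s \<preceq>d t" using t assms by (simp add: \<phi>_le_iff)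
qed

lemma dgroup_refl: "x \<in> carrier dgroup \<Longrightarrow> x \<preceq>d x"
  by (auto elim!: dgroup_cases simp: \<phi>_le_iff)

lemma dgroup_trans:
  assumes "x \<preceq>d y" "y \<preceq>d t" "x \<in> carrier dgroup" "y \<in> carrier dgroup" "t \<in> carrier dgroup"
  shows "x \<preceq>d t"
proof -
  obtain a b c where xy: "x = \<phi> (a, c)" "y = \<phi> (b, c)" "a \<in> lists C" "b \<in> lists C" "c \<in> lists C"
    using common_denominator[OF assms(3,4)] .
  obtain f g where t: "t = \<phi> (f, g)" "f \<in> lists C" "g \<in> lists C" using assms(5) by (elim dgroup_cases)
  show ?thesis using ple_trans[of "(a, c)" "(b, c)" "(f, g)"] assms xy t by (simp add: ple_def \<phi>_le_iff)
qed

lemma dgroup_antisym: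
  "x \<preceq>d y \<Longrightarrow> y \<preceq>d x \<Longrightarrow> x \<in> carrier dgroup \<Longrightarrow> y \<in> carrier dgroup \<Longrightarrow> x = y"
  by (elim dgroup_cases) (simp add: \<phi>_le_iff \<phi>_eq weq_def)

lemma dgroup_inv: "a \<in> lists C \<Longrightarrow> b \<in> lists C \<Longrightarrow> inv\<^bsub>dgroup\<^esub> \<phi> (a, b) = \<phi> (b, a)"
proof -
  assume ab: "a \<in> lists C" "b \<in> lists C"
  interpret comm_group dgroup by (rule dgroup_comm_group)
  have "\<phi> (b, a) \<otimes>\<^bsub>dgroup\<^esub> \<phi> (a, b) = \<one>\<^bsub>dgroup\<^esub>"
    using ab by (auto simp: \<phi>_mult one_dgroup intro!: \<phi>_eqI)
  then show ?thesis using ab by (intro inv_equality) auto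
qed

lemma dgroup_inv_le:
  assumes "x \<in> carrier dgroup" "y \<in> carrier dgroup" "x \<preceq>d y"
  shows "inv\<^bsub>dgroup\<^esub> y \<preceq>d inv\<^bsub>dgroup\<^esub> x"
proof -
  obtain a b c where xy: "x = \<phi> (a, c)" "y = \<phi> (b, c)" "a \<in> lists C" "b \<in> lists C" "c \<in> lists C"
    using common_denominator[OF assms(1,2)] .
  have "a @ c \<sqsubseteq>w b @ c" using assms(3) xy by (simp add: \<phi>_le_iff)
  then have "c @ a \<sqsubseteq>w c @ b" by (rule wle_perm) (use xy in simp_all)
  then show ?thesis using xy by (simp add: dgroup_inv \<phi>_le_iff)
qed

lemma abelian_lgroup_dgroup: "abelian_lgroup dgroup"
proof -
  interpret comm_group dgroup by (rule dgroup_comm_group)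
  have join: "\<exists>s \<in> carrier dgroup. x \<preceq>d s \<and> y \<preceq>d s \<and> (\<forall>t \<in> carrier dgroup. x \<preceq>d t \<longrightarrow> y \<preceq>d t \<longrightarrow> s \<preceq>d t)"
    if xy: "x \<in> carrier dgroup" "y \<in> carrier dgroup" for x y
  proof -
    obtain a b c where "x = \<phi> (a, c)" "y = \<phi> (b, c)" "a \<in> lists C" "b \<in> lists C" "c \<in> lists C"
      using common_denominator[OF xy] .
    then show ?thesis using dgroup_join[of a b c] by (intro bexI[of _ "\<phi> (b @ (b \<setminus> a), c)"]) auto
  qed
  show ?thesis
  proof (unfold_locales, simp_all add: lg_order_def)
    fix x y assume xy: "x \<in> carrier dgroup" "y \<in> carrier dgroup"
    let ?L = "\<lparr>carrier = carrier dgroup, eq = (=), le = lg_le dgroup\<rparr>"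
    obtain s where s: "s \<in> carrier dgroup" "x \<preceq>d s" "y \<preceq>d s"
      "\<And>t. t \<in> carrier dgroup \<Longrightarrow> x \<preceq>d t \<Longrightarrow> y \<preceq>d t \<Longrightarrow> s \<preceq>d t" using join[OF xy] by blast
    then show "\<exists>s. least ?L s (Upper ?L {x, y})"
      using xy by (intro exI[of _ s]) (auto simp: least_def Upper_def)
    \<comment> \<open>The meet is the inverse of the join of the inverses.\<close>
    obtain m where m: "m \<in> carrier dgroup" "inv\<^bsub>dgroup\<^esub> x \<preceq>d m" "inv\<^bsub>dgroup\<^esub> y \<preceq>d m"
      "\<And>t. t \<in> carrier dgroup \<Longrightarrow> inv\<^bsub>dgroup\<^esub> x \<preceq>d t \<Longrightarrow> inv\<^bsub>dgroup\<^esub> y \<preceq>d t \<Longrightarrow> m \<preceq>d t"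
      using join[of "inv\<^bsub>dgroup\<^esub> x" "inv\<^bsub>dgroup\<^esub> y"] xy by auto
    have "inv\<^bsub>dgroup\<^esub> m \<preceq>d x" "inv\<^bsub>dgroup\<^esub> m \<preceq>d y"
      using dgroup_inv_le[OF _ m(1) m(2)] dgroup_inv_le[OF _ m(1) m(3)] xy by auto
    moreover have "t \<preceq>d inv\<^bsub>dgroup\<^esub> m" if "t \<in> carrier dgroup" "t \<preceq>d x" "t \<preceq>d y" for t
      using that m(4)[of "inv\<^bsub>dgroup\<^esub> t"] dgroup_inv_le[of t x] dgroup_inv_le[of t y]
        dgroup_inv_le[of m "inv\<^bsub>dgroup\<^esub> t"] m(1) xy by auto
    ultimately show "\<exists>s. greatest ?L s (Lower ?L {x, y})"
      using xy m(1) by (intro exI[of _ "inv\<^bsub>dgroup\<^esub> m"]) (auto simp: greatest_def Lower_def)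
  next
    fix x y t assume xyt: "x \<in> carrier dgroup" "y \<in> carrier dgroup" "t \<in> carrier dgroup" "x \<preceq>d y"
    obtain a b c where xy: "x = \<phi> (a, c)" "y = \<phi> (b, c)" "a \<in> lists C" "b \<in> lists C" "c \<in> lists C"
      using common_denominator[OF xyt(1,2)] .
    obtain f g where t: "t = \<phi> (f, g)" "f \<in> lists C" "g \<in> lists C" using xyt(3) by (elim dgroup_cases)
    have "a @ c \<sqsubseteq>w b @ c" using xyt(4) xy by (simp add: \<phi>_le_iff)
    then have "(a @ c) @ (f @ g) \<sqsubseteq>w (b @ c) @ (f @ g)" using xy t by (subst wle_append_right) simp_all
    then have "(a @ f) @ (c @ g) \<sqsubseteq>w (b @ f) @ (c @ g)" by (rule wle_perm) (use xy t in simp_all)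
    then show "x \<otimes>\<^bsub>dgroup\<^esub> t \<preceq>d y \<otimes>\<^bsub>dgroup\<^esub> t" using xy t by (simp add: \<phi>_mult \<phi>_le_iff)
  qed (use dgroup_refl dgroup_antisym dgroup_trans in blast)+
qed

lemma \<phi>_join:
  assumes "a \<in> lists C" "b \<in> lists C" "c \<in> lists C"
  shows "lg_join dgroup (\<phi> (a, c)) (\<phi> (b, c)) = \<phi> (b @ (b \<setminus> a), c)"
  using assms by (intro abelian_lgroup.join_eqI[OF abelian_lgroup_dgroup] dgroup_join) simp_all

end

section \<open>Mundici's theorem\<close>

text \<open>An infinite set contains a copy of its square and of the natural numbers. Pairing is
  iterated along a list, and the length is coded as well.\<close>

lemma infinite_list_coding:
  assumes "infinite (UNIV :: 'u set)"
  obtains enc :: "'u list \<times> 'u list \<Rightarrow> 'u" where "inj enc"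
proof -
  have "(card_of (UNIV \<times> UNIV :: ('u \<times> 'u) set), card_of (UNIV :: 'u set)) \<in> ordLeq"
    using card_of_Times_same_infinite[OF assms] ordIso_imp_ordLeq by blast
  then obtain p :: "'u \<times> 'u \<Rightarrow> 'u" where p: "inj p"
    using card_of_ordLeq[of "UNIV \<times> UNIV :: ('u \<times> 'u) set" "UNIV :: 'u set"] by auto
  obtain \<nu> :: "nat \<Rightarrow> 'u" where \<nu>: "inj \<nu>"
    using assms infinite_countable_subset by blast
  define f where "f = rec_list (\<nu> 0) (\<lambda>x _ r. p (x, r))"
  have f: "v = w" if "length v = length w" "f v = f w" for v w
    using that by (induction v w rule: list_induct2) (auto simp: f_def dest: injD[OF p])
  \<comment> \<open>The length is stored because an iterated pair might collide with
    \<open>\<nu> 0\<close>, the code of the empty list; f is injective only on lists of equal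
    length.\<close>
  define g where "g v = p (\<nu> (length v), f v)" for v
  have "inj g" by (rule injI) (auto simp: g_def dest!: injD[OF p] injD[OF \<nu>] intro: f)
  then have "inj (\<lambda>(v, w). p (g v, g w))" by (auto simp: inj_on_def dest!: injD[OF p])
  then show thesis by (rule that)
qed

context mv_algebra
begin

interpretation difference_algebra "carrier N" "mv_diff N" \<zero> by (rule difference_algebra)

lemma neg_eq_diff: "x \<in> carrier N \<Longrightarrow> mv_diff N \<bbbone> x = \<sim> x"
  by (simp add: mv_diff_def)

lemma diff_unit: "x \<in> carrier N \<Longrightarrow> mv_diff N x \<bbbone> = \<zero>"
  by (simp add: mv_diff_def)

text \<open>The vanishing difference says that y is below \<open>\<sim> x\<close>, so the sum is not
  truncated and subtracting x from it gives back y.\<close>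

lemma weq_plus:
  assumes xy: "x \<in> carrier N" "y \<in> carrier N" and "mv_diff N y (\<sim> x) = \<zero>"
  shows "weq (mv_diff N) \<zero> [x, y] [x \<oplus> y]"
proof -
  have "mv_diff N (x \<oplus> y) x = mv_diff N (\<sim> x) (mv_diff N (\<sim> x) y)"
    using xy plus_comm[of x "\<sim> (x \<oplus> y)"] by (simp add: mv_diff_def)
  also have "\<dots> = y" using assms diff_diff[of "\<sim> x" y] by simp
  finally have *: "mv_diff N (x \<oplus> y) x = y" .
  have "mv_diff N x (x \<oplus> y) = mv_diff N (mv_diff N x x) y" using xy by (simp add: mv_diff_diff del: diff_self)
  then show ?thesis using xy * by (simp add: weq_def wle_def)
qed

text \<open>The letters of such a word can be added one after another without any truncation. This
  identifies the elements of the group between 0 and u with letters.\<close>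

lemma wle_single_imp:
  assumes "c \<in> lists (carrier N)" "t \<in> carrier N" "wle (mv_diff N) \<zero> c [t]"
  obtains x where "x \<in> carrier N" "weq (mv_diff N) \<zero> c [x]"
  using assms
proof (induction c arbitrary: t thesis rule: list.induct)
  case Nil
  then show ?case using Nil(1)[of \<zero>] by (simp add: weq_def wle_def)
next
  case (Cons y c)
  have y: "y \<in> carrier N" "c \<in> lists (carrier N)" using Cons.prems by simp_all
  have c: "wle (mv_diff N) \<zero> c [mv_diff N t y]" using Cons.prems by (simp add: wle_def)
  obtain x where x: "x \<in> carrier N" "weq (mv_diff N) \<zero> c [x]"
    by (rule Cons.IH[OF _ y(2) _ c]) (use y Cons.prems in auto)
  have "wle (mv_diff N) \<zero> [x] c" using x by (simp add: weq_def)
  also note c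
  \<comment> \<open>Subtraction of y is monotone: the cube law compares t - y with 1 - y, and t is
    below the unit.\<close>
  also (wle_trans) have "wle (mv_diff N) \<zero> [mv_diff N t y] [\<sim> y]"
    using cube[of t y \<bbbone>] y Cons.prems by (simp add: wle_def diff_unit neg_eq_diff)
  finally (wle_trans) have "wle (mv_diff N) \<zero> [x] [\<sim> y]" using x y Cons.prems by simp
  then have yx: "weq (mv_diff N) \<zero> [y, x] [y \<oplus> x]" using weq_plus[of y x] x y by (simp add: wle_def)
  have "wle (mv_diff N) \<zero> (y # c) [y, x]" "wle (mv_diff N) \<zero> [y, x] (y # c)"
    using x y by (simp_all add: weq_def)
  then have "weq (mv_diff N) \<zero> (y # c) [y \<oplus> x]"
    using yx x y wle_trans[of "y # c" "[y, x]" "[y \<oplus> x]"] wle_trans[of "[y \<oplus> x]" "[y, x]" "y # c"]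
    by (simp add: weq_def)
  then show ?case using x y Cons.prems(1)[of "y \<oplus> x"] by simp
qed

lemma wle_replicate_unit:
  "c \<in> lists (carrier N) \<Longrightarrow> wle (mv_diff N) \<zero> c (replicate (length c) \<bbbone>)"
proof (induction c rule: list.induct)
  case (Cons y c)
  have "wle (mv_diff N) \<zero> ([y] @ c) ([\<bbbone>] @ replicate (length c) \<bbbone>)"
    by (rule wle_append_mono) (use Cons in \<open>simp_all add: wle_def diff_unit in_lists_conv_set\<close>)
  then show ?case by simp
qed simp

end

theorem Mundici:
  fixes N :: "'u mv" (structure)
  assumes "mv_algebra N" and "infinite (UNIV :: 'u set)"
  obtains G :: "'u lgroup" and u h where
    "unital_lgroup G u" "h \<in> mv_hom N (Gamma G u)" "bij_betw h (carrier N) (carrier (Gamma G u))"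
proof -
  interpret mv_algebra N by fact
  interpret difference_algebra "carrier N" "mv_diff N" \<zero> by (rule difference_algebra)
  let ?P = "lists (carrier N) \<times> lists (carrier N)"
  obtain enc :: "'u list \<times> 'u list \<Rightarrow> 'u" where enc: "inj enc" using infinite_list_coding assms(2) .
  \<comment> \<open>Equivalent pairs satisfy the same predicate, so choice returns the same
    representative for them. Coding it instead of the pair makes \<phi> constant on classes and
    injective between them.\<close>
  define rep where "rep p = (SOME q. q \<in> ?P \<and> ple p q \<and> ple q p)" for p
  define \<phi> where "\<phi> p = enc (rep p)" for p
  interpret difference_group "carrier N" "mv_diff N" \<zero> \<phi>
  proof
    fix p q assume pq: "p \<in> ?P" "q \<in> ?P"
    have rep: "rep p \<in> ?P \<and> ple p (rep p) \<and> ple (rep p) p" if "p \<in> ?P" for p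
      unfolding rep_def by (rule someI[of _ p]) (use that ple_refl in auto)
    show "\<phi> p = \<phi> q \<longleftrightarrow> ple p q \<and> ple q p"
    proof
      assume "\<phi> p = \<phi> q"
      then have "rep q = rep p" unfolding \<phi>_def by (auto dest: injD[OF enc])
      then have r: "rep p \<in> ?P" "ple p (rep p)" "ple (rep p) p" "ple q (rep p)" "ple (rep p) q"
        using rep[OF pq(1)] rep[OF pq(2)] by simp_all
      show "ple p q \<and> ple q p"
        using ple_trans[OF r(2,5) pq(1) r(1) pq(2)] ple_trans[OF r(4,3) pq(2) r(1) pq(1)] by blast
    next
      assume "ple p q \<and> ple q p"
      then have "(r \<in> ?P \<and> ple p r \<and> ple r p) = (r \<in> ?P \<and> ple q r \<and> ple r q)" for r
        using ple_trans[of p q r] ple_trans[of q p r] ple_trans[of r q p] ple_trans[of r p q] pq by blast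
      then show "\<phi> p = \<phi> q" unfolding \<phi>_def rep_def by simp
    qed
  qed
  define u where "u = \<phi> ([\<bbbone>], [])"
  have pow: "u [^]\<^bsub>dgroup\<^esub> n = \<phi> (replicate n \<bbbone>, [])" for n :: nat
  proof (induction n)
    case 0
    then show ?case by (simp add: nat_pow_def one_dgroup)
  next
    case (Suc n)
    interpret comm_group dgroup by (rule dgroup_comm_group)
    show ?case using Suc
      by (auto simp: nat_pow_Suc u_def \<phi>_mult in_lists_conv_set intro!: \<phi>_eqI)
  qed
  interpret D: unital_lgroup dgroup u
  proof (rule unital_lgroup.intro[OF abelian_lgroup_dgroup], unfold_locales)
    show "u \<in> carrier dgroup" by (simp add: u_def)
    fix x assume "x \<in> carrier dgroup"
    then obtain a b where x: "x = \<phi> (a, b)" "a \<in> lists (carrier N)" "b \<in> lists (carrier N)"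
      by (elim dgroup_cases)
    \<comment> \<open>Every letter is at most the unit, so a - b is bounded by as many units as a
      has letters.\<close>
    let ?r = "replicate (length a) \<bbbone>"
    have r: "?r \<in> lists (carrier N)" by (auto simp: in_lists_conv_set)
    have "wle (mv_diff N) \<zero> (a @ []) (?r @ b)"
      by (rule wle_append_mono) (use x r wle_replicate_unit in \<open>simp_all add: wle_def\<close>)
    then show "\<exists>n::nat. x \<preceq>\<^bsub>dgroup\<^esub> u [^]\<^bsub>dgroup\<^esub> n"
      using x r by (intro exI[of _ "length a"]) (simp add: pow \<phi>_le_iff)
  qed
  define h where "h x = \<phi> ([x], [])" for x
  have h: "h x \<in> carrier (Gamma dgroup u)" if "x \<in> carrier N" for x
    unfolding h_def using that
    by (intro D.Gamma_carrierI) (simp_all add: one_dgroup u_def \<phi>_le_iff wle_def diff_unit)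
  \<comment> \<open>Equivalent one-letter words have both differences zero, and then
    \<open>diff_diff\<close> reads x = y.\<close>
  have inj: "x = y" if "x \<in> carrier N" "y \<in> carrier N" "h x = h y" for x y
    using that diff_diff[of x y] by (simp add: h_def \<phi>_eq weq_def wle_def)
  have "\<exists>x\<in>carrier N. y = h x" if "y \<in> carrier (Gamma dgroup u)" for y
  proof -
    have "y \<in> carrier dgroup" using that by simp
    then obtain a b where y: "y = \<phi> (a, b)" and ab: "a \<in> lists (carrier N)" "b \<in> lists (carrier N)"
      by (elim dgroup_cases)
    \<comment> \<open>Since y is positive, b divides a and y is the sum of the cofactor c alone. As
      y is at most u, this word is equivalent to a single letter.\<close>
    define c where "c = wres (mv_diff N) b a"
    have c: "c \<in> lists (carrier N)" using ab by (simp add: c_def)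
    have "wle (mv_diff N) \<zero> b a" using D.Gamma_carrierD(2)[OF that] y ab by (simp add: one_dgroup \<phi>_le_iff)
    then have "weq (mv_diff N) \<zero> a (b @ c)" unfolding c_def using ab by (intro wle_imp_weq)
    then have yc: "y = \<phi> (b @ c, b)" unfolding y
      using ab c wle_append_right[of b a "b @ c"] wle_append_right[of b "b @ c" a] by (simp add: \<phi>_eq weq_def)
    then have yc: "y = \<phi> (c, [])" using ab c by (simp add: \<phi>_eqI)
    have "wle (mv_diff N) \<zero> c [\<bbbone>]" using D.Gamma_carrierD(3)[OF that] yc c by (simp add: u_def \<phi>_le_iff)
    then obtain x where "x \<in> carrier N" "weq (mv_diff N) \<zero> c [x]" using wle_single_imp[OF c, of \<bbbone>] by auto
    then show ?thesis using c yc by (intro bexI[of _ x]) (simp_all add: h_def \<phi>_eq)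
  qed
  then have bij: "bij_betw h (carrier N) (carrier (Gamma dgroup u))"
    using h inj by (auto simp: bij_betw_def inj_on_def)
  have neg: "h (\<sim> x) = \<sim>\<^bsub>Gamma dgroup u\<^esub> (h x)" if "x \<in> carrier N" for x
  proof -
    have "weq (mv_diff N) \<zero> [\<sim> x, x] [\<bbbone>]" using weq_plus[of "\<sim> x" x] that by simp
    then have "h (\<sim> x) = u \<otimes>\<^bsub>dgroup\<^esub> inv\<^bsub>dgroup\<^esub> (h x)"
      using that by (simp add: h_def u_def dgroup_inv \<phi>_mult \<phi>_eq)
    then show ?thesis by simp
  qed
  have zero: "h \<zero> = \<zero>\<^bsub>Gamma dgroup u\<^esub>"
    by (simp add: h_def one_dgroup \<phi>_eq weq_def wle_def)
  have diff: "h (mv_diff N x y) = mv_diff (Gamma dgroup u) (h x) (h y)" if "x \<in> carrier N" "y \<in> carrier N" for x y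
  proof -
    \<comment> \<open>Zero is written with denominator \<open>[y]\<close>, because
      \<open>\<phi>_join\<close> takes two differences with a common denominator.\<close>
    have "\<one>\<^bsub>dgroup\<^esub> = \<phi> ([y], [y])" unfolding one_dgroup using that by (intro \<phi>_eqI) simp_all
    then have "D.pdiff (h x) (h y) = \<phi> ([y] @ [mv_diff N x y], [y])"
      using that \<phi>_join[of "[x]" "[y]" "[y]"] by (simp add: D.pdiff_def h_def dgroup_inv \<phi>_mult)
    also have "\<dots> = h (mv_diff N x y)" unfolding h_def using that by (intro \<phi>_eqI) simp_all
    finally show ?thesis using that h by (simp add: D.mv_diff_Gamma)
  qed
  have "h \<in> mv_hom N (Gamma dgroup u)"
    using mv_hom_iff[of N "Gamma dgroup u" h] mv_algebra_axioms D.Gamma_mv_algebra h neg zero diff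
    by auto
  then show thesis using that[OF D.unital_lgroup_axioms] bij by auto
qed

section \<open>Equivalences of categories\<close>

lemma
  assumes "is_category C"
  shows Id_Hom: "X \<in> Obj C \<Longrightarrow> Id C X \<in> Hom C X X"
    and Comp_Hom: "X \<in> Obj C \<Longrightarrow> Y \<in> Obj C \<Longrightarrow> Z \<in> Obj C \<Longrightarrow> f \<in> Hom C X Y \<Longrightarrow> g \<in> Hom C Y Z \<Longrightarrow>
      Comp C X Y Z g f \<in> Hom C X Z"
    and Comp_Id: "X \<in> Obj C \<Longrightarrow> Y \<in> Obj C \<Longrightarrow> f \<in> Hom C X Y \<Longrightarrow> Comp C X X Y f (Id C X) = f"
    and Id_Comp: "X \<in> Obj C \<Longrightarrow> Y \<in> Obj C \<Longrightarrow> f \<in> Hom C X Y \<Longrightarrow> Comp C X Y Y (Id C Y) f = f"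
    and Comp_assoc: "W \<in> Obj C \<Longrightarrow> X \<in> Obj C \<Longrightarrow> Y \<in> Obj C \<Longrightarrow> Z \<in> Obj C \<Longrightarrow>
      f \<in> Hom C W X \<Longrightarrow> g \<in> Hom C X Y \<Longrightarrow> h \<in> Hom C Y Z \<Longrightarrow>
      Comp C W X Z (Comp C X Y Z h g) f = Comp C W Y Z h (Comp C W X Y g f)"
  using assms unfolding is_category_def by metis+

lemma
  assumes "is_functor C D F"
  shows functor_source: "is_category C"
    and functor_target: "is_category D"
    and fobj_Obj: "X \<in> Obj C \<Longrightarrow> fobj F X \<in> Obj D"
    and fmor_Hom: "X \<in> Obj C \<Longrightarrow> Y \<in> Obj C \<Longrightarrow> f \<in> Hom C X Y \<Longrightarrow>
      fmor F X Y f \<in> Hom D (fobj F X) (fobj F Y)"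
    and fmor_Id: "X \<in> Obj C \<Longrightarrow> fmor F X X (Id C X) = Id D (fobj F X)"
    and fmor_Comp: "X \<in> Obj C \<Longrightarrow> Y \<in> Obj C \<Longrightarrow> Z \<in> Obj C \<Longrightarrow> f \<in> Hom C X Y \<Longrightarrow> g \<in> Hom C Y Z \<Longrightarrow>
      fmor F X Z (Comp C X Y Z g f) =
        Comp D (fobj F X) (fobj F Y) (fobj F Z) (fmor F Y Z g) (fmor F X Y f)"
  using assms unfolding is_functor_def by simp_all

lemma is_functor_id: "is_category C \<Longrightarrow> is_functor C C id_functor"
  by (simp add: is_functor_def id_functor_def)

lemma is_functor_comp:
  assumes F: "is_functor C D F" and G: "is_functor D E G"
  shows "is_functor C E (comp_functor G F)"
  unfolding is_functor_def comp_functor_def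
  by (simp add: functor_source[OF F] functor_target[OF G] fobj_Obj[OF F] fobj_Obj[OF G]
      fmor_Hom[OF F] fmor_Hom[OF G] fmor_Id[OF F] fmor_Id[OF G] fmor_Comp[OF F] fmor_Comp[OF G])

text \<open>Choice supplies a preimage object and a pair of inverse arrows for each object of D.
  Fullness lifts arrows to C, and every equation in C is proved by applying F and computing in
  D.\<close>

lemma categorical_equivalenceI:
  assumes F: "is_functor C D F"
    and faithful: "\<And>X Y f g. X \<in> Obj C \<Longrightarrow> Y \<in> Obj C \<Longrightarrow> f \<in> Hom C X Y \<Longrightarrow> g \<in> Hom C X Y \<Longrightarrow>
      fmor F X Y f = fmor F X Y g \<Longrightarrow> f = g"
    and full: "\<And>X Y h. X \<in> Obj C \<Longrightarrow> Y \<in> Obj C \<Longrightarrow> h \<in> Hom D (fobj F X) (fobj F Y) \<Longrightarrow>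
      \<exists>f \<in> Hom C X Y. fmor F X Y f = h"
    and surj: "\<And>Z. Z \<in> Obj D \<Longrightarrow> \<exists>X \<in> Obj C. \<exists>e. isomorphism D (fobj F X) Z e"
  shows "categorical_equivalence C D F"
proof -
  note C = functor_source[OF F] and D = functor_target[OF F]
  note cat [simp] = Id_Hom[OF C] Id_Hom[OF D] Comp_Hom[OF C] Comp_Hom[OF D] Comp_Id[OF C] Comp_Id[OF D]
    Id_Comp[OF C] Id_Comp[OF D] Comp_assoc[OF C] Comp_assoc[OF D]
    fobj_Obj[OF F] fmor_Hom[OF F] fmor_Id[OF F] fmor_Comp[OF F]
  have "\<forall>Z. \<exists>X e e'. Z \<in> Obj D \<longrightarrow> X \<in> Obj C \<and> e \<in> Hom D (fobj F X) Z \<and> e' \<in> Hom D Z (fobj F X) \<and>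
      Comp D (fobj F X) Z (fobj F X) e' e = Id D (fobj F X) \<and> Comp D Z (fobj F X) Z e e' = Id D Z"
    using surj unfolding isomorphism_def by blast
  then obtain g e e' where ge: "\<And>Z. Z \<in> Obj D \<Longrightarrow> g Z \<in> Obj C \<and> e Z \<in> Hom D (fobj F (g Z)) Z \<and>
      e' Z \<in> Hom D Z (fobj F (g Z)) \<and>
      Comp D (fobj F (g Z)) Z (fobj F (g Z)) (e' Z) (e Z) = Id D (fobj F (g Z)) \<and>
      Comp D Z (fobj F (g Z)) Z (e Z) (e' Z) = Id D Z"
    by metis
  have g [simp]: "g Z \<in> Obj C" "e Z \<in> Hom D (fobj F (g Z)) Z" "e' Z \<in> Hom D Z (fobj F (g Z))"
    "Comp D (fobj F (g Z)) Z (fobj F (g Z)) (e' Z) (e Z) = Id D (fobj F (g Z))"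
    "Comp D Z (fobj F (g Z)) Z (e Z) (e' Z) = Id D Z" if "Z \<in> Obj D" for Z
    using ge[OF that] by auto
  \<comment> \<open>Compositions are normalised by associativity to the right, so e after e' must
    also cancel in front of a further arrow.\<close>
  have cancel [simp]: "Comp D A (fobj F (g Z)) Z (e Z) (Comp D A Z (fobj F (g Z)) (e' Z) q) = q"
    if "A \<in> Obj D" "Z \<in> Obj D" "q \<in> Hom D A Z" for A Z q
    using that Comp_assoc[OF D, of A Z "fobj F (g Z)" Z q "e' Z" "e Z"] by simp
  \<comment> \<open>The transport of h along the chosen isomorphisms; its lift to C is the arrow
    part of the quasi-inverse.\<close>
  define conj where "conj Z W h = Comp D (fobj F (g Z)) W (fobj F (g W)) (e' W) (Comp D (fobj F (g Z)) Z W h (e Z))"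
    for Z W h
  have conj [simp]: "conj Z W h \<in> Hom D (fobj F (g Z)) (fobj F (g W))"
    if "Z \<in> Obj D" "W \<in> Obj D" "h \<in> Hom D Z W" for Z W h
    using that by (simp add: conj_def)
  define gm where "gm Z W h = (SOME f. f \<in> Hom C (g Z) (g W) \<and> fmor F (g Z) (g W) f = conj Z W h)" for Z W h
  have gm [simp]: "gm Z W h \<in> Hom C (g Z) (g W)" "fmor F (g Z) (g W) (gm Z W h) = conj Z W h"
    if "Z \<in> Obj D" "W \<in> Obj D" "h \<in> Hom D Z W" for Z W h
  proof -
    have "\<exists>f. f \<in> Hom C (g Z) (g W) \<and> fmor F (g Z) (g W) f = conj Z W h"
      using full[of "g Z" "g W" "conj Z W h"] that by auto
    from someI_ex[OF this, folded gm_def]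
    show "gm Z W h \<in> Hom C (g Z) (g W)" "fmor F (g Z) (g W) (gm Z W h) = conj Z W h" by auto
  qed
  define G where "G = \<lparr>fobj = g, fmor = gm\<rparr>"
  have G: "is_functor D C G"
    unfolding is_functor_def
  proof (intro conjI ballI)
    fix Z assume "Z \<in> Obj D"
    then show "fmor G Z Z (Id D Z) = Id C (fobj G Z)"
      unfolding G_def by (intro faithful[of "g Z" "g Z"]) (simp_all, simp add: conj_def)
  next
    fix Z W V h k assume "Z \<in> Obj D" "W \<in> Obj D" "V \<in> Obj D" "h \<in> Hom D Z W" "k \<in> Hom D W V"
    then show "fmor G Z V (Comp D Z W V k h) = Comp C (fobj G Z) (fobj G W) (fobj G V) (fmor G W V k) (fmor G Z W h)"
      unfolding G_def by (intro faithful[of "g Z" "g V"]) (simp_all, simp add: conj_def)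
  qed (simp_all add: C D G_def)
  \<comment> \<open>The unit at X is the lift of the chosen arrow from F X to its replacement;
    \<theta> lifts the inverse arrow and becomes the inverse of the unit by faithfulness.\<close>
  have "\<forall>X. \<exists>\<eta> \<theta>. X \<in> Obj C \<longrightarrow> \<eta> \<in> Hom C X (g (fobj F X)) \<and> fmor F X (g (fobj F X)) \<eta> = e' (fobj F X) \<and>
      \<theta> \<in> Hom C (g (fobj F X)) X \<and> fmor F (g (fobj F X)) X \<theta> = e (fobj F X)"
  proof (intro allI)
    fix X
    show "\<exists>\<eta> \<theta>. X \<in> Obj C \<longrightarrow> \<eta> \<in> Hom C X (g (fobj F X)) \<and> fmor F X (g (fobj F X)) \<eta> = e' (fobj F X) \<and>
      \<theta> \<in> Hom C (g (fobj F X)) X \<and> fmor F (g (fobj F X)) X \<theta> = e (fobj F X)"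
      using full[of X "g (fobj F X)" "e' (fobj F X)"] full[of "g (fobj F X)" X "e (fobj F X)"]
      by (cases "X \<in> Obj C") auto
  qed
  then obtain \<eta> \<theta> where "\<And>X. X \<in> Obj C \<Longrightarrow> \<eta> X \<in> Hom C X (g (fobj F X)) \<and>
      fmor F X (g (fobj F X)) (\<eta> X) = e' (fobj F X) \<and>
      \<theta> X \<in> Hom C (g (fobj F X)) X \<and> fmor F (g (fobj F X)) X (\<theta> X) = e (fobj F X)"
    by metis
  then have \<eta> [simp]: "\<eta> X \<in> Hom C X (g (fobj F X))" "fmor F X (g (fobj F X)) (\<eta> X) = e' (fobj F X)"
      "\<theta> X \<in> Hom C (g (fobj F X)) X" "fmor F (g (fobj F X)) X (\<theta> X) = e (fobj F X)" if "X \<in> Obj C" for X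
    using that by auto
  have "natural_isomorphism C C id_functor (comp_functor G F) \<eta>"
    unfolding natural_isomorphism_def
  proof (intro conjI ballI)
    fix X assume X: "X \<in> Obj C"
    have "Comp C X (g (fobj F X)) X (\<theta> X) (\<eta> X) = Id C X"
      by (rule faithful[of X X]) (use X in simp_all)
    moreover have "Comp C (g (fobj F X)) X (g (fobj F X)) (\<eta> X) (\<theta> X) = Id C (g (fobj F X))"
      by (rule faithful[of "g (fobj F X)" "g (fobj F X)"]) (use X in simp_all)
    ultimately show "isomorphism C (fobj id_functor X) (fobj (comp_functor G F) X) (\<eta> X)"
      using X \<eta>(1,3)[OF X] unfolding isomorphism_def id_functor_def comp_functor_def G_def by auto
    fix Y f assume Y: "Y \<in> Obj C" and f: "f \<in> Hom C X Y"
    have "Comp C X Y (g (fobj F Y)) (\<eta> Y) f =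
      Comp C X (g (fobj F X)) (g (fobj F Y)) (gm (fobj F X) (fobj F Y) (fmor F X Y f)) (\<eta> X)"
      by (rule faithful[of X "g (fobj F Y)"]) (use X Y f in \<open>simp_all, simp add: conj_def\<close>)
    then show "Comp C (fobj id_functor X) (fobj id_functor Y) (fobj (comp_functor G F) Y) (\<eta> Y)
        (fmor id_functor X Y f) = Comp C (fobj id_functor X) (fobj (comp_functor G F) X)
        (fobj (comp_functor G F) Y) (fmor (comp_functor G F) X Y f) (\<eta> X)"
      by (simp add: id_functor_def comp_functor_def G_def)
  qed (rule is_functor_id[OF C] is_functor_comp[OF F G])+
  moreover have "natural_isomorphism D D (comp_functor F G) id_functor e"
    unfolding natural_isomorphism_def
  proof (intro conjI ballI)
    fix Z assume Z: "Z \<in> Obj D"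
    show "isomorphism D (fobj (comp_functor F G) Z) (fobj id_functor Z) (e Z)"
      using g[OF Z] unfolding isomorphism_def id_functor_def comp_functor_def G_def by auto
    fix W h assume "W \<in> Obj D" "h \<in> Hom D Z W"
    then show "Comp D (fobj (comp_functor F G) Z) (fobj (comp_functor F G) W) (fobj id_functor W) (e W)
        (fmor (comp_functor F G) Z W h) = Comp D (fobj (comp_functor F G) Z) (fobj id_functor Z)
        (fobj id_functor W) (fmor id_functor Z W h) (e Z)"
      using Z by (simp add: id_functor_def comp_functor_def G_def) (simp add: conj_def)
  qed (rule is_functor_id[OF D] is_functor_comp[OF G F])+
  ultimately show ?thesis using F G unfolding categorical_equivalence_def by blast
qed

section \<open>Ideals\<close>

lemma unit_notin_proper_ideal:
  assumes "mv_algebra N" "mv_ideal N J" "J \<noteq> carrier N"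
  shows "\<bbbone>\<^bsub>N\<^esub> \<notin> J"
proof
  interpret mv_algebra N by fact
  assume "\<bbbone>\<^bsub>N\<^esub> \<in> J"
  then have "x \<in> J" if "x \<in> carrier N" for x
    using assms(2) that unfolding mv_ideal_def by (auto simp: mv_le_def)
  then show False using assms by (auto simp: mv_ideal_def)
qed

text \<open>An element outside J is the negation of some a in J. An ideal containing J and this
  element contains both a and its negation, hence their sum 1.\<close>

lemma maximal_mv_idealI:
  assumes N: "mv_algebra N" and J: "mv_ideal N J" "\<bbbone>\<^bsub>N\<^esub> \<notin> J" "carrier N = J \<union> mvneg N ` J"
  shows "maximal_mv_ideal N J"
proof -
  interpret mv_algebra N by fact
  have "\<not> J \<subset> K" if K: "mv_ideal N K" "K \<noteq> carrier N" for K
  proof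
    assume "J \<subset> K"
    then obtain x where x: "x \<in> K" "x \<notin> J" by blast
    then have "x \<in> carrier N" using K by (auto simp: mv_ideal_def)
    then obtain a where a: "a \<in> J" "x = \<sim>\<^bsub>N\<^esub> a" using x J(3) by blast
    then have "x \<oplus>\<^bsub>N\<^esub> a \<in> K" using x \<open>J \<subset> K\<close> K(1) by (auto simp: mv_ideal_def)
    moreover have "a \<in> carrier N" using a J(1) by (auto simp: mv_ideal_def)
    ultimately show False using unit_notin_proper_ideal[OF N K] a by simp
  qed
  then show ?thesis using J by (auto simp: maximal_mv_ideal_def)
qed

section \<open>Convex \<ell>-subgroups and their traces on the unit interval\<close>

context abelian_lgroup
begin

lemma
  assumes "l_ideal G I"
  shows l_ideal_carrier: "x \<in> I \<Longrightarrow> x \<in> carrier G"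
    and l_ideal_one: "\<one> \<in> I"
    and l_ideal_mult: "x \<in> I \<Longrightarrow> y \<in> I \<Longrightarrow> x \<otimes> y \<in> I"
    and l_ideal_inv: "x \<in> I \<Longrightarrow> inv x \<in> I"
    and l_ideal_pdiff: "x \<in> I \<Longrightarrow> y \<in> I \<Longrightarrow> pdiff x y \<in> I"
    and l_ideal_convex: "x \<in> I \<Longrightarrow> t \<in> I \<Longrightarrow> y \<in> carrier G \<Longrightarrow> x \<preceq> y \<Longrightarrow> y \<preceq> t \<Longrightarrow> y \<in> I"
proof -
  have sub: "subgroup I G" using assms by (simp add: l_ideal_def)
  show "x \<in> I \<Longrightarrow> x \<in> carrier G" by (rule subgroup.mem_carrier[OF sub])
  show one: "\<one> \<in> I" by (rule subgroup.one_closed[OF sub])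
  show mult: "x \<in> I \<Longrightarrow> y \<in> I \<Longrightarrow> x \<otimes> y \<in> I" for x y by (rule subgroup.m_closed[OF sub])
  show inv: "x \<in> I \<Longrightarrow> inv x \<in> I" for x by (rule subgroup.m_inv_closed[OF sub])
  show "x \<in> I \<Longrightarrow> t \<in> I \<Longrightarrow> y \<in> carrier G \<Longrightarrow> x \<preceq> y \<Longrightarrow> y \<preceq> t \<Longrightarrow> y \<in> I"
    using assms unfolding l_ideal_def by blast
  note lattice = assms[unfolded l_ideal_def, THEN conjunct2, THEN conjunct1]
  have join: "x \<or>\<^sub>L y \<in> I" if "x \<in> I" "y \<in> I" for x y
    by (rule conjunct1[OF bspec[OF bspec[OF lattice that(1)] that(2)]])
  show "x \<in> I \<Longrightarrow> y \<in> I \<Longrightarrow> pdiff x y \<in> I"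
    unfolding pdiff_def by (intro join mult inv one)
qed

text \<open>The join of x and y is the positive part of x - y plus y, and meets follow by inversion;
  so closure under positive parts suffices.\<close>

lemma l_idealI:
  assumes sub: "subgroup I G"
    and convex: "\<And>x y t. x \<in> I \<Longrightarrow> t \<in> I \<Longrightarrow> y \<in> carrier G \<Longrightarrow> x \<preceq> y \<Longrightarrow> y \<preceq> t \<Longrightarrow> y \<in> I"
    and pdiff: "\<And>x. x \<in> I \<Longrightarrow> pdiff x \<one> \<in> I"
  shows "l_ideal G I"
proof -
  note carr [simp] = subgroup.mem_carrier[OF sub]
  have join: "x \<or>\<^sub>L y \<in> I" if "x \<in> I" "y \<in> I" for x y
  proof -
    have "pdiff (x \<otimes> inv y) \<one> \<in> I"
      using that by (intro pdiff subgroup.m_closed[OF sub] subgroup.m_inv_closed[OF sub])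
    then have "pdiff x y \<otimes> y \<in> I" using that subgroup.m_closed[OF sub] by (simp add: pdiff_def)
    then show ?thesis using that by (simp add: pdiff_mult)
  qed
  have "x \<and>\<^sub>L y \<in> I" if "x \<in> I" "y \<in> I" for x y
  proof -
    have "inv (inv x \<or>\<^sub>L inv y) \<in> I"
      using that by (intro join subgroup.m_inv_closed[OF sub])
    then show ?thesis using that by (simp add: inv_join)
  qed
  then show ?thesis unfolding l_ideal_def using sub join convex by blast
qed

lemma le_lsum:
  "v \<in> lists (positive_cone G) \<Longrightarrow> x \<in> set v \<Longrightarrow> x \<preceq> lsum v"
proof (induction v rule: list.induct)
  case (Cons y v)
  have y: "y \<in> positive_cone G" "lsum v \<in> positive_cone G" using Cons.prems by simp_all
  show ?case
  proof (cases "x = y")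
    case True
    then show ?thesis using y mult_le_cancel_left[of \<one> "lsum v" y] by simp
  next
    case False
    then have "x \<in> set v" using Cons.prems by simp
    then have "x \<in> carrier G" "x \<preceq> lsum v" using Cons by (auto simp: in_lists_conv_set)
    then show ?thesis using y mult_mono[of \<one> y x "lsum v"] by simp
  qed
qed simp

end

context unital_lgroup
begin

lemma unit_pow_ge_one [simp]: "\<one> \<preceq> u [^] (n::nat)"
proof (induction n)
  case (Suc n)
  then show ?case using mult_mono[of \<one> "u [^] n" \<one> u] by simp
qed simp

lemma unit_le_pow: "1 \<le> n \<Longrightarrow> u \<preceq> u [^] (n::nat)"
  using mult_le_cancel_right[of \<one> "u [^] (n - 1)" u] by (cases n) simp_all

lemma l_ideal_eq_carrier:
  assumes K: "l_ideal G K" and u: "u \<in> K"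
  shows "K = carrier G"
proof -
  have pow: "u [^] n \<in> K" for n :: nat
    by (induction n) (simp_all add: l_ideal_one[OF K] l_ideal_mult[OF K] u)
  have "x \<in> K" if x: "x \<in> carrier G" for x
  proof -
    obtain n m :: nat where "x \<preceq> u [^] n" "inv x \<preceq> u [^] m" using strong_unit x by (meson inv_closed)
    moreover have "inv (u [^] m) \<preceq> x"
      using inv_le_inv_iff[of "u [^] m" "inv x"] \<open>inv x \<preceq> u [^] m\<close> x by simp
    ultimately show ?thesis using l_ideal_convex[OF K] l_ideal_inv[OF K] pow x by blast
  qed
  then show ?thesis using l_ideal_carrier[OF K] by blast
qed

text \<open>The letters of any word with sum x lie between 0 and x, hence in I by convexity.\<close>

lemma l_ideal_positive_eq_lsum:
  assumes I: "l_ideal G I" and x: "x \<in> I" "\<one> \<preceq> x"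
  obtains v where "v \<in> lists (I \<inter> carrier (Gamma G u))" "x = lsum v"
proof -
  obtain v where v: "v \<in> lists (carrier (Gamma G u))" "x = lsum v"
    using positive_eq_lsum positive_coneI l_ideal_carrier[OF I x(1)] x(2) by blast
  have "y \<in> I" if "y \<in> set v" for y
  proof (rule l_ideal_convex[OF I l_ideal_one[OF I] x(1)])
    have "y \<in> carrier (Gamma G u)" using that v by (auto simp: in_lists_conv_set)
    then show "y \<in> carrier G" "\<one> \<preceq> y" by simp_all
    show "y \<preceq> x" using le_lsum[of v y] that v by simp
  qed
  then show thesis using that[of v] v by (auto simp: in_lists_conv_set)
qed

lemma Gamma_eq_ideal_union:
  assumes I: "l_ideal G I" "u \<notin> I" and cone: "positive_cone G = lower_part G I \<union> upper_part G u I"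
  defines "J \<equiv> I \<inter> carrier (Gamma G u)"
  shows "carrier (Gamma G u) = J \<union> mvneg (Gamma G u) ` J"
proof -
  interpret N: mv_algebra "Gamma G u" by (rule Gamma_mv_algebra)
  have "x \<in> J \<union> mvneg (Gamma G u) ` J" if x: "x \<in> carrier (Gamma G u)" for x
  proof (cases "x \<in> I")
    case False
    have "x \<in> positive_cone G" using x by simp
    then have "x \<in> lower_part G I \<or> x \<in> upper_part G u I" unfolding cone by blast
    then have "x \<in> upper_part G u I" using False unfolding lower_part_def by blast
    then obtain n y where n: "1 \<le> n" "y \<in> I" "x = u [^] (n::nat) \<otimes> inv y"
      unfolding upper_part_def by blast
    have y: "y \<in> carrier G" using n l_ideal_carrier[OF I(1)] by simp
    \<comment> \<open>For n \<ge> 2, x = n u - y \<le> u forces u \<le> (n-1) u \<le> y, and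
      convexity would put u into I.\<close>
    have "n = 1"
    proof (rule ccontr)
      assume "n \<noteq> 1"
      then obtain m where m: "n = Suc m" "1 \<le> m" using n by (cases n) auto
      have "x \<preceq> u" using x by simp
      then have "u [^] n \<preceq> u \<otimes> y" using n y div_le_iff[of "u [^] n" y u] by simp
      then have "u [^] m \<otimes> u \<preceq> y \<otimes> u" using m y by (simp add: m_comm[of u y])
      then have "u [^] m \<preceq> y" using y by simp
      then have "u \<preceq> y" using lle_trans[OF unit_le_pow[OF m(2)]] y by simp
      then show False using l_ideal_convex[OF I(1) l_ideal_one[OF I(1)] n(2)] I(2) by simp
    qed
    then have eq: "x = u \<otimes> inv y" using n by simp
    then have "y = u \<otimes> inv x" using y by (simp add: inv_mult m_assoc[symmetric])
    then have "y \<in> J" using N.neg_closed[OF x] n(2) by (simp add: J_def)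
    then show ?thesis using eq by auto
  qed (use x in \<open>simp add: J_def\<close>)
  then show ?thesis using N.neg_closed unfolding J_def by blast
qed

lemma mv_ideal_Gamma:
  assumes I: "l_ideal G I"
  shows "mv_ideal (Gamma G u) (I \<inter> carrier (Gamma G u))"
proof -
  interpret N: mv_algebra "Gamma G u" by (rule Gamma_mv_algebra)
  have "\<one> \<in> I \<inter> carrier (Gamma G u)" using N.zero_closed l_ideal_one[OF I] by simp
  moreover have "y \<in> I" if "x \<in> I" "x \<in> carrier (Gamma G u)" "y \<in> carrier (Gamma G u)" "mv_le (Gamma G u) y x" for x y
    using that l_ideal_convex[OF I l_ideal_one[OF I], of x y] by (simp add: mv_le_Gamma)
  moreover have "x \<otimes> y \<and>\<^sub>L u \<in> I" if "x \<in> I" "x \<in> carrier (Gamma G u)" "y \<in> I" "y \<in> carrier (Gamma G u)" for x y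
  proof (rule l_ideal_convex[OF I l_ideal_one[OF I] l_ideal_mult[OF I that(1,3)]])
    have "x \<otimes> y \<and>\<^sub>L u \<in> carrier (Gamma G u)" using N.plus_closed[of x y] that by simp
    then show "x \<otimes> y \<and>\<^sub>L u \<in> carrier G" "\<one> \<preceq> x \<otimes> y \<and>\<^sub>L u" by (rule Gamma_carrierD)+
    show "x \<otimes> y \<and>\<^sub>L u \<preceq> x \<otimes> y" using that by simp
  qed
  ultimately show ?thesis using N.plus_closed unfolding mv_ideal_def by auto
qed

section \<open>The \<ell>-ideal generated by an ideal of the unit interval\<close>

definition ideal_hull :: "'a set \<Rightarrow> 'a set" where
  "ideal_hull J = {lsum v \<otimes> inv (lsum w) | v w. v \<in> lists J \<and> w \<in> lists J}"

context
  fixes J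
  assumes J: "mv_ideal (Gamma G u) J"
begin

lemma ideal_Gamma: "x \<in> J \<Longrightarrow> x \<in> carrier (Gamma G u)"
  using J by (auto simp: mv_ideal_def)

lemma ideal_lists [simp]: "v \<in> lists J \<Longrightarrow> v \<in> lists (carrier (Gamma G u))"
  by (auto simp: in_lists_conv_set ideal_Gamma)

lemma ideal_hullI: "v \<in> lists J \<Longrightarrow> w \<in> lists J \<Longrightarrow> lsum v \<otimes> inv (lsum w) \<in> ideal_hull J"
  by (auto simp: ideal_hull_def)

lemma lsum_ideal_hull: "v \<in> lists J \<Longrightarrow> lsum v \<in> ideal_hull J"
  using ideal_hullI[of v "[]"] by simp

lemma ideal_hull_carrier: "x \<in> ideal_hull J \<Longrightarrow> x \<in> carrier G"
  by (auto simp: ideal_hull_def)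

lemma ideal_le: "x \<in> J \<Longrightarrow> y \<in> carrier (Gamma G u) \<Longrightarrow> y \<preceq> x \<Longrightarrow> y \<in> J"
  using J ideal_Gamma[of x] mv_le_Gamma[of y x] by (auto simp: mv_ideal_def)

text \<open>Riesz decomposition produces letters below those of v, and J is down-closed.\<close>

lemma le_lsum_ideal:
  assumes "y \<in> positive_cone G" "v \<in> lists J" "y \<preceq> lsum v"
  obtains t where "t \<in> lists J" "y = lsum t"
proof -
  obtain t where t: "list_all2 (\<preceq>) t v" "t \<in> lists (positive_cone G)" "lsum t = y"
    using Riesz_decomposition[of y v] assms by auto
  have "t ! i \<in> J" if i: "i < length t" for i
  proof -
    have *: "t ! i \<preceq> v ! i" "v ! i \<in> J" "t ! i \<in> positive_cone G"
      using t i assms(2) by (auto simp: list_all2_conv_all_nth in_lists_conv_set)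
    then have "t ! i \<preceq> u" using lle_trans[OF *(1), of u] ideal_Gamma[OF *(2)] by simp
    then have "t ! i \<in> carrier (Gamma G u)" using * by (intro Gamma_carrierI) simp_all
    then show ?thesis using ideal_le * by blast
  qed
  then have "t \<in> lists J" by (auto simp: in_lists_conv_set in_set_conv_nth)
  then show thesis using that t(3) by auto
qed

text \<open>As long as the sum stays below u, it agrees with the truncated sum, under which J is
  closed.\<close>

lemma lsum_le_unit: "v \<in> lists J \<Longrightarrow> lsum v \<preceq> u \<Longrightarrow> lsum v \<in> J"
proof (induction v rule: list.induct)
  case Nil
  obtain x where "x \<in> J" using J by (auto simp: mv_ideal_def)
  moreover have "\<one> \<in> carrier (Gamma G u)" by (rule Gamma_carrierI) simp_all
  ultimately show ?case using ideal_le[of x \<one>] ideal_Gamma[of x] by simp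
next
  case (Cons x v)
  have x: "x \<in> J" "x \<in> carrier (Gamma G u)" "lsum v \<in> positive_cone G"
    using Cons.prems ideal_Gamma by simp_all
  have "lsum v \<preceq> x \<otimes> lsum v" using x mult_le_cancel_right[of \<one> x "lsum v"] by simp
  then have "lsum v \<preceq> u" using Cons.prems x lle_trans[of "lsum v" "x \<otimes> lsum v" u] by simp
  then have "x \<oplus>\<^bsub>Gamma G u\<^esub> lsum v \<in> J" using Cons x J by (simp add: mv_ideal_def)
  then show ?case using x Cons.prems by (simp add: meet_absorb)
qed

text \<open>A positive difference lies below its minuend, a sum of elements of J, so Riesz
  decomposition applies.\<close>

lemma ideal_hull_positive:
  assumes "x \<in> ideal_hull J" "\<one> \<preceq> x"
  obtains t where "t \<in> lists J" "x = lsum t"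
proof -
  obtain v w where vw: "v \<in> lists J" "w \<in> lists J" "x = lsum v \<otimes> inv (lsum w)"
    using assms(1) by (auto simp: ideal_hull_def)
  have "lsum v \<preceq> lsum v \<otimes> lsum w" using vw mult_le_cancel_left[of \<one> "lsum w" "lsum v"] by simp
  then have "x \<preceq> lsum v" using vw by (simp add: div_le_iff)
  then show thesis using le_lsum_ideal[of x v] that vw assms ideal_hull_carrier positive_coneI by metis
qed

lemma l_ideal_hull: "l_ideal G (ideal_hull J)"
proof (rule l_idealI)
  show "subgroup (ideal_hull J) G"
  proof (rule group.subgroupI)
    show "ideal_hull J \<noteq> {}" using lsum_ideal_hull[of "[]"] by auto
    fix x assume "x \<in> ideal_hull J"
    then obtain a b where x: "a \<in> lists J" "b \<in> lists J" "x = lsum a \<otimes> inv (lsum b)"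
      by (auto simp: ideal_hull_def)
    then have "inv x = lsum b \<otimes> inv (lsum a)" by (simp add: inv_mult m_comm)
    then show "inv x \<in> ideal_hull J" using x by (simp add: ideal_hullI)
    fix y assume "y \<in> ideal_hull J"
    then obtain c e where y: "c \<in> lists J" "e \<in> lists J" "y = lsum c \<otimes> inv (lsum e)"
      by (auto simp: ideal_hull_def)
    have "x \<otimes> y = lsum (a @ c) \<otimes> inv (lsum (b @ e))" using x y by (simp add: inv_mult m_ac)
    then show "x \<otimes> y \<in> ideal_hull J" using x y by (simp only: ideal_hullI append_in_lists_conv)
  qed (use ideal_hull_carrier in \<open>auto intro: is_group\<close>)
  show convex: "y \<in> ideal_hull J" if asm: "x \<in> ideal_hull J" "t \<in> ideal_hull J" "y \<in> carrier G" "x \<preceq> y" "y \<preceq> t" for x y t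
  proof -
    obtain a b where x: "a \<in> lists J" "b \<in> lists J" "x = lsum a \<otimes> inv (lsum b)"
      using asm(1) by (auto simp: ideal_hull_def)
    obtain c e where t: "c \<in> lists J" "e \<in> lists J" "t = lsum c \<otimes> inv (lsum e)"
      using asm(2) by (auto simp: ideal_hull_def)
    \<comment> \<open>Adding the subtrahend of x to y gives a positive element below the sum of
      \<open>c @ b\<close>, which is again a sum of elements of J.\<close>
    have "lsum a \<preceq> y \<otimes> lsum b" using x asm(3,4) by (simp add: div_le_iff)
    then have pos: "y \<otimes> lsum b \<in> positive_cone G"
      using x asm(3) lle_trans[of \<one> "lsum a" "y \<otimes> lsum b"] by (intro positive_coneI) simp_all
    have "lsum c \<preceq> lsum c \<otimes> lsum e" using t mult_le_cancel_left[of \<one> "lsum e" "lsum c"] by simp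
    then have "t \<preceq> lsum c" using t by (simp add: div_le_iff)
    then have "y \<preceq> lsum c" using asm(3,5) t lle_trans[of y t "lsum c"] by simp
    then have "y \<otimes> lsum b \<preceq> lsum (c @ b)" using t x asm(3) by simp
    then obtain s where s: "s \<in> lists J" "y \<otimes> lsum b = lsum s"
      using le_lsum_ideal[OF pos, of "c @ b"] t x by auto
    then have "y = lsum s \<otimes> inv (lsum b)" using asm(3) x s by (simp add: inv_solve_right)
    then show ?thesis using s x by (simp add: ideal_hullI)
  qed
  fix x assume "x \<in> ideal_hull J"
  then obtain a b where x: "a \<in> lists J" "b \<in> lists J" "x = lsum a \<otimes> inv (lsum b)"
    by (auto simp: ideal_hull_def)
  have "lsum a \<preceq> lsum a \<otimes> lsum b" using x mult_le_cancel_left[of \<one> "lsum b" "lsum a"] by simp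
  then have "pdiff x \<one> \<preceq> lsum a" using x by (simp add: pdiff_le_iff div_le_iff)
  then show "pdiff x \<one> \<in> ideal_hull J"
    using x lsum_ideal_hull[of "[]"] lsum_ideal_hull[OF x(1)] convex[of \<one> "lsum a" "pdiff x \<one>"] by simp
qed

text \<open>Positive elements of the hull are sums from J, and such sums below u stay in J. Hence
  passing to the hull and back to the unit interval recovers J.\<close>

lemma ideal_hull_Gamma: "ideal_hull J \<inter> carrier (Gamma G u) = J"
proof
  show "ideal_hull J \<inter> carrier (Gamma G u) \<subseteq> J"
  proof
    fix x assume x: "x \<in> ideal_hull J \<inter> carrier (Gamma G u)"
    then obtain t where "t \<in> lists J" "x = lsum t" using ideal_hull_positive[of x] by auto
    then show "x \<in> J" using lsum_le_unit[of t] x by simp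
  qed
  show "J \<subseteq> ideal_hull J \<inter> carrier (Gamma G u)"
    using lsum_ideal_hull[of "[x]" for x] ideal_Gamma by fastforce
qed

context
  assumes proper: "u \<notin> J" and union: "carrier (Gamma G u) = J \<union> mvneg (Gamma G u) ` J"
begin

lemma unit_notin_hull: "u \<notin> ideal_hull J"
  using ideal_hull_Gamma proper Gamma_carrierI[of u] by auto

lemma positive_cone_hull: "positive_cone G = lower_part G (ideal_hull J) \<union> upper_part G u (ideal_hull J)"
proof -
  note I = l_ideal_hull
  have sum: "\<exists>n::nat. \<exists>y \<in> ideal_hull J. lsum v = u [^] n \<otimes> inv y" if "v \<in> lists (carrier (Gamma G u))" for v
    using that
  proof (induction v rule: list.induct)
    case Nil
    then show ?case using l_ideal_one[OF I] by (intro exI[of _ 0] bexI[of _ \<one>]) simp_all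
  next
    case (Cons x v)
    then obtain n :: nat and y where y: "y \<in> ideal_hull J" "lsum v = u [^] n \<otimes> inv y" by auto
    have yG: "y \<in> carrier G" using y ideal_hull_carrier by blast
    have JI: "a \<in> ideal_hull J" if "a \<in> J" for a using that ideal_hull_Gamma by blast
    \<comment> \<open>Adding a letter of J decreases y; adding a letter u - a raises n by one and
      increases y by a. Thus y may become negative.\<close>
    consider "x \<in> J" | a where "a \<in> J" "x = u \<otimes> inv a" using Cons.prems union by auto
    then show ?case
    proof cases
      case 1
      then have "x \<in> carrier G" using ideal_Gamma by simp
      then have "lsum (x # v) = u [^] n \<otimes> inv (y \<otimes> inv x)" using y yG by (simp add: inv_mult m_ac)
      moreover have "y \<otimes> inv x \<in> ideal_hull J"
        using y JI[OF 1] l_ideal_mult[OF I] l_ideal_inv[OF I] by blast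
      ultimately show ?thesis by blast
    next
      case 2
      then have "a \<in> carrier G" using ideal_Gamma by simp
      then have "lsum (x # v) = u [^] Suc n \<otimes> inv (y \<otimes> a)" using 2 y yG by (simp add: inv_mult m_ac)
      moreover have "y \<otimes> a \<in> ideal_hull J" using y JI[OF 2(1)] l_ideal_mult[OF I] by blast
      ultimately show ?thesis by blast
    qed
  qed
  have "x \<in> lower_part G (ideal_hull J) \<union> upper_part G u (ideal_hull J)" if x: "x \<in> positive_cone G" for x
  proof -
    obtain n :: nat and y where y: "y \<in> ideal_hull J" "x = u [^] n \<otimes> inv y"
      using positive_eq_lsum[OF x] sum by metis
    have yG: "y \<in> carrier G" using y ideal_hull_carrier by blast
    have le: "y \<preceq> u [^] n" using x y(2) yG positive_coneD(2)[OF x] by (simp add: le_div_iff)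
    \<comment> \<open>The upper part asks for n \<ge> 1 and y strictly below n u. In the two
      degenerate cases x is -y or 0 and belongs to the lower part.\<close>
    consider "n = 0" | "y = u [^] n" | "1 \<le> n" "y \<noteq> u [^] n" by linarith
    then show ?thesis
    proof cases
      case 1
      then have "x \<in> ideal_hull J" using y yG l_ideal_inv[OF I y(1)] by simp
      then show ?thesis using x by (simp add: lower_part_def)
    next
      case 2
      then have "x = \<one>" using y by simp
      then show ?thesis using l_ideal_one[OF I] by (simp add: lower_part_def)
    next
      case 3
      then show ?thesis using y le by (auto simp: upper_part_def)
    qed
  qed
  moreover have "x \<in> positive_cone G" if "x \<in> upper_part G u (ideal_hull J)" for x
    using that ideal_hull_carrier by (auto simp: upper_part_def le_div_iff intro!: positive_coneI)
  ultimately show ?thesis using ideal_hull_carrier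
    by (auto simp: lower_part_def intro!: positive_coneI)
qed

text \<open>A larger \<ell>-ideal contains a positive element outside the hull. The cone condition
  writes it as n u - y with y in the hull, so n u, and by convexity u, is in the larger
  ideal.\<close>

lemma maximal_l_ideal_hull: "maximal_l_ideal G u (ideal_hull J)"
proof -
  note I = l_ideal_hull
  have "\<not> ideal_hull J \<subset> K" if K: "l_ideal G K" "K \<noteq> carrier G" for K
  proof
    assume less: "ideal_hull J \<subset> K"
    then obtain x where x: "x \<in> K" "x \<notin> ideal_hull J" by blast
    have xG: "x \<in> carrier G" using x l_ideal_carrier[OF K(1)] by blast
    \<comment> \<open>If x is outside the hull, so is its positive or its negative part.\<close>
    have "\<not> (pdiff x \<one> \<in> ideal_hull J \<and> pdiff \<one> x \<in> ideal_hull J)"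
      using eq_pos_div[OF xG] x(2) l_ideal_mult[OF I] l_ideal_inv[OF I] by metis
    then obtain p where p: "p \<in> K" "p \<notin> ideal_hull J" "p \<in> positive_cone G"
      using l_ideal_pdiff[OF K(1)] l_ideal_one[OF K(1)] x(1) xG positive_pdiff one_closed by metis
    then have "p \<in> upper_part G u (ideal_hull J)"
      unfolding positive_cone_hull lower_part_def by blast
    then obtain n y where n: "1 \<le> n" "y \<in> ideal_hull J" "p = u [^] (n::nat) \<otimes> inv y"
      unfolding upper_part_def by blast
    have "y \<in> carrier G" using n ideal_hull_carrier by blast
    then have "p \<otimes> y = u [^] n" using n by (simp add: m_assoc)
    then have "u [^] n \<in> K" using l_ideal_mult[OF K(1) p(1)] n(2) less by (metis psubsetD)
    then have "u \<in> K" using l_ideal_convex[OF K(1) l_ideal_one[OF K(1)], of "u [^] n" u] unit_le_pow[OF n(1)] by simp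
    then show False using l_ideal_eq_carrier K by blast
  qed
  then show ?thesis using I unit_notin_hull by (auto simp: maximal_l_ideal_def)
qed

end

end

end

section \<open>The functor\<close>

lemma PUALG_simps:
  "(G, u, I) \<in> Obj PUALG \<longleftrightarrow> unital_lgroup G u \<and> maximal_l_ideal G u I \<and>
    positive_cone G = lower_part G I \<union> upper_part G u I \<and>
    enough_idempotents (Gamma G u) (I \<inter> carrier (Gamma G u))"
  "f \<in> Hom PUALG (G, u, I) (H, v, J) \<longleftrightarrow>
    f \<in> lgroup_hom G H \<and> f \<in> extensional (carrier G) \<and> f u = v \<and> f ` I \<subseteq> J"
  "Id PUALG (G, u, I) = (\<lambda>x \<in> carrier G. x)"
  "Comp PUALG (G, u, I) Y Z g f = compose (carrier G) g f"
  by (simp_all add: PUALG_def)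

lemma PMV_simps:
  "(N, I) \<in> Obj PMV \<longleftrightarrow> mv_algebra N \<and> maximal_mv_ideal N I \<and> enough_idempotents N I \<and>
    carrier N = I \<union> mvneg N ` I"
  "f \<in> Hom PMV (M, I) (N, J) \<longleftrightarrow> f \<in> mv_hom M N \<and> f \<in> extensional (carrier M) \<and> f ` I \<subseteq> J"
  "Id PMV (N, I) = (\<lambda>x \<in> carrier N. x)"
  "Comp PMV (N, I) Y Z g f = compose (carrier N) g f"
  by (simp_all add: PMV_def)

lemma Gamma_I_simps:
  "fobj Gamma_I (G, u, I) = (Gamma G u, I \<inter> carrier (Gamma G u))"
  "fmor Gamma_I (G, u, I) Y f = (\<lambda>x \<in> carrier (Gamma G u). f x)"
  by (simp_all add: Gamma_I_def)

lemma lgroup_hom_Pi: "f \<in> lgroup_hom G H \<Longrightarrow> f \<in> carrier G \<rightarrow> carrier H"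
  by (auto simp: lgroup_hom_def hom_def)

lemma PUALG_is_category: "is_category (PUALG :: ('u pualg_obj, 'u \<Rightarrow> 'u) category)"
proof -
  have "Id PUALG X \<in> Hom PUALG X X" if "X \<in> Obj PUALG" for X :: "'u pualg_obj"
  proof (cases X)
    case (fields G u I)
    then interpret unital_lgroup G u using that by (simp add: PUALG_simps)
    have I: "l_ideal G I" using that fields by (simp add: PUALG_simps maximal_l_ideal_def)
    have "(\<lambda>x \<in> carrier G. x) \<in> lgroup_hom G G"
      by (simp add: lgroup_hom_def hom_def)
    then show ?thesis using fields l_ideal_carrier[OF I] by (auto simp: PUALG_simps)
  qed
  moreover have "Comp PUALG X Y Z g f \<in> Hom PUALG X Z"
    if "X \<in> Obj PUALG" "Y \<in> Obj PUALG" "f \<in> Hom PUALG X Y" "g \<in> Hom PUALG Y Z"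
    for X Y Z :: "'u pualg_obj" and f g
  proof -
    obtain G u I where X: "X = (G, u, I)" by (metis surj_pair)
    obtain H v J where Y: "Y = (H, v, J)" by (metis surj_pair)
    obtain K w L where Z: "Z = (K, w, L)" by (metis surj_pair)
    interpret A: unital_lgroup G u using that X by (simp add: PUALG_simps)
    have I: "l_ideal G I" using that X by (simp add: PUALG_simps maximal_l_ideal_def)
    have f: "f \<in> lgroup_hom G H" "f u = v" "f ` I \<subseteq> J" and g: "g \<in> lgroup_hom H K" "g v = w" "g ` J \<subseteq> L"
      using that X Y Z by (simp_all add: PUALG_simps)
    have fc: "f x \<in> carrier H" if "x \<in> carrier G" for x using lgroup_hom_Pi[OF f(1)] that by auto
    have gc: "g x \<in> carrier K" if "x \<in> carrier H" for x using lgroup_hom_Pi[OF g(1)] that by auto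
    have "compose (carrier G) g f \<in> lgroup_hom G K"
      using f(1) g(1) fc gc by (auto simp: lgroup_hom_def hom_def compose_def)
    then show ?thesis unfolding X Y Z using f g A.l_ideal_carrier[OF I]
      by (auto simp: PUALG_simps compose_def)
  qed
  moreover have "Comp PUALG X X Y f (Id PUALG X) = f \<and> Comp PUALG X Y Y (Id PUALG Y) f = f"
    if "f \<in> Hom PUALG X Y" for X Y :: "'u pualg_obj" and f
    using that lgroup_hom_Pi
    by (cases X; cases Y) (auto simp: PUALG_simps intro!: compose_Id Id_compose)
  moreover have "Comp PUALG W Y Z h (Comp PUALG W X Y g f) = Comp PUALG W X Z (Comp PUALG X Y Z h g) f"
    if "f \<in> Hom PUALG W X" for W X Y Z :: "'u pualg_obj" and f g h
    using that lgroup_hom_Pi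
    by (cases W; cases X) (auto simp: PUALG_simps intro!: compose_assoc)
  ultimately show ?thesis unfolding is_category_def by blast
qed

lemma mv_hom_Pi: "f \<in> mv_hom M N \<Longrightarrow> f \<in> carrier M \<rightarrow> carrier N"
  by (simp add: mv_hom_def)

lemma PMV_is_category: "is_category (PMV :: ('u pmv_obj, 'u \<Rightarrow> 'u) category)"
proof -
  have IC: "I \<subseteq> carrier N" if "(N, I) \<in> Obj PMV" for N :: "'u mv" and I
    using that by (simp add: PMV_simps maximal_mv_ideal_def mv_ideal_def)
  have "Id PMV X \<in> Hom PMV X X" if "X \<in> Obj PMV" for X :: "'u pmv_obj"
  proof (cases X)
    case (Pair N I)
    then interpret mv_algebra N using that by (simp add: PMV_simps)
    have "(\<lambda>x \<in> carrier N. x) \<in> mv_hom N N" by (simp add: mv_hom_def)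
    then show ?thesis using IC[of N I] that unfolding Pair PMV_simps by auto
  qed
  moreover have "Comp PMV X Y Z g f \<in> Hom PMV X Z"
    if "X \<in> Obj PMV" "f \<in> Hom PMV X Y" "g \<in> Hom PMV Y Z" for X Y Z :: "'u pmv_obj" and f g
  proof -
    obtain M I N J L K where X: "X = (M, I)" and Y: "Y = (N, J)" and Z: "Z = (L, K)" by (metis surj_pair)
    interpret mv_algebra M using that X by (simp add: PMV_simps)
    have f: "f \<in> mv_hom M N" "f ` I \<subseteq> J" and g: "g \<in> mv_hom N L" "g ` J \<subseteq> K"
      using that X Y Z by (simp_all add: PMV_simps)
    have "f x \<in> carrier N" if "x \<in> carrier M" for x using mv_hom_Pi[OF f(1)] that by auto
    then have "compose (carrier M) g f \<in> mv_hom M L"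
      using f(1) g(1) by (auto simp: mv_hom_def compose_def)
    then show ?thesis unfolding X Y Z using f g IC that(1) X
      by (auto simp: PMV_simps compose_def)
  qed
  moreover have "Comp PMV X X Y f (Id PMV X) = f \<and> Comp PMV X Y Y (Id PMV Y) f = f"
    if "f \<in> Hom PMV X Y" for X Y :: "'u pmv_obj" and f
    using that mv_hom_Pi
    by (cases X; cases Y) (auto simp: PMV_simps intro!: compose_Id Id_compose)
  moreover have "Comp PMV W Y Z h (Comp PMV W X Y g f) = Comp PMV W X Z (Comp PMV X Y Z h g) f"
    if "f \<in> Hom PMV W X" for W X Y Z :: "'u pmv_obj" and f g h
    using that mv_hom_Pi
    by (cases W; cases X) (auto simp: PMV_simps intro!: compose_assoc)
  ultimately show ?thesis unfolding is_category_def by blast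
qed

lemma Gamma_I_Obj: "X \<in> Obj PUALG \<Longrightarrow> fobj Gamma_I X \<in> Obj PMV"
proof -
  assume X: "X \<in> Obj PUALG"
  obtain G u I where eq: "X = (G, u, I)" by (metis surj_pair)
  interpret unital_lgroup G u using X eq by (simp add: PUALG_simps)
  have I: "l_ideal G I" "u \<notin> I" and cone: "positive_cone G = lower_part G I \<union> upper_part G u I"
    and idem: "enough_idempotents (Gamma G u) (I \<inter> carrier (Gamma G u))"
    using X unfolding eq PUALG_simps maximal_l_ideal_def by simp_all
  have "maximal_mv_ideal (Gamma G u) (I \<inter> carrier (Gamma G u))"
    by (rule maximal_mv_idealI[OF Gamma_mv_algebra mv_ideal_Gamma[OF I(1)]])
      (use I(2) Gamma_eq_ideal_union[OF I cone] in simp_all)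
  then show ?thesis unfolding eq Gamma_I_simps PMV_simps
    using Gamma_mv_algebra idem Gamma_eq_ideal_union[OF I cone] by blast
qed

lemma Gamma_I_Hom:
  assumes "X \<in> Obj PUALG" "Y \<in> Obj PUALG" "f \<in> Hom PUALG X Y"
  shows "fmor Gamma_I X Y f \<in> Hom PMV (fobj Gamma_I X) (fobj Gamma_I Y)"
proof -
  obtain G u I where X: "X = (G, u, I)" by (metis surj_pair)
  obtain H v J where Y: "Y = (H, v, J)" by (metis surj_pair)
  interpret unital_lgroup_pair G u H v
    using assms X Y by (simp add: PUALG_simps unital_lgroup_pair_def)
  have f: "f \<in> lgroup_hom G H" "f u = v" "f ` I \<subseteq> J" using assms X Y by (simp_all add: PUALG_simps)
  have "f x \<in> carrier (Gamma H v)" if "x \<in> carrier (Gamma G u)" for x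
    using funcset_mem[OF mv_hom_Pi[OF restrict_mv_hom[OF f(1,2)]] that] that by simp
  then show ?thesis unfolding X Y Gamma_I_simps PMV_simps
    using restrict_mv_hom[OF f(1,2)] f(3) by auto
qed

lemma Gamma_I_is_functor: "is_functor PUALG PMV Gamma_I"
  unfolding is_functor_def
proof (intro conjI ballI)
  fix X :: "'a pualg_obj" assume "X \<in> Obj PUALG"
  obtain G u I where X: "X = (G, u, I)" by (metis surj_pair)
  have "carrier (Gamma G u) \<subseteq> carrier G" by (auto simp: Gamma_def)
  then show "fmor Gamma_I X X (Id PUALG X) = Id PMV (fobj Gamma_I X)"
    unfolding X Gamma_I_simps PUALG_simps PMV_simps by (auto simp: fun_eq_iff restrict_def)
next
  fix X Y Z :: "'a pualg_obj" and f g
  assume "X \<in> Obj PUALG" "Y \<in> Obj PUALG" "f \<in> Hom PUALG X Y"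
  then have hom: "fmor Gamma_I X Y f \<in> Hom PMV (fobj Gamma_I X) (fobj Gamma_I Y)" by (rule Gamma_I_Hom)
  obtain G u I where X: "X = (G, u, I)" by (metis surj_pair)
  obtain H v J where Y: "Y = (H, v, J)" by (metis surj_pair)
  have "restrict f (carrier (Gamma G u)) \<in> mv_hom (Gamma G u) (Gamma H v)"
    using hom unfolding X Y Gamma_I_simps PMV_simps by blast
  then have "f x \<in> carrier (Gamma H v)" if "x \<in> carrier (Gamma G u)" for x
    using funcset_mem[OF mv_hom_Pi that] that by fastforce
  moreover have "carrier (Gamma G u) \<subseteq> carrier G" by (auto simp: Gamma_def)
  ultimately show "fmor Gamma_I X Z (Comp PUALG X Y Z g f) =
      Comp PMV (fobj Gamma_I X) (fobj Gamma_I Y) (fobj Gamma_I Z) (fmor Gamma_I Y Z g) (fmor Gamma_I X Y f)"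
    unfolding X Y Gamma_I_simps PUALG_simps PMV_simps by (auto simp: fun_eq_iff restrict_def compose_def)
qed (simp_all add: PUALG_is_category PMV_is_category Gamma_I_Obj Gamma_I_Hom)

lemma Gamma_I_faithful:
  assumes XY: "X \<in> Obj PUALG" "Y \<in> Obj PUALG" and fg: "f \<in> Hom PUALG X Y" "g \<in> Hom PUALG X Y"
    and eq: "fmor Gamma_I X Y f = fmor Gamma_I X Y g"
  shows "f = g"
proof -
  obtain G u I where X: "X = (G, u, I)" by (metis surj_pair)
  obtain H v J where Y: "Y = (H, v, J)" by (metis surj_pair)
  interpret unital_lgroup_pair G u H v
    using XY X Y by (simp add: PUALG_simps unital_lgroup_pair_def)
  have f: "f \<in> lgroup_hom G H" "f \<in> extensional (carrier G)"
    and g: "g \<in> lgroup_hom G H" "g \<in> extensional (carrier G)"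
    using fg X Y by (simp_all add: PUALG_simps)
  have "f x = g x" if "x \<in> carrier (Gamma G u)" for x
    using eq that unfolding X Gamma_I_simps by (metis restrict_apply')
  then have "f x = g x" if "x \<in> carrier G" for x
    using that by (rule lgroup_hom_eqI[OF f(1) g(1)])
  then show ?thesis by (rule extensionalityI[OF f(2) g(2)])
qed

lemma Gamma_I_full:
  assumes XY: "X \<in> Obj PUALG" "Y \<in> Obj PUALG" and h: "h \<in> Hom PMV (fobj Gamma_I X) (fobj Gamma_I Y)"
  shows "\<exists>f \<in> Hom PUALG X Y. fmor Gamma_I X Y f = h"
proof -
  obtain G u I where X: "X = (G, u, I)" by (metis surj_pair)
  obtain H v J where Y: "Y = (H, v, J)" by (metis surj_pair)
  interpret unital_lgroup_pair G u H v
    using XY X Y by (simp add: PUALG_simps unital_lgroup_pair_def)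
  have I: "l_ideal G I" and J: "l_ideal H J" using XY X Y by (simp_all add: PUALG_simps maximal_l_ideal_def)
  have h: "h \<in> mv_hom (Gamma G u) (Gamma H v)" "h \<in> extensional (carrier (Gamma G u))"
    "h ` (I \<inter> carrier (Gamma G u)) \<subseteq> J"
    using h unfolding X Y Gamma_I_simps PMV_simps by auto
  obtain f where f: "f \<in> lgroup_hom G H" "f u = v" "f \<in> extensional (carrier G)"
    "\<forall>x \<in> carrier (Gamma G u). f x = h x" using mv_hom_extends[OF h(1)] .
  \<comment> \<open>Positive elements of I are sums of elements of I in the unit interval, where f
    agrees with h. General elements are then split into positive and negative parts.\<close>
  have pos: "f p \<in> J" if p: "p \<in> I" "\<one>\<^bsub>G\<^esub> \<preceq>\<^bsub>G\<^esub> p" for p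
  proof -
    obtain w where w: "w \<in> lists (I \<inter> carrier (Gamma G u))" "p = A.lsum w"
      using A.l_ideal_positive_eq_lsum[OF I p] .
    have "B.lsum (map f w) \<in> J" using w(1)
    proof (induction w rule: list.induct)
      case (Cons x w)
      then have "f x \<in> J" using f(4) h(3) by auto
      then show ?case using Cons B.l_ideal_mult[OF J] by simp
    qed (simp add: B.l_ideal_one[OF J])
    moreover have "w \<in> lists (carrier G)" using w(1) by (auto simp: in_lists_conv_set)
    ultimately show ?thesis using w(2) lgroup_hom_lsum[OF f(1)] by simp
  qed
  have "f x \<in> J" if x: "x \<in> I" for x
  proof -
    let ?p = "A.pdiff x \<one>\<^bsub>G\<^esub>" and ?q = "A.pdiff \<one>\<^bsub>G\<^esub> x"
    have xG: "x \<in> carrier G" using A.l_ideal_carrier[OF I x] .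
    have "f x = f (?p \<otimes>\<^bsub>G\<^esub> inv\<^bsub>G\<^esub> ?q)" using A.eq_pos_div[OF xG] by simp
    also have "\<dots> = f ?p \<otimes>\<^bsub>H\<^esub> inv\<^bsub>H\<^esub> (f ?q)"
      using xG by (simp add: lgroup_hom_mult[OF f(1)] lgroup_hom_inv[OF f(1)])
    also have "\<dots> \<in> J"
      using x xG A.l_ideal_one[OF I]
      by (intro B.l_ideal_mult[OF J] B.l_ideal_inv[OF J] pos A.l_ideal_pdiff[OF I]) simp_all
    finally show ?thesis .
  qed
  then have "f \<in> Hom PUALG X Y" using f unfolding X Y PUALG_simps by auto
  moreover have "fmor Gamma_I X Y f = h"
    unfolding X Gamma_I_simps using f(4) h(2) by (auto simp: fun_eq_iff restrict_def extensional_def)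
  ultimately show ?thesis by blast
qed

lemma Gamma_I_surj:
  assumes "infinite (UNIV :: 'u set)" and Z: "Z \<in> Obj (PMV :: ('u pmv_obj, 'u \<Rightarrow> 'u) category)"
  shows "\<exists>X \<in> Obj PUALG. \<exists>e. isomorphism PMV (fobj Gamma_I X) Z e"
proof -
  obtain N J where ZNJ: "Z = (N, J)" by fastforce
  have N: "mv_algebra N" and max: "maximal_mv_ideal N J" and idem: "enough_idempotents N J"
    and union: "carrier N = J \<union> mvneg N ` J" using Z ZNJ by (simp_all add: PMV_simps)
  interpret N: mv_algebra N by (rule N)
  have J: "mv_ideal N J" "\<bbbone>\<^bsub>N\<^esub> \<notin> J" using max unit_notin_proper_ideal[OF N] by (auto simp: maximal_mv_ideal_def)
  have JN: "x \<in> carrier N" if "x \<in> J" for x using J(1) that by (auto simp: mv_ideal_def)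
  obtain G :: "'u lgroup" and u h where G: "unital_lgroup G u" and h: "h \<in> mv_hom N (Gamma G u)"
    and bij: "bij_betw h (carrier N) (carrier (Gamma G u))" using Mundici[OF N assms(1)] .
  interpret unital_lgroup G u by (rule G)
  interpret M: mv_algebra "Gamma G u" by (rule Gamma_mv_algebra)
  let ?\<Gamma> = "Gamma G u"
  have hc: "h x \<in> carrier ?\<Gamma>" if "x \<in> carrier N" for x using mv_hom_Pi[OF h] that by auto
  have inj: "h x = h y \<longleftrightarrow> x = y" if "x \<in> carrier N" "y \<in> carrier N" for x y
    using bij that by (auto simp: bij_betw_def inj_on_def)
  have hp: "h (x \<oplus>\<^bsub>N\<^esub> y) = h x \<oplus>\<^bsub>?\<Gamma>\<^esub> h y" if "x \<in> carrier N" "y \<in> carrier N" for x y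
    using h that unfolding mv_hom_def by blast
  have hn: "h (\<sim>\<^bsub>N\<^esub> x) = \<sim>\<^bsub>?\<Gamma>\<^esub> (h x)" if "x \<in> carrier N" for x
    using h that unfolding mv_hom_def by blast
  have h01: "h \<zero>\<^bsub>N\<^esub> = \<zero>\<^bsub>?\<Gamma>\<^esub>" "h \<bbbone>\<^bsub>N\<^esub> = \<bbbone>\<^bsub>?\<Gamma>\<^esub>"
    using h unfolding mv_hom_def by blast+
  have le: "mv_le ?\<Gamma> (h x) (h y) \<longleftrightarrow> mv_le N x y" if "x \<in> carrier N" "y \<in> carrier N" for x y
    unfolding mv_le_def using that inj[of "\<sim>\<^bsub>N\<^esub> x \<oplus>\<^bsub>N\<^esub> y" "\<bbbone>\<^bsub>N\<^esub>"] hp[of "\<sim>\<^bsub>N\<^esub> x" y] hn[of x] h01(2) by auto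
  have surj: "\<exists>x\<in>carrier N. y = h x" if "y \<in> carrier ?\<Gamma>" for y
    using bij that by (auto simp: bij_betw_def)
  have hJ: "mv_ideal ?\<Gamma> (h ` J)"
    unfolding mv_ideal_def
  proof (intro conjI ballI impI)
    show "h ` J \<subseteq> carrier ?\<Gamma>" using hc JN by blast
    show "h ` J \<noteq> {}" using J(1) by (auto simp: mv_ideal_def)
    fix x assume x: "x \<in> h ` J"
    fix y assume y: "y \<in> carrier ?\<Gamma>" "mv_le ?\<Gamma> y x"
    obtain a b where "x = h a" "a \<in> J" "y = h b" "b \<in> carrier N" using x surj[OF y(1)] by blast
    then show "y \<in> h ` J" using y(2) J(1) le[of b a] JN[of a] by (auto simp: mv_ideal_def)
  next
    fix x y assume "x \<in> h ` J" "y \<in> h ` J"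
    then obtain a b where ab: "x = h a" "a \<in> J" "y = h b" "b \<in> J" by blast
    then have "a \<oplus>\<^bsub>N\<^esub> b \<in> J" using J(1) by (auto simp: mv_ideal_def)
    then show "x \<oplus>\<^bsub>?\<Gamma>\<^esub> y \<in> h ` J" using hp[of a b] ab JN[OF ab(2)] JN[OF ab(4)] by (metis imageI)
  qed
  \<comment> \<open>Properness and the splitting of the carrier are transported along h;
    \<open>maximal_l_ideal_hull\<close> recovers maximality from them.\<close>
  have u: "u \<notin> h ` J"
  proof
    assume "u \<in> h ` J"
    then obtain x where "x \<in> J" "h x = h \<bbbone>\<^bsub>N\<^esub>" using h01(2) by auto
    then show False using inj[OF JN N.unit_closed] J(2) by metis
  qed
  have union': "carrier ?\<Gamma> = h ` J \<union> mvneg ?\<Gamma> ` h ` J"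
  proof -
    have "carrier ?\<Gamma> = h ` carrier N" using bij by (simp add: bij_betw_def)
    also have "\<dots> = h ` J \<union> (\<lambda>x. h (\<sim>\<^bsub>N\<^esub> x)) ` J" unfolding union by (simp add: image_Un image_image)
    also have "(\<lambda>x. h (\<sim>\<^bsub>N\<^esub> x)) ` J = mvneg ?\<Gamma> ` h ` J"
      unfolding image_image by (intro image_cong) (use hn JN in auto)
    finally show ?thesis .
  qed
  have idem': "enough_idempotents ?\<Gamma> (h ` J)"
    unfolding enough_idempotents_def
  proof
    fix x assume "x \<in> h ` J"
    then obtain b where b: "b \<in> J" "x = h b" by blast
    then obtain a where a: "a \<in> J" "a \<oplus>\<^bsub>N\<^esub> a = a" "mv_le N b a"
      using idem unfolding enough_idempotents_def by blast
    then have "h a \<oplus>\<^bsub>?\<Gamma>\<^esub> h a = h a" "mv_le ?\<Gamma> x (h a)"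
      using hp[of a a] le[of b a] b JN by (metis, metis)
    then show "\<exists>a\<in>h ` J. a \<oplus>\<^bsub>?\<Gamma>\<^esub> a = a \<and> mv_le ?\<Gamma> x a" using a(1) by blast
  qed
  \<comment> \<open>The isomorphism has to start at the value of the functor, so it is the inverse
    of h. The hull of the transported ideal restricts to exactly that ideal, so ideals match as
    well.\<close>
  let ?I = "ideal_hull (h ` J)" and ?g = "inv_into (carrier N) h"
  have X: "(G, u, ?I) \<in> Obj PUALG"
    unfolding PUALG_simps ideal_hull_Gamma[OF hJ]
    using G maximal_l_ideal_hull[OF hJ u union'] positive_cone_hull[OF hJ u union'] idem' by blast
  have gh: "?g (h x) = x" if "x \<in> carrier N" for x
    using bij that by (auto simp: bij_betw_def)
  have hg: "h (?g y) = y" "?g y \<in> carrier N" if "y \<in> carrier ?\<Gamma>" for y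
    using surj[OF that] gh by auto
  have g_hom: "restrict ?g (carrier ?\<Gamma>) \<in> Hom PMV (?\<Gamma>, h ` J) (N, J)"
  proof -
    have eq: "?g y = x" if "x \<in> carrier N" "y = h x" for x y using that gh by simp
    have "?g (x \<oplus>\<^bsub>?\<Gamma>\<^esub> y) = ?g x \<oplus>\<^bsub>N\<^esub> ?g y" if "x \<in> carrier ?\<Gamma>" "y \<in> carrier ?\<Gamma>" for x y
      by (rule eq) (use hp[of "?g x" "?g y"] hg[OF that(1)] hg[OF that(2)] in \<open>simp_all del: Gamma_simps\<close>)
    moreover have "?g (\<sim>\<^bsub>?\<Gamma>\<^esub> x) = \<sim>\<^bsub>N\<^esub> (?g x)" if "x \<in> carrier ?\<Gamma>" for x
      by (rule eq) (use hn[of "?g x"] hg[OF that] in \<open>simp_all del: Gamma_simps\<close>)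
    moreover have "?g \<zero>\<^bsub>?\<Gamma>\<^esub> = \<zero>\<^bsub>N\<^esub>" "?g \<bbbone>\<^bsub>?\<Gamma>\<^esub> = \<bbbone>\<^bsub>N\<^esub>"
      by (rule eq; use h01 in simp)+
    ultimately have "restrict ?g (carrier ?\<Gamma>) \<in> mv_hom ?\<Gamma> N"
      using hg(2) M.plus_closed M.neg_closed M.zero_closed M.unit_closed
      unfolding mv_hom_def by (auto simp del: Gamma_simps)
    moreover have "restrict ?g (carrier ?\<Gamma>) ` h ` J \<subseteq> J" using gh hc JN by auto
    ultimately show ?thesis by (simp add: PMV_simps)
  qed
  have h_hom: "restrict h (carrier N) \<in> Hom PMV (N, J) (?\<Gamma>, h ` J)"
    using h JN by (auto simp: PMV_simps mv_hom_def)
  have "isomorphism PMV (?\<Gamma>, h ` J) (N, J) (restrict ?g (carrier ?\<Gamma>))"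
    unfolding isomorphism_def
  proof (intro conjI bexI[OF _ h_hom] g_hom)
    show "Comp PMV (?\<Gamma>, h ` J) (N, J) (?\<Gamma>, h ` J) (restrict h (carrier N)) (restrict ?g (carrier ?\<Gamma>)) = Id PMV (?\<Gamma>, h ` J)"
      using hg by (auto simp: PMV_simps fun_eq_iff compose_def restrict_def)
    show "Comp PMV (N, J) (?\<Gamma>, h ` J) (N, J) (restrict ?g (carrier ?\<Gamma>)) (restrict h (carrier N)) = Id PMV (N, J)"
      using gh hc by (auto simp: PMV_simps fun_eq_iff compose_def restrict_def)
  qed
  then show ?thesis using X unfolding ZNJ
    by (intro bexI[OF _ X] exI) (simp add: Gamma_I_simps ideal_hull_Gamma[OF hJ])
qed

theorem theorem6p8:
  assumes "infinite (UNIV :: 'u set)"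
  shows "categorical_equivalence
    (PUALG :: ('u pualg_obj, 'u \<Rightarrow> 'u) category)
    (PMV :: ('u pmv_obj, 'u \<Rightarrow> 'u) category)
    Gamma_I"
  by (rule categorical_equivalenceI[OF Gamma_I_is_functor Gamma_I_faithful Gamma_I_full Gamma_I_surj[OF assms]])

end
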